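(* Let $\tilde Y^{\tilde\nu}$ denote the second component of the unique solution $(\tilde X^{\tilde\nu},\tilde Y^{\tilde\nu},\tilde\nu)$, $\tilde\nu\in\mathcal A$, of the mean field FBSDE system (MF). Then the unique solution $(\hat v^i)_{i\in\mathbb N}\subset\mathcal A$ to the infinite player mean field game (i.e. its unique Nash equilibrium) is given in linear feedback form by $$\hat v^i_t=\frac{R'(T-t)}{R(T-t)}X^{\hat v^i}_t-\frac1{2\lambda}E_t\left[\int_t^T\frac{R(T-s)}{R(T-t)}\left(dA_s-\kappa\,d\tilde Y^{\tilde\nu}_s\right)+\sqrt{\frac\phi\lambda}\,\frac{\kappa}{R(T-t)}\tilde Y^{\tilde\nu}_T\right]$$ for all $t\in(0,T)$, where $$R(t)=\sqrt{\phi/\lambda}\,\cosh(\sqrt{\phi/\lambda}\,t)+\frac{\varrho}{\lambda}\sinh(\sqrt{\phi/\lambda}\,t).$$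
   Context: Fix $T>0$ and a filtered probability space $(\Omega,\mathcal F,(\mathcal F_t)_{0\le t\le T},\mathbb P)$ satisfying the usual conditions of right continuity and completeness; $E_t$ denotes conditional expectation given $\mathcal F_t$. Fix constants $\kappa,\gamma,\rho,\lambda,\phi,\varrho,y>0$. The process $P=(P_t)_{0\le t\le T}$ belongs to $\mathcal H^2$: it is a special semimartingale with canonical decomposition $P=L+A$ into a (local) martingale $L$ and a predictable finite-variation process $A$ such that $E[\langle L\rangle_T]+E[(\int_0^T|dA_s|)^2]<\infty$. Admissible controls: $\mathcal A=\{v: v \text{ progressively measurable},\ E[\int_0^Tv_s^2ds]<\infty\}$. Mean field game. Agents $i\in\mathbb N$ have initial positions $x^i\in\mathbb R$ such that the limit $\tilde x=\lim_{N\to\infty}\frac1N\sum_{i=1}^Nx^i\in\mathbb R$ exists (standing assumption). For $v^i\in\mathcal A$ put $X^{v^i}_t=x^i-\int_0^tv^i_sds$; for $\nu\in\mathcal A$ put $Y^\nu_t=e^{-\rho t}y+\gamma\int_0^te^{-\rho(t-s)}\nu_sds$, $S^\nu_t=P_t-\kappa Y^\nu_t$ and $$J^{i,\infty}(v^i;\nu)=E\Big[\int_0^TS^\nu_tv^i_tdt-\lambda\int_0^T(v^i_t)^2dt-\phi\int_0^T(X^{v^i}_t)^2dt+X^{v^i}_T(P_T-\varrho X^{v^i}_T)\Big].$$ A collection $(\hat v^i)_{i\in\mathbb N}\subset\mathcal A$ is a Nash equilibrium of the mean field game if for each $i$ the strategy $\hat v^i$ maximizes $J^{i,\infty}(\cdot;\hat\nu)$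 over $\mathcal A$, where $\hat\nu\in\mathcal A$ satisfies $\hat\nu_t=\lim_{N\to\infty}\frac1N\sum_{i=1}^N\hat v^i_t$ $d\mathbb P\otimes dt$-a.e. on $\Omega\times[0,T]$. System (MF), unknowns including the square integrable martingale $\tilde L$: $$\begin{aligned}d\tilde X_t^{\tilde\nu}&=-\tilde\nu_tdt,\quad\tilde X_0^{\tilde\nu}=\tilde x,\\ d\tilde Y_t^{\tilde\nu}&=-\rho\tilde Y_t^{\tilde\nu}dt+\gamma\tilde\nu_tdt,\quad\tilde Y_0^{\tilde\nu}=y,\\ d\tilde\nu_t&=\tfrac{dP_t}{2\lambda}+\tfrac{\kappa\rho}{2\lambda}\tilde Y_t^{\tilde\nu}dt-\tfrac{\kappa\gamma}{2\lambda}\tilde\nu_tdt-\tfrac\phi\lambda\tilde X_t^{\tilde\nu}dt+d\tilde L_t,\quad\tilde\nu_T=\tfrac\varrho\lambda\tilde X_T^{\tilde\nu}-\tfrac\kappa{2\lambda}\tilde Y_T^{\tilde\nu}.\end{aligned}$$ *)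

theory Defs
  imports "HOL-Probability.Probability"
begin

section \<open>Stochastic processes on a finite horizon\<close>

text \<open>
  The library's \<open>filtration\<close> is indexed by a whole linear order, here the reals. Only the
  \<open>\<sigma>\<close>-algebras \<open>F t\<close> with \<open>0 \<le> t \<le> T\<close> play a role below: a filtration on \<open>[0,T]\<close> is thought of
  as being frozen outside that interval.
\<close>

locale usual_filtered_prob_space =
  prob_space M + filtration "space M" F
  for M :: "'a measure" and F :: "real \<Rightarrow> 'a measure" +
  fixes T :: real
  assumes T_pos: "0 < T"
    and subalgebra_F: "\<And>t. 0 \<le> t \<Longrightarrow> t \<le> T \<Longrightarrow> subalgebra M (F t)"
    and right_continuous_F: "\<And>t. 0 \<le> t \<Longrightarrow> t < T \<Longrightarrow> sets (F t) = (\<Inter>s\<in>{t<..T}. sets (F s))"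
    and complete_F: "\<And>N B. N \<in> null_sets M \<Longrightarrow> B \<subseteq> N \<Longrightarrow> B \<in> sets (F 0)"

definition adapted :: "(real \<Rightarrow> 'a measure) \<Rightarrow> real \<Rightarrow> (real \<Rightarrow> 'a \<Rightarrow> real) \<Rightarrow> bool" where
  "adapted F T X \<longleftrightarrow> (\<forall>t\<in>{0..T}. X t \<in> borel_measurable (F t))"

definition progressively_measurable ::
    "(real \<Rightarrow> 'a measure) \<Rightarrow> real \<Rightarrow> (real \<Rightarrow> 'a \<Rightarrow> real) \<Rightarrow> bool" where
  "progressively_measurable F T X \<longleftrightarrow>
    (\<forall>t\<in>{0..T}. (\<lambda>(s, \<omega>). X s \<omega>) \<in> borel_measurable (restrict_space borel {0..t} \<Otimes>\<^sub>M F t))"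

definition predictable_sigma ::
    "'a measure \<Rightarrow> (real \<Rightarrow> 'a measure) \<Rightarrow> real \<Rightarrow> (real \<times> 'a) measure" where
  "predictable_sigma M F T = sigma ({0..T} \<times> space M)
     ({{0} \<times> B | B. B \<in> sets (F 0)} \<union>
      {{s<..t} \<times> B | s t B. 0 \<le> s \<and> s < t \<and> t \<le> T \<and> B \<in> sets (F s)})"

definition predictable ::
    "'a measure \<Rightarrow> (real \<Rightarrow> 'a measure) \<Rightarrow> real \<Rightarrow> (real \<Rightarrow> 'a \<Rightarrow> real) \<Rightarrow> bool" where
  "predictable M F T X \<longleftrightarrow> (\<lambda>(t, \<omega>). X t \<omega>) \<in> borel_measurable (predictable_sigma M F T)"

definition cadlag_on :: "real \<Rightarrow> (real \<Rightarrow> real) \<Rightarrow> bool" where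
  "cadlag_on T g \<longleftrightarrow>
    (\<forall>t\<in>{0..<T}. (g \<longlongrightarrow> g t) (at_right t)) \<and>
    (\<forall>t\<in>{0<..T}. \<exists>l. (g \<longlongrightarrow> l) (at_left t))"

definition martingale ::
    "'a measure \<Rightarrow> (real \<Rightarrow> 'a measure) \<Rightarrow> real \<Rightarrow> (real \<Rightarrow> 'a \<Rightarrow> real) \<Rightarrow> bool" where
  "martingale M F T X \<longleftrightarrow>
    adapted F T X \<and> (AE \<omega> in M. cadlag_on T (\<lambda>t. X t \<omega>)) \<and>
    (\<forall>t\<in>{0..T}. integrable M (X t)) \<and>
    (\<forall>s\<in>{0..T}. \<forall>t\<in>{s..T}. AE \<omega> in M. real_cond_exp M (F s) (X t) \<omega> = X s \<omega>)"

definition square_integrable_martingale ::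
    "'a measure \<Rightarrow> (real \<Rightarrow> 'a measure) \<Rightarrow> real \<Rightarrow> (real \<Rightarrow> 'a \<Rightarrow> real) \<Rightarrow> bool" where
  "square_integrable_martingale M F T X \<longleftrightarrow>
    martingale M F T X \<and> (\<forall>t\<in>{0..T}. integrable M (\<lambda>\<omega>. (X t \<omega>)\<^sup>2))"

text \<open>
  On the compact horizon \<open>[0,T]\<close> a localizing sequence increases to \<open>T\<close> and reaches it almost surely
  after finitely many steps. Multiplying the stopped process by the indicator of \<open>\<tau> n > 0\<close> avoids
  integrability requirements on \<open>X 0\<close>.
\<close>

definition local_martingale ::
    "'a measure \<Rightarrow> (real \<Rightarrow> 'a measure) \<Rightarrow> real \<Rightarrow> (real \<Rightarrow> 'a \<Rightarrow> real) \<Rightarrow> bool" where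
  "local_martingale M F T X \<longleftrightarrow>
    adapted F T X \<and> (AE \<omega> in M. cadlag_on T (\<lambda>t. X t \<omega>)) \<and>
    (\<exists>\<tau> :: nat \<Rightarrow> 'a \<Rightarrow> real.
      (\<forall>n. stopping_time F (\<tau> n)) \<and>
      (\<forall>n. \<forall>\<omega>\<in>space M. 0 \<le> \<tau> n \<omega> \<and> \<tau> n \<omega> \<le> \<tau> (Suc n) \<omega> \<and> \<tau> n \<omega> \<le> T) \<and>
      (AE \<omega> in M. \<exists>n. \<tau> n \<omega> = T) \<and>
      (\<forall>n. martingale M F T (\<lambda>t \<omega>. if 0 < \<tau> n \<omega> then X (min t (\<tau> n \<omega>)) \<omega> else 0)))"

text \<open>
  \<open>Q\<close> is the predictable quadratic variation (angle bracket) of \<open>L\<close>. The convention is that the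
  bracket starts at \<open>L\<^sub>0\<^sup>2\<close>, so that its integrability also controls the initial value.
\<close>

definition is_predictable_quadratic_variation ::
    "'a measure \<Rightarrow> (real \<Rightarrow> 'a measure) \<Rightarrow> real \<Rightarrow> (real \<Rightarrow> 'a \<Rightarrow> real) \<Rightarrow> (real \<Rightarrow> 'a \<Rightarrow> real) \<Rightarrow> bool"
  where
  "is_predictable_quadratic_variation M F T L Q \<longleftrightarrow>
    predictable M F T Q \<and>
    (AE \<omega> in M. cadlag_on T (\<lambda>t. Q t \<omega>) \<and> mono_on {0..T} (\<lambda>t. Q t \<omega>) \<and> Q 0 \<omega> = (L 0 \<omega>)\<^sup>2) \<and>
    local_martingale M F T (\<lambda>t \<omega>. (L t \<omega>)\<^sup>2 - Q t \<omega>)"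

definition total_variation :: "(real \<Rightarrow> real) \<Rightarrow> real \<Rightarrow> real \<Rightarrow> ennreal" where
  "total_variation g a b =
    (SUP (n, p) \<in> {(n :: nat, p :: nat \<Rightarrow> real). mono p \<and> range p \<subseteq> {a..b}}.
       \<Sum>i<n. ennreal \<bar>g (p (Suc i)) - g (p i)\<bar>)"

text \<open>
  Lebesgue--Stieltjes integral of \<open>f\<close> against a right-continuous \<open>g\<close> of finite variation over the
  half-open interval \<open>(a,b]\<close>, through the decomposition \<open>g = V - (V - g)\<close> of \<open>g\<close> into two
  nondecreasing functions, \<open>V s\<close> being the variation of \<open>g\<close> on \<open>[a,s]\<close>. Outside \<open>[a,b]\<close> the
  integrators are extended as constants.
\<close>

definition stieltjes_integral ::
    "(real \<Rightarrow> real) \<Rightarrow> (real \<Rightarrow> real) \<Rightarrow> real \<Rightarrow> real \<Rightarrow> real" where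
  "stieltjes_integral f g a b =
    (let c = (\<lambda>s. min b (max a s)); V = (\<lambda>s. enn2real (total_variation g a (c s))) in
      (LINT s:{a<..b}|interval_measure V. f s) -
      (LINT s:{a<..b}|interval_measure (\<lambda>s. V s - g (c s)). f s))"

text \<open>
  \<open>P\<close> is a special semimartingale with canonical decomposition \<open>P = L + A\<close> (normalized by
  \<open>A\<^sub>0 = 0\<close>) that belongs to the space \<open>\<H>\<^sup>2\<close>.
\<close>

definition H2_semimartingale ::
    "'a measure \<Rightarrow> (real \<Rightarrow> 'a measure) \<Rightarrow> real \<Rightarrow>
     (real \<Rightarrow> 'a \<Rightarrow> real) \<Rightarrow> (real \<Rightarrow> 'a \<Rightarrow> real) \<Rightarrow> (real \<Rightarrow> 'a \<Rightarrow> real) \<Rightarrow> bool" where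
  "H2_semimartingale M F T P L A \<longleftrightarrow>
    (AE \<omega> in M. \<forall>t\<in>{0..T}. P t \<omega> = L t \<omega> + A t \<omega>) \<and>
    local_martingale M F T L \<and>
    predictable M F T A \<and>
    (AE \<omega> in M. A 0 \<omega> = 0 \<and> cadlag_on T (\<lambda>t. A t \<omega>) \<and> total_variation (\<lambda>t. A t \<omega>) 0 T < \<infinity>) \<and>
    (\<exists>Q. is_predictable_quadratic_variation M F T L Q \<and> (\<integral>\<^sup>+\<omega>. ennreal (Q T \<omega>) \<partial>M) < \<infinity>) \<and>
    (\<integral>\<^sup>+\<omega>. (total_variation (\<lambda>t. A t \<omega>) 0 T)\<^sup>2 \<partial>M) < \<infinity>"

section \<open>The mean field game\<close>

definition admissible ::
    "'a measure \<Rightarrow> (real \<Rightarrow> 'a measure) \<Rightarrow> real \<Rightarrow> (real \<Rightarrow> 'a \<Rightarrow> real) set" where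
  "admissible M F T =
    {v. progressively_measurable F T v \<and>
        (\<integral>\<^sup>+\<omega>. (\<integral>\<^sup>+s\<in>{0..T}. ennreal ((v s \<omega>)\<^sup>2) \<partial>lborel) \<partial>M) < \<infinity>}"

definition inventory :: "real \<Rightarrow> (real \<Rightarrow> 'a \<Rightarrow> real) \<Rightarrow> real \<Rightarrow> 'a \<Rightarrow> real" where
  "inventory x v t \<omega> = x - (LBINT s:{0..t}. v s \<omega>)"

definition transient_impact ::
    "real \<Rightarrow> real \<Rightarrow> real \<Rightarrow> (real \<Rightarrow> 'a \<Rightarrow> real) \<Rightarrow> real \<Rightarrow> 'a \<Rightarrow> real" where
  "transient_impact \<gamma> \<rho> y \<nu> t \<omega> =
    exp (- \<rho> * t) * y + \<gamma> * (LBINT s:{0..t}. exp (- \<rho> * (t - s)) * \<nu> s \<omega>)"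

definition objective ::
    "'a measure \<Rightarrow> real \<Rightarrow> real \<Rightarrow> real \<Rightarrow> real \<Rightarrow> real \<Rightarrow> real \<Rightarrow> real \<Rightarrow> real \<Rightarrow>
     (real \<Rightarrow> 'a \<Rightarrow> real) \<Rightarrow> real \<Rightarrow> (real \<Rightarrow> 'a \<Rightarrow> real) \<Rightarrow> (real \<Rightarrow> 'a \<Rightarrow> real) \<Rightarrow> real" where
  "objective M T \<kappa> \<gamma> \<rho> lam \<phi> varrho y P x v \<nu> =
    (let X = inventory x v; S = (\<lambda>t \<omega>. P t \<omega> - \<kappa> * transient_impact \<gamma> \<rho> y \<nu> t \<omega>) in
      LINT \<omega>|M.
        (LBINT t:{0..T}. S t \<omega> * v t \<omega>)
        - lam * (LBINT t:{0..T}. (v t \<omega>)\<^sup>2)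
        - \<phi> * (LBINT t:{0..T}. (X t \<omega>)\<^sup>2)
        + X T \<omega> * (P T \<omega> - varrho * X T \<omega>))"

text \<open>Agents are numbered from \<open>0\<close>, so the first \<open>N\<close> agents are those with index \<open>i < N\<close>.\<close>

definition mfg_nash_equilibrium ::
    "'a measure \<Rightarrow> (real \<Rightarrow> 'a measure) \<Rightarrow> real \<Rightarrow>
     real \<Rightarrow> real \<Rightarrow> real \<Rightarrow> real \<Rightarrow> real \<Rightarrow> real \<Rightarrow> real \<Rightarrow>
     (real \<Rightarrow> 'a \<Rightarrow> real) \<Rightarrow> (nat \<Rightarrow> real) \<Rightarrow> (nat \<Rightarrow> real \<Rightarrow> 'a \<Rightarrow> real) \<Rightarrow> bool" where
  "mfg_nash_equilibrium M F T \<kappa> \<gamma> \<rho> lam \<phi> varrho y P x v \<longleftrightarrow>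
    (\<forall>i. v i \<in> admissible M F T) \<and>
    (\<exists>\<nu>\<in>admissible M F T.
      (AE (\<omega>, t) in M \<Otimes>\<^sub>M restrict_space lborel {0..T}.
         (\<lambda>N. (\<Sum>i<N. v i t \<omega>) / real N) \<longlonglongrightarrow> \<nu> t \<omega>) \<and>
      (\<forall>i. \<forall>w\<in>admissible M F T.
         objective M T \<kappa> \<gamma> \<rho> lam \<phi> varrho y P (x i) w \<nu>
         \<le> objective M T \<kappa> \<gamma> \<rho> lam \<phi> varrho y P (x i) (v i) \<nu>))"

text \<open>
  The equations of the mean field FBSDE in integrated form, holding simultaneously for all times
  outside a null set. The martingale \<open>N\<close> is part of the unknowns.
\<close>

definition mean_field_fbsde_solution ::
    "'a measure \<Rightarrow> (real \<Rightarrow> 'a measure) \<Rightarrow> real \<Rightarrow>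
     real \<Rightarrow> real \<Rightarrow> real \<Rightarrow> real \<Rightarrow> real \<Rightarrow> real \<Rightarrow> real \<Rightarrow> (real \<Rightarrow> 'a \<Rightarrow> real) \<Rightarrow> real \<Rightarrow>
     (real \<Rightarrow> 'a \<Rightarrow> real) \<Rightarrow> (real \<Rightarrow> 'a \<Rightarrow> real) \<Rightarrow> (real \<Rightarrow> 'a \<Rightarrow> real) \<Rightarrow> bool" where
  "mean_field_fbsde_solution M F T \<kappa> \<gamma> \<rho> lam \<phi> varrho y P x X Y \<nu> \<longleftrightarrow>
    \<nu> \<in> admissible M F T \<and>
    (\<exists>N. square_integrable_martingale M F T N \<and>
      (AE \<omega> in M.
        set_integrable lborel {0..T} (\<lambda>s. X s \<omega>) \<and>
        set_integrable lborel {0..T} (\<lambda>s. Y s \<omega>) \<and>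
        (\<forall>t\<in>{0..T}.
          X t \<omega> = x - (LBINT s:{0..t}. \<nu> s \<omega>) \<and>
          Y t \<omega> = y + (LBINT s:{0..t}. - \<rho> * Y s \<omega> + \<gamma> * \<nu> s \<omega>) \<and>
          \<nu> t \<omega> = \<nu> 0 \<omega> + (P t \<omega> - P 0 \<omega>) / (2 * lam)
            + (LBINT s:{0..t}. \<kappa> * \<rho> / (2 * lam) * Y s \<omega> - \<kappa> * \<gamma> / (2 * lam) * \<nu> s \<omega>
                 - \<phi> / lam * X s \<omega>)
            + (N t \<omega> - N 0 \<omega>)) \<and>
        \<nu> T \<omega> = varrho / lam * X T \<omega> - \<kappa> / (2 * lam) * Y T \<omega>))"

definition R_fun :: "real \<Rightarrow> real \<Rightarrow> real \<Rightarrow> real \<Rightarrow> real" where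
  "R_fun lam \<phi> varrho t =
    sqrt (\<phi> / lam) * cosh (sqrt (\<phi> / lam) * t) + varrho / lam * sinh (sqrt (\<phi> / lam) * t)"

end

theory Submission
  imports Defs
begin

text \<open>
  The best response problem of an agent is linear-quadratic and strictly concave, so a strategy is
  optimal iff the directional derivatives of the payoff vanish. Integrating the system (MF) from \<open>t\<close> to
  \<open>T\<close> turns the first order condition into orthogonality of adapted processes to the martingale
  increments \<open>N\<^sub>T - N\<^sub>t\<close>. As the optimality system is linear, the best response started from \<open>x\<close>
  instead of \<open>xbar\<close> differs from \<open>\<nu>\<close> by the deterministic function \<open>(x - xbar) R'(T - t) / R(T)\<close>; these
  responses average to \<open>\<nu>\<close> and hence form an equilibrium. The feedback formula is the conditional
  expectation of the identity obtained from integrating \<open>R(T - s)\<close> against the dynamics of \<open>\<nu>\<close>, with every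
  integral rewritten by parts, so that no stochastic integral is needed.

  For a second equilibrium, the deviations \<open>w i - v i\<close> solve one and the same strictly convex problem, so
  they equal a common process \<open>d\<close>, by which the mean fields then differ as well. Testing the first order
  conditions with \<open>d\<close> gives \<open>d = 0\<close>, because the kernel \<open>exp (- \<rho> (t - s))\<close> is positive definite.
\<close>

subsection \<open>Integration by parts and functions of bounded variation\<close>

text \<open>The data are rougher than the argument wants. \<open>P\<close> and the martingale in
  (MF) are only almost surely cadlag, whereas every use of Fubini needs joint measurability in time
  and scenario; it is obtained for versions, and completeness of the filtration makes the
  exceptional null sets harmless. The part \<open>L\<close> of \<open>P\<close> is a local
  martingale with integrable bracket and must first be shown to be a true martingale, bounded in L2.
  From then on the martingale property is carried as equality of integrals over the sets of
  \<open>F t\<close>, a form that survives changes of version and integration over time.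
  \<open>R\<close> is the solution of r'' = (\<phi>/lam) r with lam r'(0) = varrho r(0), scaled so
  that r(0) = sqrt (\<phi>/lam). The equation cancels the running inventory cost when the dynamics
  of \<nu> are weighted with \<open>R (T - s)\<close>, and the condition at 0 cancels the terminal
  inventory. The terminal impact is not cancelled: it stays in the formula with the weight R(0)/R(T
  - t). The Stieltjes integrals of the formula are defined path by path through the variation
  function, so they have to be reduced to Lebesgue integrals before expectations can be taken; this
  is why total variation is studied at the start.\<close>

lemma ac_by_parts:
  fixes F G f g :: "real \<Rightarrow> real"
  assumes ab: "a \<le> b"
    and f: "set_integrable lborel {a..b} f" and g: "set_integrable lborel {a..b} g"
    and F: "\<And>t. t \<in> {a..b} \<Longrightarrow> F t = F a + (LBINT s:{a..t}. f s)"
    and G: "\<And>t. t \<in> {a..b} \<Longrightarrow> G t = G a + (LBINT s:{a..t}. g s)"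
  shows "set_integrable lborel {a..b} (\<lambda>s. f s * G s + F s * g s)"
    and "(LBINT s:{a..b}. f s * G s + F s * g s) = F b * G b - F a * G a"
proof -
  define f1 where "f1 s = indicator {a..b} s * f s" for s
  define g1 where "g1 s = indicator {a..b} s * g s" for s
  have f1[measurable]: "integrable lborel f1" and g1[measurable]: "integrable lborel g1"
    using f g by (simp_all add: f1_def[abs_def] g1_def[abs_def] set_integrable_def)
  have [measurable]: "f1 \<in> borel_measurable borel" "g1 \<in> borel_measurable borel"
    using borel_measurable_integrable[OF f1] borel_measurable_integrable[OF g1] by auto
  have h: "integrable (lborel \<Otimes>\<^sub>M lborel) (\<lambda>(s,u). f1 s * g1 u)"
  proof (rule lborel_pair.Fubini_integrable)
    show "integrable lborel (\<lambda>x. \<integral>y. norm (case (x, y) of (s, u) \<Rightarrow> f1 s * g1 u) \<partial>lborel)"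
      using f1 by (simp add: abs_mult)
    show "AE x in lborel. integrable lborel (\<lambda>y. case (x, y) of (s, u) \<Rightarrow> f1 s * g1 u)"
      using g1 by simp
  qed measurable
  \<comment> \<open>The square is cut along its diagonal. Integrating over u first on the triangle
    \<open>u \<le> s\<close> yields the increment of \<open>G\<close>; integrating over s first on
    the other one yields the increment of \<open>F\<close>.\<close>
  have h1: "integrable (lborel \<Otimes>\<^sub>M lborel) (\<lambda>(s,u). if u \<le> s then f1 s * g1 u else 0)"
    and h2: "integrable (lborel \<Otimes>\<^sub>M lborel) (\<lambda>(s,u). if u \<le> s then 0 else f1 s * g1 u)"
    by (rule Bochner_Integration.integrable_bound[OF h]; auto split: if_splits; fail)+
  have i1: "(\<integral>u. (if u \<le> s then f1 s * g1 u else 0) \<partial>lborel) = indicator {a..b} s * (f s * (G s - G a))" for s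
  proof (cases "s \<in> {a..b}")
    case True
    have "(\<integral>u. (if u \<le> s then f1 s * g1 u else 0) \<partial>lborel) = (\<integral>u. f1 s * (indicator {a..s} u *\<^sub>R g u) \<partial>lborel)"
      by (intro Bochner_Integration.integral_cong) (use True in \<open>auto simp: g1_def indicator_def\<close>)
    with True G[OF True] show ?thesis by (simp add: set_lebesgue_integral_def f1_def)
  qed (simp add: f1_def cong: if_cong)
  have i2: "(\<integral>s. (if u \<le> s then 0 else f1 s * g1 u) \<partial>lborel) = indicator {a..b} u * ((F u - F a) * g u)" for u
  proof (cases "u \<in> {a..b}")
    case True
    \<comment> \<open>The diagonal point \<open>s = u\<close> belongs to the other triangle. It is a
      null set, hence an almost everywhere comparison here and a pointwise one in
      \<open>i1\<close>.\<close>
    have "(\<integral>s. (if u \<le> s then 0 else f1 s * g1 u) \<partial>lborel) = (\<integral>s. (indicator {a..u} s *\<^sub>R f s) * g1 u \<partial>lborel)"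
      by (intro integral_cong_AE borel_measurable_times)
         (use True set_borel_measurable_def[of lborel "{a..u}" f] set_integrable_subset[OF f, of "{a..u}"] AE_lborel_singleton[of u]
          in \<open>auto simp: f1_def set_integrable_def indicator_def intro: borel_measurable_integrable elim!: eventually_mono\<close>)
    with True F[OF True] show ?thesis by (simp add: set_lebesgue_integral_def g1_def)
  qed (simp add: g1_def cong: if_cong)
  have j1: "integrable lborel (\<lambda>s. indicator {a..b} s * (f s * (G s - G a)))"
    using lborel_pair.integrable_fst[OF h1] by (simp add: i1)
  have j2: "integrable lborel (\<lambda>u. indicator {a..b} u * ((F u - F a) * g u))"
    using lborel_pair.integrable_snd[OF h2] by (simp add: i2)
  have "(F b - F a) * (G b - G a) = (\<integral>s. f1 s \<partial>lborel) * (\<integral>u. g1 u \<partial>lborel)"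
    using F[of b] G[of b] ab by (simp add: set_lebesgue_integral_def f1_def g1_def)
  also have "\<dots> = (\<integral>s. (\<integral>u. f1 s * g1 u \<partial>lborel) \<partial>lborel)" by simp
  also have "\<dots> = integral\<^sup>L (lborel \<Otimes>\<^sub>M lborel) (\<lambda>(s,u). f1 s * g1 u)"
    using lborel_pair.integral_fst[OF h] by simp
  also have "\<dots> = integral\<^sup>L (lborel \<Otimes>\<^sub>M lborel) (\<lambda>x. (\<lambda>(s,u). if u \<le> s then f1 s * g1 u else 0) x +
     (\<lambda>(s,u). if u \<le> s then 0 else f1 s * g1 u) x)"
    by (intro Bochner_Integration.integral_cong) auto
  also have "\<dots> = (\<integral>s. indicator {a..b} s * (f s * (G s - G a)) \<partial>lborel) + (\<integral>u. indicator {a..b} u * ((F u - F a) * g u) \<partial>lborel)"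
    using lborel_pair.integral_fst[OF h1] lborel_pair.integral_snd[OF h2]
    by (subst Bochner_Integration.integral_add[OF h1 h2]) (simp add: i1 i2)
  finally have e: "(F b - F a) * (G b - G a) = \<dots>" .
  have k: "indicator {a..b} s *\<^sub>R (f s * G s + F s * g s) = indicator {a..b} s * (f s * (G s - G a)) +
     indicator {a..b} s * ((F s - F a) * g s) + G a * f1 s + F a * g1 s" for s
    by (simp add: f1_def g1_def algebra_simps)
  show "set_integrable lborel {a..b} (\<lambda>s. f s * G s + F s * g s)"
    unfolding set_integrable_def k
    by (intro Bochner_Integration.integrable_add j1 j2 integrable_mult_right f1 g1)
  have "(LBINT s:{a..b}. f s * G s + F s * g s) = (F b - F a) * (G b - G a) + G a * (\<integral>s. f1 s \<partial>lborel) + F a * (\<integral>s. g1 s \<partial>lborel)"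
    unfolding set_lebesgue_integral_def k e using j1 j2 f1 g1 by simp
  also have "\<dots> = F b * G b - F a * G a"
    using F[of b] G[of b] ab by (simp add: set_lebesgue_integral_def f1_def g1_def algebra_simps)
  finally show "(LBINT s:{a..b}. f s * G s + F s * g s) = F b * G b - F a * G a" .
qed

lemma LBINT_FTC:
  fixes f f' :: "real \<Rightarrow> real"
  assumes "a \<le> b" "\<And>s. (f has_real_derivative f' s) (at s)" "continuous_on UNIV f'"
  shows "f b = f a + (LBINT s:{a..b}. f' s)"
proof -
  have "(\<integral>x. indicator {a..b} x *\<^sub>R f' x \<partial>lborel) = f b - f a"
    using assms by (intro integral_FTC_atLeastAtMost)
      (auto simp flip: has_real_derivative_iff_has_vector_derivative intro: has_field_derivative_at_within continuous_on_subset)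
  then show ?thesis by (simp add: set_lebesgue_integral_def)
qed

section \<open>Total variation of a path and Stieltjes integrals\<close>

lemma total_variation_upper:
  assumes "mono p" "range p \<subseteq> {a..b}"
  shows "(\<Sum>i<n. ennreal \<bar>g (p (Suc i)) - g (p i)\<bar>) \<le> total_variation g a b"
  unfolding total_variation_def by (rule SUP_upper2[of "(n, p)"]) (use assms in auto)

lemma total_variation_least:
  assumes "\<And>p n. mono p \<Longrightarrow> range p \<subseteq> {a..b} \<Longrightarrow> (\<Sum>i<n. ennreal \<bar>g (p (Suc i)) - g (p i)\<bar>) \<le> c"
  shows "total_variation g a b \<le> c"
  unfolding total_variation_def by (rule SUP_least) (use assms in auto)

lemma total_variation_ge_abs:
  assumes "a \<le> s" "s \<le> t" "t \<le> b"
  shows "ennreal \<bar>g t - g s\<bar> \<le> total_variation g a b"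
  using total_variation_upper[of "\<lambda>i. if i = 0 then s else t" a b g 1] assms
  by (simp add: mono_def image_subset_iff)

lemma total_variation_mono:
  assumes "a \<le> a'" "b' \<le> b"
  shows "total_variation g a' b' \<le> total_variation g a b"
proof (rule total_variation_least)
  fix p :: "nat \<Rightarrow> real" and n assume "mono p" "range p \<subseteq> {a'..b'}"
  moreover from this have "range p \<subseteq> {a..b}" using assms by fastforce
  ultimately show "(\<Sum>i<n. ennreal \<bar>g (p (Suc i)) - g (p i)\<bar>) \<le> total_variation g a b"
    by (intro total_variation_upper)
qed

text \<open>A supremum in \<open>ennreal\<close> commutes with adding a constant over a nonempty
  index set, and the constant partition at a shows that this one is nonempty. Applied to each
  summand in turn, the rule bounds a sum of two variations.\<close>

lemma total_variation_add_least:
  assumes "a \<le> b"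
    and "\<And>p n. mono p \<Longrightarrow> range p \<subseteq> {a..b} \<Longrightarrow> (\<Sum>i<n. ennreal \<bar>g (p (Suc i)) - g (p i)\<bar>) + c \<le> d"
  shows "total_variation g a b + c \<le> d"
proof -
  have "{(n :: nat, p :: nat \<Rightarrow> real). mono p \<and> range p \<subseteq> {a..b}} \<noteq> {}"
    using assms(1) by (auto intro!: exI[of _ "\<lambda>_. a"] simp: mono_def)
  then show ?thesis
    unfolding total_variation_def using assms(2)
    by (subst ennreal_SUP_add_left[symmetric]) (auto intro!: SUP_least)
qed

text \<open>Clipping with \<open>min\<close> and \<open>max\<close> keeps a partition monotone, so u
  does not have to be inserted as a partition point. A step on one side of u survives in one sum and
  is constant in the other; a step across u is covered by the triangle inequality.\<close>

lemma variation_sum_split: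
  assumes "mono p"
  shows "(\<Sum>i<n. ennreal \<bar>g (p (Suc i)) - g (p i)\<bar>)
    \<le> (\<Sum>i<n. ennreal \<bar>g (min (p (Suc i)) u) - g (min (p i) u)\<bar>)
      + (\<Sum>i<n. ennreal \<bar>g (max (p (Suc i)) u) - g (max (p i) (u::real))\<bar>)"
  unfolding sum.distrib[symmetric]
proof (rule sum_mono)
  fix i
  have "p i \<le> p (Suc i)" using assms by (auto simp: mono_def)
  then have "\<bar>g (p (Suc i)) - g (p i)\<bar> \<le> \<bar>g (min (p (Suc i)) u) - g (min (p i) u)\<bar> + \<bar>g (max (p (Suc i)) u) - g (max (p i) u)\<bar>"
    by (auto simp: min_def max_def)
  then show "ennreal \<bar>g (p (Suc i)) - g (p i)\<bar> \<le> ennreal \<bar>g (min (p (Suc i)) u) - g (min (p i) u)\<bar>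
     + ennreal \<bar>g (max (p (Suc i)) u) - g (max (p i) u)\<bar>"
    by (simp flip: ennreal_plus)
qed

lemma total_variation_split:
  assumes "a \<le> u" "u \<le> b"
  shows "total_variation g a b = total_variation g a u + total_variation g u b"
proof (rule antisym)
  show "total_variation g a b \<le> total_variation g a u + total_variation g u b"
  proof (rule total_variation_least)
    fix p :: "nat \<Rightarrow> real" and n assume p: "mono p" "range p \<subseteq> {a..b}"
    have "(\<Sum>i<n. ennreal \<bar>g (min (p (Suc i)) u) - g (min (p i) u)\<bar>) \<le> total_variation g a u"
      using p assms by (intro total_variation_upper) (auto simp: mono_def min_le_iff_disj image_subset_iff)
    moreover have "(\<Sum>i<n. ennreal \<bar>g (max (p (Suc i)) u) - g (max (p i) u)\<bar>) \<le> total_variation g u b"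
      using p assms by (intro total_variation_upper monoI max.mono) (auto simp: monoD image_subset_iff le_max_iff_disj)
    ultimately show "(\<Sum>i<n. ennreal \<bar>g (p (Suc i)) - g (p i)\<bar>) \<le> total_variation g a u + total_variation g u b"
      using variation_sum_split[OF p(1), where g=g and u=u and n=n] add_mono order_trans by blast
  qed
  have *: "(\<Sum>i<n. ennreal \<bar>g (p (Suc i)) - g (p i)\<bar>) + (\<Sum>i<m. ennreal \<bar>g (q (Suc i)) - g (q i)\<bar>) \<le> total_variation g a b"
    if p: "mono p" "range p \<subseteq> {a..u}" and q: "mono q" "range q \<subseteq> {u..b}" for p q :: "nat \<Rightarrow> real" and n m
  proof -
    \<comment> \<open>\<open>r\<close> runs through p up to index n and then through q. The step
      from \<open>p n\<close> to \<open>q 0\<close> sits at index n, which is the one index missing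
      from the union below.\<close>
    define r where "r i = (if i \<le> n then p i else q (i - Suc n))" for i
    have "p i \<le> q j" for i j using p q by (meson atLeastAtMost_iff order_trans rangeI subsetD)
    then have r: "mono r" using p(1) q(1) by (auto simp: mono_def r_def)
    have r': "range r \<subseteq> {a..b}"
    proof -
      have "r i \<in> {a..b}" for i
        using p(2) q(2) assms by (auto simp: r_def image_subset_iff) (meson order_trans)+
      then show ?thesis by auto
    qed
    have "(\<Sum>i<n. ennreal \<bar>g (p (Suc i)) - g (p i)\<bar>) = (\<Sum>i\<in>{..<n}. ennreal \<bar>g (r (Suc i)) - g (r i)\<bar>)"
      by (intro sum.cong) (auto simp: r_def)
    moreover have "(\<Sum>i<m. ennreal \<bar>g (q (Suc i)) - g (q i)\<bar>) = (\<Sum>i\<in>{Suc n..<Suc n + m}. ennreal \<bar>g (r (Suc i)) - g (r i)\<bar>)"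
      by (rule sum.reindex_bij_witness[where i="\<lambda>i. i - Suc n" and j="\<lambda>i. i + Suc n"]) (auto simp: r_def Suc_diff_le)
    ultimately have "(\<Sum>i<n. ennreal \<bar>g (p (Suc i)) - g (p i)\<bar>) + (\<Sum>i<m. ennreal \<bar>g (q (Suc i)) - g (q i)\<bar>)
      = (\<Sum>i\<in>{..<n} \<union> {Suc n..<Suc n + m}. ennreal \<bar>g (r (Suc i)) - g (r i)\<bar>)"
      by (subst sum.union_disjoint) auto
    also have "\<dots> \<le> (\<Sum>i<Suc n + m. ennreal \<bar>g (r (Suc i)) - g (r i)\<bar>)"
      by (intro sum_mono2) auto
    also have "\<dots> \<le> total_variation g a b" using r r' by (rule total_variation_upper)
    finally show ?thesis .
  qed
  have "total_variation g u b + (\<Sum>i<n. ennreal \<bar>g (p (Suc i)) - g (p i)\<bar>) \<le> total_variation g a b"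
    if "mono p" "range p \<subseteq> {a..u}" for p :: "nat \<Rightarrow> real" and n
    using *[OF that] assms(2) by (intro total_variation_add_least) (simp_all add: add.commute)
  then show "total_variation g a u + total_variation g u b \<le> total_variation g a b"
    using assms(1) by (intro total_variation_add_least) (simp_all add: add.commute)
qed

text \<open>
  Take a partition of \<open>[s,b]\<close> that nearly exhausts the variation and cut it at \<open>u\<close>. For \<open>u\<close> close to \<open>s\<close> the
  part on \<open>[s,u]\<close> only sees increments of size \<open>\<bar>g u - g s\<bar>\<close>, so almost all variation lies in \<open>[u,b]\<close>.
\<close>

lemma total_variation_right_small:
  fixes g :: "real \<Rightarrow> real"
  assumes su: "s < b" and fin: "total_variation g s b < \<infinity>" and rc: "(g \<longlongrightarrow> g s) (at_right s)" and e: "e > 0"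
  shows "\<forall>\<^sub>F u in at_right s. total_variation g s u < ennreal e"
proof -
  have "\<exists>p n. mono p \<and> range p \<subseteq> {s..b} \<and> total_variation g s b < (\<Sum>i<n. ennreal \<bar>g (p (Suc i)) - g (p i)\<bar>) + ennreal (e/2)"
  proof (rule ccontr)
    assume "\<not> ?thesis"
    then have "total_variation g s b + ennreal (e/2) \<le> total_variation g s b"
      using su by (intro total_variation_add_least) (auto simp: not_less)
    moreover have "total_variation g s b + 0 < total_variation g s b + ennreal (e/2)"
      using fin e by (subst ennreal_add_left_cancel_less) auto
    ultimately show False by simp
  qed
  then obtain p n where p: "mono p" "range p \<subseteq> {s..b}"
    and pn: "total_variation g s b < (\<Sum>i<n. ennreal \<bar>g (p (Suc i)) - g (p i)\<bar>) + ennreal (e/2)" by blast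
  \<comment> \<open>n increments, each at most d, have to stay within e/2; the 1 in the denominator
    covers n = 0.\<close>
  define d where "d = e / (2 * (real n + 1))"
  have d: "d > 0" using e by (simp add: d_def)
  have ev1: "\<forall>\<^sub>F u in at_right s. \<bar>g u - g s\<bar> < d"
    using tendstoD[OF rc d] by (simp add: dist_real_def)
  have ev2: "\<forall>\<^sub>F u in at_right s. \<forall>i\<in>{..n}. p i = s \<or> u < p i"
  proof (subst eventually_ball_finite_distrib, simp, rule ballI)
    fix i
    have "s \<le> p i" using p(2) by (auto simp: image_subset_iff)
    then consider "p i = s" | "s < p i" by linarith
    then show "\<forall>\<^sub>F u in at_right s. p i = s \<or> u < p i"
      by cases (auto simp: eventually_at_right_field intro!: exI[of _ "p i"])
  qed
  have ev3: "\<forall>\<^sub>F u in at_right s. s < u \<and> u < b"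
    using su by (auto simp: eventually_at_right_field)
  show ?thesis using ev1 ev2 ev3
  proof eventually_elim
    case (elim u)
    have "(\<Sum>i<n. ennreal \<bar>g (min (p (Suc i)) u) - g (min (p i) u)\<bar>) \<le> (\<Sum>i<n. ennreal d)"
    proof (rule sum_mono)
      fix i assume i: "i \<in> {..<n}"
      have "min (p i) u \<in> {s, u}" "min (p (Suc i)) u \<in> {s, u}"
        using elim i by (auto simp: min_def)
      then show "ennreal \<bar>g (min (p (Suc i)) u) - g (min (p i) u)\<bar> \<le> ennreal d"
        using elim(1) d by (intro ennreal_leI) (auto simp: abs_minus_commute)
    qed
    also have "\<dots> = ennreal (real n * d)" using d by (simp add: ennreal_mult ennreal_of_nat_eq_real_of_nat)
    also have "\<dots> \<le> ennreal (e / 2)" using e by (intro ennreal_leI) (simp add: d_def field_simps)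
    finally have a: "(\<Sum>i<n. ennreal \<bar>g (min (p (Suc i)) u) - g (min (p i) u)\<bar>) \<le> ennreal (e/2)" .
    have "(\<Sum>i<n. ennreal \<bar>g (max (p (Suc i)) u) - g (max (p i) u)\<bar>) \<le> total_variation g u b"
      using p elim by (intro total_variation_upper monoI max.mono) (auto simp: monoD image_subset_iff le_max_iff_disj)
    with a have "(\<Sum>i<n. ennreal \<bar>g (p (Suc i)) - g (p i)\<bar>) \<le> ennreal (e/2) + total_variation g u b"
      using variation_sum_split[OF p(1), where g=g and u=u and n=n] add_mono order_trans by blast
    then have "(\<Sum>i<n. ennreal \<bar>g (p (Suc i)) - g (p i)\<bar>) + ennreal (e/2) \<le> ennreal (e/2) + total_variation g u b + ennreal (e/2)"
      by (intro add_right_mono)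
    with pn have "total_variation g s b < ennreal (e/2) + total_variation g u b + ennreal (e/2)"
      by (rule less_le_trans)
    also have "\<dots> = total_variation g u b + ennreal e" using e by (simp add: ac_simps flip: ennreal_plus)
    finally have "total_variation g s u + total_variation g u b < ennreal e + total_variation g u b"
      using total_variation_split[of s u b g] elim by (simp add: add.commute)
    then show ?case using add_right_mono[of "ennreal e" "total_variation g s u" "total_variation g u b"] by (auto simp: not_le[symmetric])
  qed
qed

text \<open>Write \<open>f s - f a\<close> as the integral of \<open>f'\<close> over [a,s] and
  exchange the order of integration: the inner integral becomes the mass \<open>G b - G u\<close> of
  (u,b].\<close>

lemma interval_measure_by_parts:
  fixes f f' G :: "real \<Rightarrow> real"
  assumes mono: "mono G" and rc: "\<And>s. continuous (at_right s) G" and ab: "a \<le> b"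
    and f: "\<And>s. (f has_real_derivative f' s) (at s)" and f': "continuous_on UNIV f'"
  shows "(LINT s:{a<..b}|interval_measure G. f s) = f b * G b - f a * G a - (LBINT s:{a..b}. f' s * G s)"
    and "set_integrable lborel {a..b} (\<lambda>s. f' s * G s)"
proof -
  define \<mu> where "\<mu> = interval_measure G"
  have mG: "\<And>x y. x \<le> y \<Longrightarrow> G x \<le> G y" using mono by (simp add: monoD)
  interpret \<mu>: sigma_finite_measure \<mu> unfolding \<mu>_def using sigma_finite_interval_measure[OF mG rc] by simp
  interpret p: pair_sigma_finite lborel \<mu> ..
  have [measurable_cong]: "sets \<mu> = sets borel" by (simp add: \<mu>_def)
  have [measurable]: "f' \<in> borel_measurable borel" using f' borel_measurable_continuous_onI by blast
  have [measurable]: "f \<in> borel_measurable borel"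
    using f by (intro borel_measurable_continuous_onI) (meson DERIV_isCont continuous_at_imp_continuous_on)
  have [measurable]: "G \<in> borel_measurable borel" using mono by (rule borel_measurable_mono)
  have meas: "emeasure \<mu> {u<..b} = ennreal (G b - G u)" if "u \<le> b" for u
    unfolding \<mu>_def using that mG rc by (intro emeasure_interval_measure_Ioc) auto
  have meas': "measure \<mu> {u<..b} = G b - G u" if "u \<le> b" for u
    using meas[OF that] mG[OF that] by (simp add: measure_def)
  have bnd: "\<exists>B. \<forall>u\<in>{a..b}. norm (f' u) \<le> B"
    using compact_continuous_image[OF continuous_on_subset[OF f'], of "{a..b}"]
    by (auto dest!: compact_imp_bounded simp: bounded_iff)
  then obtain B where B: "\<And>u. u \<in> {a..b} \<Longrightarrow> norm (f' u) \<le> B" by blast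
  define h where "h = (\<lambda>(u,s). indicator {a..b} u * indicator {a<..b} s * (if u < s then f' u else 0))"
  have [measurable]: "h \<in> borel_measurable (lborel \<Otimes>\<^sub>M \<mu>)"
    unfolding h_def by measurable
  have bb: "integrable (lborel \<Otimes>\<^sub>M \<mu>) (\<lambda>x. B * indicator ({a..b} \<times> {a<..b}) x)"
    using ab meas[OF ab] by (intro integrable_mult_right integrable_real_indicator)
      (auto simp: \<mu>.emeasure_pair_measure_Times ennreal_mult_less_top)
  have h: "integrable (lborel \<Otimes>\<^sub>M \<mu>) h"
  proof (rule Bochner_Integration.integrable_bound[OF bb], simp, rule AE_I2)
    fix x show "norm (h x) \<le> norm (B * indicator ({a..b} \<times> {a<..b}) x)"
      using B[of "fst x"] by (auto simp: h_def indicator_def split: prod.split)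
  qed
  have i1: "(\<integral>u. h (u, s) \<partial>lborel) = indicator {a<..b} s * (f s - f a)" for s
  proof (cases "s \<in> {a<..b}")
    case True
    have "(\<integral>u. h (u, s) \<partial>lborel) = (\<integral>u. indicator {a..s} u *\<^sub>R f' u \<partial>lborel)"
      by (intro integral_cong_AE, (auto simp: h_def)[2])
         (use True AE_lborel_singleton[of s] in \<open>auto simp: h_def indicator_def elim!: eventually_mono\<close>)
    with True LBINT_FTC[of a s f f'] f f' show ?thesis by (simp add: set_lebesgue_integral_def)
  qed (simp add: h_def)
  have i2: "(\<integral>s. h (u, s) \<partial>\<mu>) = indicator {a..b} u * (f' u * (G b - G u))" for u
  proof (cases "u \<in> {a..b}")
    case True
    have "(\<integral>s. h (u, s) \<partial>\<mu>) = (\<integral>s. f' u * indicator {u<..b} s \<partial>\<mu>)"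
      by (intro Bochner_Integration.integral_cong) (use True in \<open>auto simp: h_def indicator_def\<close>)
    with True show ?thesis by (simp add: meas' \<mu>_def[symmetric])
  qed (simp add: h_def)
  have j1: "integrable \<mu> (\<lambda>s. indicator {a<..b} s * (f s - f a))"
    using p.integrable_snd[of "\<lambda>u s. h (u, s)"] h by (simp add: i1)
  have j2: "integrable lborel (\<lambda>u. indicator {a..b} u * (f' u * (G b - G u)))"
    using p.integrable_fst[of "\<lambda>u s. h (u, s)"] h by (simp add: i2)
  have e: "(\<integral>s. indicator {a<..b} s * (f s - f a) \<partial>\<mu>) = (\<integral>u. indicator {a..b} u * (f' u * (G b - G u)) \<partial>lborel)"
    using p.integral_fst[of "\<lambda>u s. h (u, s)"] p.integral_snd[of "\<lambda>u s. h (u, s)"] h by (simp add: i1 i2)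
  have j3: "integrable \<mu> (indicat_real {a<..b})"
    using meas[OF ab] by (intro integrable_real_indicator) auto
  have j4: "integrable lborel (\<lambda>u. indicator {a..b} u * f' u)"
    using borel_integrable_atLeastAtMost'[of a b f'] continuous_on_subset[OF f'] by (simp add: set_integrable_def)
  have k1: "indicator {a<..b} s *\<^sub>R f s = indicator {a<..b} s * (f s - f a) + f a * indicator {a<..b} s" for s
    by (simp add: algebra_simps)
  have k2: "indicator {a..b} s *\<^sub>R (f' s * G s) = G b * (indicator {a..b} s * f' s) - indicator {a..b} s * (f' s * (G b - G s))" for s
    by (simp add: algebra_simps)
  show "set_integrable lborel {a..b} (\<lambda>s. f' s * G s)"
    unfolding set_integrable_def k2 by (intro Bochner_Integration.integrable_diff integrable_mult_right j4 j2)
  have "(LINT s:{a<..b}|\<mu>. f s) = (\<integral>u. indicator {a..b} u * (f' u * (G b - G u)) \<partial>lborel) + f a * (G b - G a)"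
    unfolding set_lebesgue_integral_def k1 using j1 j3 by (simp add: e meas'[OF ab])
  moreover have "(LBINT s:{a..b}. f' s * G s) = G b * (f b - f a) - (\<integral>u. indicator {a..b} u * (f' u * (G b - G u)) \<partial>lborel)"
    unfolding set_lebesgue_integral_def k2 using j4 j2 LBINT_FTC[OF ab f f'] by (simp add: set_lebesgue_integral_def)
  ultimately show "(LINT s:{a<..b}|interval_measure G. f s) = f b * G b - f a * G a - (LBINT s:{a..b}. f' s * G s)"
    by (simp add: \<mu>_def[symmetric] algebra_simps)
qed

text \<open>\<open>V\<close> and \<open>V - g\<close> are nondecreasing, so the formula for monotone
  integrators applies to both, and \<open>V\<close> drops out of the difference. Interval measures
  also ask for right-continuity; that of \<open>V\<close> comes from
  \<open>total_variation_right_small\<close>.\<close>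

lemma stieltjes_by_parts:
  fixes f f' g :: "real \<Rightarrow> real"
  assumes ab: "a < b" and fin: "total_variation g a b < \<infinity>"
    and rc: "\<And>s. s \<in> {a..<b} \<Longrightarrow> (g \<longlongrightarrow> g s) (at_right s)"
    and f: "\<And>s. (f has_real_derivative f' s) (at s)" and f': "continuous_on UNIV f'"
  shows "stieltjes_integral f g a b = f b * g b - f a * g a - (LBINT s:{a..b}. f' s * g s)"
    and "set_integrable lborel {a..b} (\<lambda>s. f' s * g s)"
proof -
  define c where "c s = min b (max a s)" for s
  define V where "V s = enn2real (total_variation g a (c s))" for s
  define W where "W s = V s - g (c s)" for s
  have c: "a \<le> c s" "c s \<le> b" for s using ab by (auto simp: c_def)
  have cm: "c s \<le> c t" if "s \<le> t" for s t using that by (auto simp: c_def)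
  have tvf: "total_variation g s t < \<infinity>" if "a \<le> s" "t \<le> b" for s t
    using total_variation_mono[OF that, of g] fin by (auto intro: le_less_trans)
  have Vd: "V t - V s = enn2real (total_variation g (c s) (c t))" if "s \<le> t" for s t
    using total_variation_split[OF c(1) cm[OF that], of g] tvf[of a "c s"] tvf[of "c s" "c t"] c
    by (simp add: V_def enn2real_plus)
  have Vg: "\<bar>g (c t) - g (c s)\<bar> \<le> V t - V s" if "s \<le> t" for s t
  proof -
    have "ennreal \<bar>g (c t) - g (c s)\<bar> \<le> ennreal (enn2real (total_variation g (c s) (c t)))"
      using total_variation_ge_abs[of "c s" "c s" "c t" "c t" g] cm[OF that] tvf[of "c s" "c t"] c by simp
    then show ?thesis using Vd[OF that] by (simp add: ennreal_le_iff)
  qed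
  have mV: "mono V" using Vg by (intro monoI) (smt (verit))
  have mW: "mono W" using Vg unfolding W_def by (intro monoI) (smt (verit))
  \<comment> \<open>To the left of a and from b on, the clipped integrators are constant just to the
    right of s, so only s in [a,b) needs an argument.\<close>
  have const: "(h \<longlongrightarrow> h s) (at_right s)" if "s < a \<or> b \<le> s" "\<And>u. h u = k (c u)" for h :: "real \<Rightarrow> real" and k s
  proof (rule tendsto_eventually)
    show "\<forall>\<^sub>F u in at_right s. h u = h s"
      using that ab by (auto simp: eventually_at_right_field c_def intro: exI[of _ a] exI[of _ "s+1"])
  qed
  have ev: "\<forall>\<^sub>F u in at_right s. s < u \<and> u < b" if "s \<in> {a..<b}" for s
    using that by (auto simp: eventually_at_right_field intro: exI[of _ b])
  have rcg: "((\<lambda>s. g (c s)) \<longlongrightarrow> g (c s)) (at_right s)" for s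
  proof (cases "s \<in> {a..<b}")
    case True
    have "((\<lambda>s. g (c s)) \<longlongrightarrow> g s) (at_right s)"
      by (rule Lim_transform_eventually[OF rc[OF True]])
         (use ev[OF True] True in \<open>auto simp: c_def elim!: eventually_mono\<close>)
    then show ?thesis using True by (simp add: c_def)
  qed (intro const[of s _ g]; auto)
  have rcV: "(V \<longlongrightarrow> V s) (at_right s)" for s
  proof (cases "s \<in> {a..<b}")
    case True
    show ?thesis
    proof (rule tendstoI)
      fix e :: real assume e: "e > 0"
      have "\<forall>\<^sub>F u in at_right s. total_variation g s u < ennreal e"
        using True tvf[of s b] rc[OF True] e by (intro total_variation_right_small[of s b]) auto
      then show "\<forall>\<^sub>F u in at_right s. dist (V u) (V s) < e" using ev[OF True]
      proof eventually_elim
        case (elim u)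
        then have "c u = u" "c s = s" using True by (auto simp: c_def)
        then have "V u - V s = enn2real (total_variation g s u)" using Vd[of s u] elim by simp
        moreover have "enn2real (total_variation g s u) < e"
          using elim(1) e by (cases "total_variation g s u") (auto simp: ennreal_less_iff)
        ultimately show ?case by (simp add: dist_real_def)
      qed
    qed
  qed (intro const[of s _ "\<lambda>s. enn2real (total_variation g a s)"]; auto simp: V_def)
  have rcW: "(W \<longlongrightarrow> W s) (at_right s)" for s
    unfolding W_def by (intro tendsto_diff rcV rcg)
  note pV = interval_measure_by_parts[OF mV _ less_imp_le[OF ab] f f', unfolded continuous_within, OF rcV]
  note pW = interval_measure_by_parts[OF mW _ less_imp_le[OF ab] f f', unfolded continuous_within, OF rcW]
  have st: "stieltjes_integral f g a b = (LINT s:{a<..b}|interval_measure V. f s) - (LINT s:{a<..b}|interval_measure W. f s)"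
    unfolding stieltjes_integral_def Let_def V_def W_def c_def ..
  have i: "set_integrable lborel {a..b} (\<lambda>s. f' s * V s - f' s * W s)"
    using pV(2) pW(2) by (rule set_integral_diff)
  have eq: "f' s * V s - f' s * W s = f' s * g s" if "s \<in> {a..b}" for s
    using that by (auto simp: W_def c_def algebra_simps)
  show "set_integrable lborel {a..b} (\<lambda>s. f' s * g s)"
    using i eq by (subst set_integrable_cong[OF refl refl eq[symmetric]]) auto
  have "(LBINT s:{a..b}. f' s * V s) - (LBINT s:{a..b}. f' s * W s) = (LBINT s:{a..b}. f' s * V s - f' s * W s)"
    using pV(2) pW(2) by simp
  also have "\<dots> = (LBINT s:{a..b}. f' s * g s)" using eq by (intro set_lebesgue_integral_cong) auto
  finally have "(LBINT s:{a..b}. f' s * V s) - (LBINT s:{a..b}. f' s * W s) = (LBINT s:{a..b}. f' s * g s)" .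
  moreover have "f b * V b - f b * W b = f b * g b" "f a * V a - f a * W a = f a * g a"
    using ab by (auto simp: W_def c_def algebra_simps)
  ultimately show "stieltjes_integral f g a b = f b * g b - f a * g a - (LBINT s:{a..b}. f' s * g s)"
    unfolding st pV(1) pW(1) by linarith
qed

text \<open>The increments of \<open>F\<close> are dominated by those of the integral
  \<open>G\<close> of \<open>\<bar>f\<bar>\<close>, whose sums telescope. Paths of \<open>Y\<close>
  thereby qualify as integrators in \<open>stieltjes_by_parts\<close>.\<close>

lemma total_variation_indefinite_integral:
  fixes F f :: "real \<Rightarrow> real"
  assumes f: "set_integrable lborel {a..b} f"
    and F: "\<And>t. t \<in> {a..b} \<Longrightarrow> F t = c + (LBINT s:{a..t}. f s)"
  shows "total_variation F a b < \<infinity>"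
    and "\<And>s. s \<in> {a..<b} \<Longrightarrow> (F \<longlongrightarrow> F s) (at_right s)"
proof -
  have inc: "F v - F u = (LBINT s:{u<..v}. f s)" if "a \<le> u" "u \<le> v" "v \<le> b" for u v
  proof -
    have "(LBINT s:{a..u} \<union> {u<..v}. f s) = (LBINT s:{a..u}. f s) + (LBINT s:{u<..v}. f s)"
      using that by (intro set_integral_Un set_integrable_subset[OF f]) auto
    moreover have "{a..u} \<union> {u<..v} = {a..v}" using that by auto
    ultimately show ?thesis using F[of u] F[of v] that by simp
  qed
  define G where "G t = (LBINT s:{a..t}. \<bar>f s\<bar>)" for t
  have af: "set_integrable lborel {a..b} (\<lambda>s. \<bar>f s\<bar>)" using f by (rule set_integrable_abs)
  have incG: "G v - G u = (LBINT s:{u<..v}. \<bar>f s\<bar>)" if "a \<le> u" "u \<le> v" "v \<le> b" for u v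
  proof -
    have "(LBINT s:{a..u} \<union> {u<..v}. \<bar>f s\<bar>) = (LBINT s:{a..u}. \<bar>f s\<bar>) + (LBINT s:{u<..v}. \<bar>f s\<bar>)"
      using that by (intro set_integral_Un set_integrable_subset[OF af]) auto
    moreover have "{a..u} \<union> {u<..v} = {a..v}" using that by auto
    ultimately show ?thesis using that by (simp add: G_def)
  qed
  have le: "\<bar>F v - F u\<bar> \<le> G v - G u" if "a \<le> u" "u \<le> v" "v \<le> b" for u v
  proof -
    have "set_integrable lborel {u<..v} f" using that by (intro set_integrable_subset[OF f]) auto
    then show ?thesis unfolding inc[OF that] incG[OF that]
      using set_integral_norm_bound[of lborel "{u<..v}" f] by simp
  qed
  have "total_variation F a b \<le> ennreal (G b - G a)"
  proof (rule total_variation_least)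
    fix p :: "nat \<Rightarrow> real" and n assume p: "mono p" "range p \<subseteq> {a..b}"
    then have r: "a \<le> p i" "p i \<le> b" "p i \<le> p (Suc i)" for i by (auto simp: image_subset_iff mono_def)
    have "(\<Sum>i<n. ennreal \<bar>F (p (Suc i)) - F (p i)\<bar>) \<le> (\<Sum>i<n. ennreal (G (p (Suc i)) - G (p i)))"
      using r by (intro sum_mono ennreal_leI le) auto
    also have "\<dots> = ennreal (\<Sum>i<n. G (p (Suc i)) - G (p i))"
      using r le by (intro sum_ennreal) (metis abs_ge_zero order_trans)
    also have "\<dots> = ennreal (G (p n) - G (p 0))" by (subst sum_lessThan_telescope) (rule refl)
    also have "\<dots> \<le> ennreal (G b - G a)"
      using le[of a "p 0"] le[of "p n" b] r[of 0] r[of n] by (intro ennreal_leI) linarith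
    finally show "(\<Sum>i<n. ennreal \<bar>F (p (Suc i)) - F (p i)\<bar>) \<le> ennreal (G b - G a)" .
  qed
  then show "total_variation F a b < \<infinity>" by (auto intro: le_less_trans)
  have "continuous_on {a..b} (\<lambda>t. integral {a..t} f)"
    using f by (intro indefinite_integral_continuous_1) (simp add: set_borel_integral_eq_integral)
  moreover have "F t = c + integral {a..t} f" if "t \<in> {a..b}" for t
    using F[OF that] set_borel_integral_eq_integral(2)[OF set_integrable_subset[OF f, of "{a..t}"]] that by simp
  ultimately have cF: "continuous_on {a..b} F"
    by (subst continuous_on_cong[where g="\<lambda>t. c + integral {a..t} f"]) (auto intro!: continuous_intros)
  fix s assume s: "s \<in> {a..<b}"
  then have "(F \<longlongrightarrow> F s) (at s within {a..b})" using cF by (auto simp: continuous_on_def)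
  then have "(F \<longlongrightarrow> F s) (at s within {s..b})"
    by (rule tendsto_within_subset) (use s in auto)
  then show "(F \<longlongrightarrow> F s) (at_right s)" using s by (simp add: at_within_Icc_at_right)
qed

section \<open>Set integrals, the impact equation and the exponential kernel\<close>

lemma set_integrable_Icc_mult:
  fixes c f :: "real \<Rightarrow> real"
  assumes c: "continuous_on UNIV c" and f: "set_integrable lborel {a..b} f"
  shows "set_integrable lborel {a..b} (\<lambda>s. c s * f s)"
proof -
  have "bounded (c ` {a..b})"
    by (intro compact_imp_bounded compact_continuous_image continuous_on_subset[OF c]) auto
  then obtain B where "\<forall>x\<in>c ` {a..b}. norm x \<le> B" unfolding bounded_iff by blast
  then have B: "\<And>t. t \<in> {a..b} \<Longrightarrow> \<bar>c t\<bar> \<le> B" by auto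
  have [measurable]: "c \<in> borel_measurable borel" using c by (rule borel_measurable_continuous_onI)
  have f': "integrable lborel (\<lambda>s. indicator {a..b} s * f s)" using f by (simp add: set_integrable_def)
  note [measurable] = borel_measurable_integrable[OF f']
  have "integrable lborel (\<lambda>s. c s * (indicator {a..b} s * f s))"
  proof (rule Bochner_Integration.integrable_bound[OF integrable_mult_right[OF f', of B]])
    show "AE s in lborel. norm (c s * (indicator {a..b} s * f s)) \<le> norm (B * (indicator {a..b} s * f s))"
      using B by (intro AE_I2) (auto simp: indicator_def abs_mult intro!: mult_right_mono order_trans[OF B abs_ge_self])
  qed measurable
  then show ?thesis by (simp add: set_integrable_def mult.left_commute)
qed

lemma LBINT_refl: "(LBINT s:{a..a::real}. f s) = (0::real)"
  unfolding set_lebesgue_integral_def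
  by (rule integral_eq_zero_AE) (use AE_lborel_singleton[of a] in \<open>auto elim!: eventually_mono\<close>)

lemma LBINT_Icc_tail:
  fixes f :: "real \<Rightarrow> real"
  assumes "a \<le> t" "t \<le> b" "set_integrable lborel {a..b} f"
  shows "(LBINT s:{a..b}. f s) = (LBINT s:{a..t}. f s) + (LBINT s:{t..b}. f s)"
proof -
  have "(LBINT s:{a..b}. f s) = (LBINT s:{a..t} \<union> {t<..b}. f s)" using assms by (simp add: ivl_disj_un_two(6) ivl_disj_un_two(7) ivl_disj_un_two(8))
  also have "\<dots> = (LBINT s:{a..t}. f s) + (LBINT s:{t<..b}. f s)"
    using assms by (intro set_integral_Un set_integrable_subset[OF assms(3)]) auto
  also have "(LBINT s:{t<..b}. f s) = (LBINT s:{t..b}. f s)"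
    by (intro set_integral_null_delta[symmetric, THEN sym] set_integral_discrete_difference[where X="{t}"]) auto
  finally show ?thesis .
qed

text \<open>Integrating factor \<open>exp (\<rho> * t)\<close>. The impact equation of (MF) is
  implicit in \<open>Y\<close>; this brings it into the explicit form of
  \<open>transient_impact\<close>.\<close>

lemma linear_ode_solution:
  fixes Y g :: "real \<Rightarrow> real"
  assumes Y: "set_integrable lborel {0..T} Y" and g: "set_integrable lborel {0..T} g"
    and eq: "\<And>t. t \<in> {0..T} \<Longrightarrow> Y t = y + (LBINT s:{0..t}. - \<rho> * Y s + \<gamma> * g s)" and t: "t \<in> {0..T}"
  shows "Y t = exp (- \<rho> * t) * y + \<gamma> * (exp (- \<rho> * t) * (LBINT s:{0..t}. exp (\<rho> * s) * g s))"
proof -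
  have Y0: "Y 0 = y" using eq[of 0] t LBINT_refl[of 0] by simp
  have Yt: "set_integrable lborel {0..t} Y" and gt: "set_integrable lborel {0..t} g"
    using t by (auto intro: set_integrable_subset[OF Y] set_integrable_subset[OF g])
  have "exp (\<rho> * t) * Y t - exp (\<rho> * 0) * Y 0 = (LBINT s:{0..t}. \<rho> * exp (\<rho> * s) * Y s + exp (\<rho> * s) * (- \<rho> * Y s + \<gamma> * g s))"
  proof (rule ac_by_parts(2)[symmetric])
    show "set_integrable lborel {0..t} (\<lambda>s. \<rho> * exp (\<rho> * s))"
      by (intro borel_integrable_atLeastAtMost' continuous_intros)
    show "set_integrable lborel {0..t} (\<lambda>s. - \<rho> * Y s + \<gamma> * g s)"
      using Yt gt by (intro set_integral_add set_integrable_mult_right)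
    show "exp (\<rho> * r) = exp (\<rho> * 0) + (LBINT s:{0..r}. \<rho> * exp (\<rho> * s))" if "r \<in> {0..t}" for r
      using that by (intro LBINT_FTC) (auto intro!: derivative_eq_intros continuous_intros)
    show "Y r = Y 0 + (LBINT s:{0..r}. - \<rho> * Y s + \<gamma> * g s)" if "r \<in> {0..t}" for r
      using eq[of r] that t by (simp add: Y0)
  qed (use t in auto)
  also have "\<dots> = \<gamma> * (LBINT s:{0..t}. exp (\<rho> * s) * g s)"
    by (simp add: algebra_simps flip: set_integral_mult_right)
  finally have e: "exp (\<rho> * t) * Y t = y + \<gamma> * (LBINT s:{0..t}. exp (\<rho> * s) * g s)" by (simp add: Y0)
  have "Y t = exp (- \<rho> * t) * (exp (\<rho> * t) * Y t)" by (simp add: mult.assoc[symmetric] exp_add[symmetric])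
  then show ?thesis unfolding e by (simp add: algebra_simps)
qed

text \<open>With \<open>E t = exp (- 2 * \<rho> * t)\<close> the form is half the integral of
  \<open>E\<close> against the differential of \<open>G * G\<close>. By parts it becomes half of
  \<open>E T * (G T * G T)\<close> plus \<rho> times the integral of \<open>E * (G * G)\<close>, and
  neither term is negative.\<close>

lemma exponential_kernel_nonneg:
  fixes d :: "real \<Rightarrow> real"
  assumes T: "0 \<le> T" and \<rho>: "0 \<le> \<rho>" and d: "set_integrable lborel {0..T} d"
  shows "0 \<le> (LBINT t:{0..T}. (exp (- \<rho> * t) * (LBINT s:{0..t}. exp (\<rho> * s) * d s)) * d t)"
proof -
  define g where "g s = exp (\<rho> * s) * d s" for s
  define G where "G t = (LBINT s:{0..t}. g s)" for t
  have g: "set_integrable lborel {0..T} g"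
    unfolding g_def by (intro set_integrable_Icc_mult d continuous_intros)
  have G0: "G 0 = 0" unfolding G_def by (rule LBINT_refl)
  have G: "G t = G 0 + (LBINT s:{0..t}. g s)" for t unfolding G0 by (simp add: G_def)
  have gG: "set_integrable lborel {0..t} (\<lambda>s. g s * G s + G s * g s)"
      "(LBINT s:{0..t}. g s * G s + G s * g s) = G t * G t" if "t \<in> {0..T}" for t
  proof -
    have t: "0 \<le> t" "set_integrable lborel {0..t} g"
      using that by (auto intro: set_integrable_subset[OF g])
    show "set_integrable lborel {0..t} (\<lambda>s. g s * G s + G s * g s)"
      "(LBINT s:{0..t}. g s * G s + G s * g s) = G t * G t"
      using ac_by_parts[OF t(1,2,2) G G] by (simp_all add: G0)
  qed
  define E where "E t = exp (- 2 * \<rho> * t)" for t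
  have I: "set_integrable lborel {0..T} (\<lambda>s. (- 2 * \<rho> * E s) * (G s * G s) + E s * (g s * G s + G s * g s))"
    "(LBINT s:{0..T}. (- 2 * \<rho> * E s) * (G s * G s) + E s * (g s * G s + G s * g s)) = E T * (G T * G T) - E 0 * (G 0 * G 0)"
  proof -
    have 1: "set_integrable lborel {0..T} (\<lambda>s. - 2 * \<rho> * E s)"
      unfolding E_def by (intro borel_integrable_atLeastAtMost' continuous_intros)
    have 2: "E t = E 0 + (LBINT s:{0..t}. - 2 * \<rho> * E s)" if "t \<in> {0..T}" for t
      using that unfolding E_def by (intro LBINT_FTC) (auto intro!: derivative_eq_intros continuous_intros)
    have 3: "G t * G t = G 0 * G 0 + (LBINT s:{0..t}. g s * G s + G s * g s)" if "t \<in> {0..T}" for t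
      using gG(2)[OF that] G0 by simp
    show "set_integrable lborel {0..T} (\<lambda>s. (- 2 * \<rho> * E s) * (G s * G s) + E s * (g s * G s + G s * g s))"
      "(LBINT s:{0..T}. (- 2 * \<rho> * E s) * (G s * G s) + E s * (g s * G s + G s * g s)) = E T * (G T * G T) - E 0 * (G 0 * G 0)"
      using T by (intro ac_by_parts[OF T 1 gG(1)[of T] 2 3]; simp)+
  qed
  have i1: "set_integrable lborel {0..T} (\<lambda>s. E s * (g s * G s + G s * g s))"
    unfolding E_def by (rule set_integrable_Icc_mult[OF _ gG(1)[of T]]) (use T in \<open>auto intro!: continuous_intros\<close>)
  have i2: "set_integrable lborel {0..T} (\<lambda>s. 2 * \<rho> * E s * (G s * G s))"
    using set_integral_diff(1)[OF i1 I(1)] by (simp add: algebra_simps)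
  have pe: "(exp (- \<rho> * t) * (LBINT s:{0..t}. exp (\<rho> * s) * d s)) * d t = (E t * (g t * G t + G t * g t)) / 2" for t
  proof -
    have "exp (- \<rho> * t) = E t * exp (\<rho> * t)" by (simp add: E_def exp_add[symmetric])
    then show ?thesis by (simp add: G_def g_def algebra_simps)
  qed
  have "(LBINT t:{0..T}. (exp (- \<rho> * t) * (LBINT s:{0..t}. exp (\<rho> * s) * d s)) * d t) = (LBINT t:{0..T}. E t * (g t * G t + G t * g t)) / 2"
    unfolding pe by (simp only: set_integral_divide_zero)
  moreover have "(LBINT t:{0..T}. E t * (g t * G t + G t * g t)) = E T * (G T * G T) + (LBINT t:{0..T}. 2 * \<rho> * E t * (G t * G t))"
    using set_integral_add(2)[OF i2 I(1)] I(2) by (simp add: G0 algebra_simps)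
  moreover have "0 \<le> E T * (G T * G T)" by (simp add: E_def)
  moreover have "0 \<le> (LBINT t:{0..T}. 2 * \<rho> * E t * (G t * G t))"
    unfolding set_lebesgue_integral_def using \<rho> by (intro integral_nonneg_AE) (auto simp: E_def)
  ultimately show ?thesis by linarith
qed

subsection \<open>The function R\<close>

text \<open>The derivative of \<open>R_fun\<close> written out, so that it can itself be
  differentiated and integrated without going through \<open>deriv\<close>.\<close>

definition dR_fun :: "real \<Rightarrow> real \<Rightarrow> real \<Rightarrow> real \<Rightarrow> real" where
  "dR_fun lam \<phi> varrho t =
    \<phi> / lam * sinh (sqrt (\<phi> / lam) * t) + sqrt (\<phi> / lam) * (varrho / lam) * cosh (sqrt (\<phi> / lam) * t)"

lemma R_fun_deriv:
  assumes "0 < lam" "0 < \<phi>"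
  shows "(R_fun lam \<phi> varrho has_real_derivative dR_fun lam \<phi> varrho t) (at t)"
    and "(dR_fun lam \<phi> varrho has_real_derivative \<phi> / lam * R_fun lam \<phi> varrho t) (at t)"
proof -
  define k where "k = sqrt (\<phi> / lam)"
  have k: "\<phi> / lam = k * k" using assms by (simp add: k_def)
  show "(R_fun lam \<phi> varrho has_real_derivative dR_fun lam \<phi> varrho t) (at t)"
    unfolding R_fun_def[abs_def] dR_fun_def k_def[symmetric] k
    using assms by (auto intro!: derivative_eq_intros simp: algebra_simps)
  show "(dR_fun lam \<phi> varrho has_real_derivative \<phi> / lam * R_fun lam \<phi> varrho t) (at t)"
    unfolding R_fun_def dR_fun_def[abs_def] k_def[symmetric] k
    using assms by (auto intro!: derivative_eq_intros simp: algebra_simps)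
qed

lemma deriv_R_fun: "0 < lam \<Longrightarrow> 0 < \<phi> \<Longrightarrow> deriv (R_fun lam \<phi> varrho) t = dR_fun lam \<phi> varrho t"
  by (rule DERIV_imp_deriv) (rule R_fun_deriv)

lemma R_fun_pos: "0 < lam \<Longrightarrow> 0 < \<phi> \<Longrightarrow> 0 < varrho \<Longrightarrow> 0 \<le> t \<Longrightarrow> 0 < R_fun lam \<phi> varrho t"
  unfolding R_fun_def by (intro add_pos_nonneg mult_pos_pos mult_nonneg_nonneg) (auto simp: cosh_real_pos)

lemma continuous_R_fun: "continuous_on UNIV (\<lambda>t. R_fun lam \<phi> varrho (T - t))" "continuous_on UNIV (\<lambda>t. dR_fun lam \<phi> varrho (T - t))"
  unfolding R_fun_def dR_fun_def by (intro continuous_intros)+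

lemma R_fun_reflect_deriv:
  assumes "0 < lam" "0 < \<phi>"
  shows "((\<lambda>s. R_fun lam \<phi> varrho (T - s)) has_real_derivative - dR_fun lam \<phi> varrho (T - s)) (at s)"
    and "((\<lambda>s. dR_fun lam \<phi> varrho (T - s)) has_real_derivative - (\<phi> / lam * R_fun lam \<phi> varrho (T - s))) (at s)"
proof -
  have d: "((\<lambda>s. T - s) has_real_derivative -1) (at s)" by (auto intro!: derivative_eq_intros)
  show "((\<lambda>s. R_fun lam \<phi> varrho (T - s)) has_real_derivative - dR_fun lam \<phi> varrho (T - s)) (at s)"
    using DERIV_chain2[OF R_fun_deriv(1)[OF assms] d] by simp
  show "((\<lambda>s. dR_fun lam \<phi> varrho (T - s)) has_real_derivative - (\<phi> / lam * R_fun lam \<phi> varrho (T - s))) (at s)"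
    using DERIV_chain2[OF R_fun_deriv(2)[OF assms] d] by simp
qed

subsection \<open>Processes on a filtered probability space\<close>

lemma right_continuous_sequentially:
  fixes g :: "real \<Rightarrow> real"
  assumes g: "(g \<longlongrightarrow> g s) (at_right s)" and x: "x \<longlonglongrightarrow> s" and ge: "\<And>k. s \<le> x k"
  shows "(\<lambda>k. g (x k)) \<longlonglongrightarrow> g s"
proof (rule tendstoI)
  fix e :: real assume e: "0 < e"
  then obtain b where b: "b > s" "\<And>y. y > s \<Longrightarrow> y < b \<Longrightarrow> dist (g y) (g s) < e"
    using tendstoD[OF g e] by (auto simp: eventually_at_right_field)
  have "\<forall>\<^sub>F k in sequentially. x k < b" using x b(1) by (rule order_tendstoD)
  then show "\<forall>\<^sub>F k in sequentially. dist (g (x k)) (g s) < e"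
  proof eventually_elim
    case (elim k)
    then show ?case using b(2)[of "x k"] ge[of k] e by (cases "x k = s") auto
  qed
qed

lemma integrable_bounded_mult:
  fixes f g :: "'a \<Rightarrow> real"
  assumes "integrable M f" "g \<in> borel_measurable M" "\<And>x. \<bar>g x\<bar> \<le> c"
  shows "integrable M (\<lambda>x. g x * f x)"
proof (rule Bochner_Integration.integrable_bound[where f="\<lambda>x. c * f x"])
  show "AE x in M. norm (g x * f x) \<le> norm (c * f x)"
    using order_trans[OF assms(3) abs_ge_self] by (auto simp: abs_mult intro!: mult_right_mono)
qed (use assms in auto)

text \<open>L2 boundedness takes the place of domination: the distance of \<open>f n\<close> and
  \<open>g\<close> is at most K where they differ, plus its square over K. The set where they differ
  has vanishing probability, and the second term is small for large K.\<close>

lemma (in prob_space) L1_convergence_of_L2_bounded: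
  fixes f :: "nat \<Rightarrow> 'a \<Rightarrow> real"
  assumes [measurable]: "\<And>n. f n \<in> borel_measurable M" "g \<in> borel_measurable M"
    and C: "\<And>n. (\<integral>\<^sup>+x. ennreal ((f n x)\<^sup>2) \<partial>M) \<le> ennreal C" "(\<integral>\<^sup>+x. ennreal ((g x)\<^sup>2) \<partial>M) \<le> ennreal C" "0 \<le> C"
    and ev: "AE x in M. \<forall>\<^sub>F n in sequentially. f n x = g x"
  shows "(\<lambda>n. \<integral>x. \<bar>f n x - g x\<bar> \<partial>M) \<longlonglongrightarrow> 0"
proof -
  have i2: "integrable M (\<lambda>x. (f n x)\<^sup>2)" "integrable M (\<lambda>x. (g x)\<^sup>2)" for n
    using le_less_trans[OF C(1)] le_less_trans[OF C(2)] by (auto intro!: integrableI_nonneg)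
  have b2: "(\<integral>x. (f n x)\<^sup>2 \<partial>M) \<le> C" "(\<integral>x. (g x)\<^sup>2 \<partial>M) \<le> C" for n
    using C(1)[of n] C(2,3) nn_integral_eq_integral[OF i2(1)[of n]] nn_integral_eq_integral[OF i2(2)]
    by (simp_all add: ennreal_le_iff)
  have i1: "integrable M (f n)" "integrable M g" for n
    using i2 by (simp_all add: square_integrable_imp_integrable)
  have dom: "(\<lambda>n. \<integral>x. (if f n x = g x then 0 else 1::real) \<partial>M) \<longlonglongrightarrow> (\<integral>x. 0 \<partial>M)"
  proof (rule integral_dominated_convergence[where w="\<lambda>_. 1"])
    show "AE x in M. (\<lambda>n. if f n x = g x then 0 else 1::real) \<longlonglongrightarrow> 0"
      using ev by eventually_elim (rule tendsto_eventually, erule eventually_mono, simp)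
  qed auto
  show ?thesis
  proof (rule LIMSEQ_I)
    fix e :: real assume e: "0 < e"
    \<comment> \<open>The mean of the squared distance is at most \<open>4 * C\<close>, so this K
      makes the second term at most e/2; the 1 keeps K positive when C = 0.\<close>
    define K where "K = 8 * (C + 1) / e"
    have K: "K > 0" using C(3) e by (simp add: K_def)
    from dom have "(\<lambda>n. K * (\<integral>x. (if f n x = g x then 0 else 1::real) \<partial>M)) \<longlonglongrightarrow> K * 0"
      by (intro tendsto_mult tendsto_const) (simp only: Bochner_Integration.integral_zero)
    from LIMSEQ_D[OF this, of "e/2"] e obtain n0 where
      n0: "\<And>n. n \<ge> n0 \<Longrightarrow> norm (K * (\<integral>x. (if f n x = g x then 0 else 1::real) \<partial>M) - K * 0) < e/2"
      by auto
    have "norm ((\<integral>x. \<bar>f n x - g x\<bar> \<partial>M) - 0) < e" if n: "n \<ge> n0" for n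
    proof -
      have i01: "integrable M (\<lambda>x. (if f n x = g x then 0 else 1::real))"
        by (rule integrable_const_bound[where B=1]) auto
      have "(\<integral>x. \<bar>f n x - g x\<bar> \<partial>M) \<le> (\<integral>x. K * (if f n x = g x then 0 else 1) + (2 * (f n x)\<^sup>2 + 2 * (g x)\<^sup>2) / K \<partial>M)"
      proof (rule integral_mono)
        fix x
        let ?d = "\<bar>f n x - g x\<bar>"
        have "2 * (?d * K) \<le> ?d\<^sup>2 + K * K"
          using sum_squares_bound[of ?d K] by (simp add: power2_eq_square mult.assoc)
        moreover have "0 \<le> ?d * K" using K by simp
        ultimately have "?d * K \<le> K * K + ?d\<^sup>2" by linarith
        then have "?d \<le> (K * K + ?d\<^sup>2) / K" using K by (simp add: pos_le_divide_eq)
        then have "?d \<le> K + ?d\<^sup>2 / K" using K by (simp add: add_divide_distrib)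
        moreover have "?d\<^sup>2 \<le> 2 * (f n x)\<^sup>2 + 2 * (g x)\<^sup>2"
          using zero_le_power2[of "f n x + g x"] by (simp add: power2_sum power2_diff)
        then have "?d\<^sup>2 / K \<le> (2 * (f n x)\<^sup>2 + 2 * (g x)\<^sup>2) / K" using K by (intro divide_right_mono) auto
        ultimately show "?d \<le> K * (if f n x = g x then 0 else 1) + (2 * (f n x)\<^sup>2 + 2 * (g x)\<^sup>2) / K"
          using K by (cases "f n x = g x") simp_all
      qed (use i1 i2 i01 in auto)
      also have "\<dots> = K * (\<integral>x. (if f n x = g x then 0 else 1::real) \<partial>M) + (2 * (\<integral>x. (f n x)\<^sup>2 \<partial>M) + 2 * (\<integral>x. (g x)\<^sup>2 \<partial>M)) / K"
        using i2 i01 by (simp add: add_divide_distrib)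
      also have "\<dots> < e/2 + 4 * C / K"
        using n0[OF n] b2(1)[of n] b2(2) K by (intro add_less_le_mono divide_right_mono) auto
      also have "4 * C / K \<le> e / 2" using C(3) e by (simp add: K_def field_simps)
      finally show ?thesis by simp
    qed
    then show "\<exists>no. \<forall>n\<ge>no. norm ((\<integral>x. \<bar>f n x - g x\<bar> \<partial>M) - 0) < e" by blast
  qed
qed

lemma integrable_mult_of_squares:
  fixes f g :: "'a \<Rightarrow> real"
  assumes "f \<in> borel_measurable M" "integrable M (\<lambda>x. (f x)\<^sup>2)" "g \<in> borel_measurable M" "integrable M (\<lambda>x. (g x)\<^sup>2)"
  shows "integrable M (\<lambda>x. f x * g x)"
proof (rule Bochner_Integration.integrable_bound[where f="\<lambda>x. (f x)\<^sup>2 + (g x)\<^sup>2"])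
  show "AE x in M. norm (f x * g x) \<le> norm ((f x)\<^sup>2 + (g x)\<^sup>2)"
  proof (rule AE_I2)
    fix x
    have "2 * (\<bar>f x\<bar> * \<bar>g x\<bar>) \<le> (f x)\<^sup>2 + (g x)\<^sup>2"
      using sum_squares_bound[of "\<bar>f x\<bar>" "\<bar>g x\<bar>"] by (simp add: mult.assoc)
    moreover have "0 \<le> \<bar>f x\<bar> * \<bar>g x\<bar>" by simp
    ultimately show "norm (f x * g x) \<le> norm ((f x)\<^sup>2 + (g x)\<^sup>2)"
      unfolding real_norm_def abs_mult by linarith
  qed
qed (use assms in auto)

lemma quadratic_nonpos_imp_zero:
  fixes g q :: real
  assumes "\<And>e. e * g - e\<^sup>2 * q \<le> 0"
  shows "g = 0"
proof (rule ccontr)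
  assume g: "g \<noteq> 0"
  \<comment> \<open>The trial value \<open>e = g / k\<close> makes the linear term positive, and
    since k is positive and exceeds q, the quadratic term cannot compensate it.\<close>
  define k where "k = \<bar>q\<bar> + 1"
  have k: "k > 0" "q < k" by (auto simp: k_def)
  have "(g / k) * g - (g / k)\<^sup>2 * q = g\<^sup>2 * (k - q) / k\<^sup>2"
    using k by (simp add: power2_eq_square field_simps)
  moreover have "0 < g\<^sup>2 * (k - q) / k\<^sup>2" using k g by simp
  ultimately show False using assms[of "g / k"] by linarith
qed

context usual_filtered_prob_space
begin

section \<open>Measurability under the usual conditions, optional stopping\<close>

lemma sets_F_subset: "0 \<le> t \<Longrightarrow> t \<le> T \<Longrightarrow> sets (F t) \<subseteq> sets M"
  using subalgebra_F[of t] by (simp add: subalgebra_def)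

lemma sigma_finite_subalgebra_F: "0 \<le> t \<Longrightarrow> t \<le> T \<Longrightarrow> sigma_finite_subalgebra M (F t)"
  by (intro finite_measure_subalgebra_is_sigma_finite finite_measure_subalgebra.intro
      finite_measure_subalgebra_axioms.intro finite_measure_axioms subalgebra_F)

lemma measurable_from_F: "0 \<le> t \<Longrightarrow> t \<le> T \<Longrightarrow> f \<in> borel_measurable (F t) \<Longrightarrow> f \<in> borel_measurable M"
  using measurable_from_subalg[OF subalgebra_F] by blast

text \<open>The set where f and g differ lies in a null set, and by completeness all its subsets
  belong to \<open>F 0\<close>. Stieltjes integrals and the payoff along \<open>P\<close> obtain
  their measurability in this way.\<close>

lemma borel_measurable_AE_eq:
  fixes f g :: "'a \<Rightarrow> real"
  assumes f[measurable]: "f \<in> borel_measurable M" and ae: "AE x in M. f x = g x"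
  shows "g \<in> borel_measurable M"
proof (rule measurableI)
  fix B :: "real set" assume B[measurable]: "B \<in> sets borel"
  obtain N where N: "N \<in> null_sets M" "{x \<in> space M. f x \<noteq> g x} \<subseteq> N" using ae by (auto simp: eventually_ae_filter)
  have sub: "S \<in> sets M" if "S \<subseteq> N" for S
    using complete_F[OF N(1) that] sets_F_subset[of 0] T_pos by auto
  have "g -` B \<inter> space M = ((f -` B \<inter> space M) - {x \<in> space M. f x \<noteq> g x}) \<union> (g -` B \<inter> {x \<in> space M. f x \<noteq> g x})" by auto
  moreover have "{x \<in> space M. f x \<noteq> g x} \<in> sets M" "g -` B \<inter> {x \<in> space M. f x \<noteq> g x} \<in> sets M"
    using N(2) by (auto intro!: sub)
  ultimately show "g -` B \<inter> space M \<in> sets M" by simp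
qed auto

text \<open>Measurability at each single time does not give joint measurability. Paths in a
  measurable null set are replaced by 0; the others are approached through their values at grid
  points on the right, and right-continuity identifies the limit.\<close>

lemma cadlag_measurable_version:
  assumes X: "\<And>t. t \<in> {0..T} \<Longrightarrow> X t \<in> borel_measurable M" and cl: "AE \<omega> in M. cadlag_on T (\<lambda>t. X t \<omega>)"
  obtains X' where "(\<lambda>(\<omega>, t). X' t \<omega>) \<in> borel_measurable (M \<Otimes>\<^sub>M lborel)"
    and "AE \<omega> in M. \<forall>t\<in>{0..T}. X' t \<omega> = X t \<omega>"
proof -
  obtain N where N: "{\<omega> \<in> space M. \<not> cadlag_on T (\<lambda>t. X t \<omega>)} \<subseteq> N" "N \<in> null_sets M"
    using cl by (auto simp: eventually_ae_filter)
  have [measurable]: "N \<in> sets M" using N by auto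
  \<comment> \<open>Rounding up is strict, so the grid point lies to the right of t. Clipping makes
    it constantly T at t = T, where \<open>cadlag_on\<close> says nothing about limits from the
    right.\<close>
  define grid where "grid n t = min T (max 0 ((of_int \<lfloor>real (Suc n) * t\<rfloor> + 1) / real (Suc n)))" for n t
  define X1 where "X1 t \<omega> = (if \<omega> \<in> N then 0 else X (min T (max 0 t)) \<omega>)" for t \<omega>
  have [measurable]: "X1 t \<in> borel_measurable M" for t
  proof -
    have [measurable]: "X (min T (max 0 t)) \<in> borel_measurable M" using X T_pos by auto
    show ?thesis unfolding X1_def[abs_def] by measurable
  qed
  define X' where "X' t \<omega> = (if t \<in> {0..T} then X1 t \<omega> else 0)" for t \<omega>
  have "(\<lambda>x. (\<lambda>(\<omega>, t). X' t \<omega>) x) \<in> borel_measurable (M \<Otimes>\<^sub>M lborel)"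
  proof (rule borel_measurable_LIMSEQ_real)
    fix n
    \<comment> \<open>For fixed n the grid point depends on t only through an integer, so countably
      many random variables are glued together.\<close>
    have "(\<lambda>x. (\<lambda>i x. X1 (min T (max 0 ((of_int i + 1) / real (Suc n)))) (fst x)) \<lfloor>real (Suc n) * snd x\<rfloor> x)
      \<in> borel_measurable (M \<Otimes>\<^sub>M lborel)"
      by (rule measurable_compose_countable) measurable
    then have [measurable]: "(\<lambda>x. X1 (grid n (snd x)) (fst x)) \<in> borel_measurable (M \<Otimes>\<^sub>M lborel)"
      by (simp add: grid_def)
    show "(\<lambda>x. if snd x \<in> {0..T} then X1 (grid n (snd x)) (fst x) else 0) \<in> borel_measurable (M \<Otimes>\<^sub>M lborel)"
      by measurable
  next
    fix x assume "x \<in> space (M \<Otimes>\<^sub>M (lborel :: real measure))"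
    then obtain \<omega> t where x: "x = (\<omega>, t)" "\<omega> \<in> space M" by (auto simp: space_pair_measure)
    show "(\<lambda>n. if snd x \<in> {0..T} then X1 (grid n (snd x)) (fst x) else 0) \<longlonglongrightarrow> (case x of (\<omega>, t) \<Rightarrow> X' t \<omega>)"
    proof (cases "t \<in> {0..T} \<and> \<omega> \<notin> N")
      case True
      then have "t \<in> {0..T}" and cl: "cadlag_on T (\<lambda>t. X t \<omega>)" using N(1) x(2) by blast+
      have gge: "t \<le> grid n t" for n
      proof -
        have "real (Suc n) * t \<le> of_int \<lfloor>real (Suc n) * t\<rfloor> + 1" by linarith
        then have "t \<le> (of_int \<lfloor>real (Suc n) * t\<rfloor> + 1) / real (Suc n)" by (simp add: field_simps)
        then show ?thesis using True by (auto simp: grid_def)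
      qed
      have gle: "grid n t \<le> t + 1 / real (Suc n)" for n
      proof -
        have "of_int \<lfloor>real (Suc n) * t\<rfloor> + 1 \<le> real (Suc n) * t + 1" by linarith
        then have "(of_int \<lfloor>real (Suc n) * t\<rfloor> + 1) / real (Suc n) \<le> (real (Suc n) * t + 1) / real (Suc n)"
          by (intro divide_right_mono) auto
        also have "\<dots> = t + 1 / real (Suc n)" by (simp add: field_simps)
        finally show ?thesis using True by (auto simp: grid_def)
      qed
      have gl: "(\<lambda>n. grid n t) \<longlonglongrightarrow> t"
      proof (rule tendsto_sandwich[OF _ _ tendsto_const[of t]])
        show "(\<lambda>n. t + 1 / real (Suc n)) \<longlonglongrightarrow> t"
          using tendsto_add[OF tendsto_const[of t] LIMSEQ_Suc[OF lim_1_over_n]] by simp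
      qed (use gge gle in auto)
      have "(\<lambda>n. X (grid n t) \<omega>) \<longlonglongrightarrow> X t \<omega>"
      proof (cases "t < T")
        case True
        then have "((\<lambda>t. X t \<omega>) \<longlongrightarrow> X t \<omega>) (at_right t)"
          using cl \<open>t \<in> {0..T}\<close> by (auto simp: cadlag_on_def)
        then show ?thesis by (rule right_continuous_sequentially[OF _ gl gge])
      next
        case False
        then have "grid n t = t" for n using gge[of n] True by (auto simp: grid_def)
        then show ?thesis by simp
      qed
      moreover have "min T (max 0 (grid n t)) = grid n t" "min T (max 0 t) = t" for n
        using True T_pos by (auto simp: grid_def)
      ultimately show ?thesis using True by (simp add: x X'_def X1_def)
    qed (auto simp: x X'_def X1_def)
  qed
  moreover have "AE \<omega> in M. \<forall>t\<in>{0..T}. X' t \<omega> = X t \<omega>"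
    by (rule AE_I'[OF N(2)]) (auto simp: X'_def X1_def)
  ultimately show ?thesis by (intro that[of X']) auto
qed

text \<open>The generators of the predictable sigma-algebra are measurable rectangles, so swapping
  coordinates is measurable from the product space. In contrast to the cadlag case the paths on
  [0,T] are left untouched.\<close>

lemma predictable_measurable_version:
  assumes "predictable M F T X"
  shows "(\<lambda>(\<omega>, t). if t \<in> {0..T} then X t \<omega> else 0) \<in> borel_measurable (M \<Otimes>\<^sub>M lborel)"
proof -
  let ?G = "{{0} \<times> B | B. B \<in> sets (F 0)} \<union> {{s<..t} \<times> B | s t B. 0 \<le> s \<and> s < t \<and> t \<le> T \<and> B \<in> sets (F s)}"
  have sub: "B \<subseteq> space M" if "B \<in> sets (F s)" for B s
    using sets.sets_into_space[OF that] by (simp add: space_F)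
  have gsub: "?G \<subseteq> Pow ({0..T} \<times> space M)"
    using T_pos sub by auto
  have sp: "space (predictable_sigma M F T) = {0..T} \<times> space M"
    unfolding predictable_sigma_def by (rule space_measure_of) (rule gsub)
  have "prod.swap \<in> measurable (restrict_space (M \<Otimes>\<^sub>M lborel) (space M \<times> {0..T})) (predictable_sigma M F T)"
    unfolding predictable_sigma_def
  proof (rule measurable_measure_of[OF gsub])
    fix A assume "A \<in> ?G"
    then have "\<exists>I B. A = I \<times> B \<and> I \<in> sets lborel \<and> B \<in> sets M \<and> I \<subseteq> {0..T}"
    proof
      assume "A \<in> {{0} \<times> B | B. B \<in> sets (F 0)}"
      then obtain B where "A = {0} \<times> B" "B \<in> sets (F 0)" by blast
      then show ?thesis using sets_F_subset[of 0] T_pos by (intro exI[of _ "{0}"] exI[of _ B]) auto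
    next
      assume "A \<in> {{s<..t} \<times> B | s t B. 0 \<le> s \<and> s < t \<and> t \<le> T \<and> B \<in> sets (F s)}"
      then obtain s t B where "A = {s<..t} \<times> B" "0 \<le> s" "s < t" "t \<le> T" "B \<in> sets (F s)" by blast
      then show ?thesis using sets_F_subset[of s] by (intro exI[of _ "{s<..t}"] exI[of _ B]) auto
    qed
    then obtain I B where A: "A = I \<times> B" "I \<in> sets lborel" "B \<in> sets M" "I \<subseteq> {0..T}" by blast
    have "prod.swap -` A \<inter> space (restrict_space (M \<Otimes>\<^sub>M lborel) (space M \<times> {0..T})) = (space M \<times> {0..T}) \<inter> (B \<times> I)"
      using A sets.sets_into_space[OF A(3)] by (auto simp: space_restrict_space space_pair_measure)
    also have "\<dots> \<in> sets (restrict_space (M \<Otimes>\<^sub>M lborel) (space M \<times> {0..T}))"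
      using A by (auto simp: sets_restrict_space)
    finally show "prod.swap -` A \<inter> space (restrict_space (M \<Otimes>\<^sub>M lborel) (space M \<times> {0..T})) \<in> sets (restrict_space (M \<Otimes>\<^sub>M lborel) (space M \<times> {0..T}))" .
  qed (auto simp: space_restrict_space space_pair_measure)
  from measurable_compose[OF this assms[unfolded predictable_def]]
  have "(\<lambda>(\<omega>, t). X t \<omega>) \<in> borel_measurable (restrict_space (M \<Otimes>\<^sub>M lborel) (space M \<times> {0..T}))"
    by (simp add: case_prod_beta')
  then have "(\<lambda>x. indicator (space M \<times> {0..T}) x * (\<lambda>(\<omega>, t). X t \<omega>) x) \<in> borel_measurable (M \<Otimes>\<^sub>M lborel)"
    by (subst (asm) borel_measurable_restrict_space_iff) (auto simp: space_pair_measure)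
  then show ?thesis
    by (rule measurable_cong[THEN iffD1, rotated]) (auto simp: space_pair_measure)
qed

text \<open>Optional stopping for a time with finitely many values: on the event
  \<open>J = j\<close>, which lies in \<open>F (t j)\<close>, the martingale property replaces
  \<open>Z (t j)\<close> by \<open>Z T\<close>.\<close>

lemma martingale_stopped_at_grid:
  assumes Z: "martingale M F T Z" and t: "\<And>j::nat. j \<le> K \<Longrightarrow> 0 \<le> t j \<and> t j \<le> T"
    and J: "\<And>\<omega>. \<omega> \<in> space M \<Longrightarrow> J \<omega> \<le> K" "\<And>j. j \<le> K \<Longrightarrow> {\<omega> \<in> space M. J \<omega> = j} \<in> sets (F (t j))"
  shows "integrable M (\<lambda>\<omega>. Z (t (J \<omega>)) \<omega>)" "(\<integral>\<omega>. Z (t (J \<omega>)) \<omega> \<partial>M) = (\<integral>\<omega>. Z T \<omega> \<partial>M)"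
proof -
  have Zi: "integrable M (Z s)" if "0 \<le> s" "s \<le> T" for s using Z that by (auto simp: martingale_def)
  define E where "E j = {\<omega> \<in> space M. J \<omega> = j}" for j
  have EF: "E j \<in> sets (F (t j))" if "j \<le> K" for j using J(2)[OF that] by (simp add: E_def)
  have EM: "E j \<in> sets M" if "j \<le> K" for j using EF[OF that] sets_F_subset t[OF that] by blast
  have eq: "Z (t (J \<omega>)) \<omega> = (\<Sum>j\<le>K. indicator (E j) \<omega> * Z (t j) \<omega>)" if "\<omega> \<in> space M" for \<omega>
    using J(1)[OF that] that by (subst sum.remove[of _ "J \<omega>"]) (auto simp: E_def indicator_def intro!: sum.neutral)
  have eqT: "Z T \<omega> = (\<Sum>j\<le>K. indicator (E j) \<omega> * Z T \<omega>)" if "\<omega> \<in> space M" for \<omega>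
    using J(1)[OF that] that by (subst sum.remove[of _ "J \<omega>"]) (auto simp: E_def indicator_def intro!: sum.neutral)
  have ii: "integrable M (\<lambda>\<omega>. indicator (E j) \<omega> * Z s \<omega>)" if "j \<le> K" "0 \<le> s" "s \<le> T" for j s
    using EM[OF that(1)] Zi[OF that(2,3)] by (intro integrable_bounded_mult[where c=1]) auto
  have step: "(\<integral>\<omega>. indicator (E j) \<omega> * Z (t j) \<omega> \<partial>M) = (\<integral>\<omega>. indicator (E j) \<omega> * Z T \<omega> \<partial>M)" if j: "j \<le> K" for j
  proof -
    interpret sigma_finite_subalgebra M "F (t j)" using sigma_finite_subalgebra_F t[OF j] by blast
    have ZT: "integrable M (Z T)" using Zi T_pos by auto
    have "(\<integral>\<omega>. indicator (E j) \<omega> * Z (t j) \<omega> \<partial>M) = (\<integral>\<omega>. indicator (E j) \<omega> * real_cond_exp M (F (t j)) (Z T) \<omega> \<partial>M)"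
    proof (rule integral_cong_AE)
      have "AE \<omega> in M. real_cond_exp M (F (t j)) (Z T) \<omega> = Z (t j) \<omega>"
        using Z t[OF j] by (auto simp: martingale_def)
      then show "AE \<omega> in M. indicator (E j) \<omega> * Z (t j) \<omega> = indicator (E j) \<omega> * real_cond_exp M (F (t j)) (Z T) \<omega>"
        by eventually_elim simp
    qed (use EM[OF j] Zi[of "t j"] t[OF j] in auto)
    also have "\<dots> = (\<integral>\<omega>. indicator (E j) \<omega> * Z T \<omega> \<partial>M)"
      using EF[OF j] ii[OF j, of T] T_pos ZT by (intro real_cond_exp_intg) auto
    finally show ?thesis .
  qed
  have "integrable M (\<lambda>\<omega>. \<Sum>j\<le>K. indicator (E j) \<omega> * Z (t j) \<omega>)" using t
    by (intro Bochner_Integration.integrable_sum ii) auto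
  then show "integrable M (\<lambda>\<omega>. Z (t (J \<omega>)) \<omega>)"
    by (subst Bochner_Integration.integrable_cong[OF refl eq]) auto
  have "(\<integral>\<omega>. Z (t (J \<omega>)) \<omega> \<partial>M) = (\<integral>\<omega>. (\<Sum>j\<le>K. indicator (E j) \<omega> * Z (t j) \<omega>) \<partial>M)"
    by (rule Bochner_Integration.integral_cong[OF refl eq])
  also have "\<dots> = (\<Sum>j\<le>K. \<integral>\<omega>. indicator (E j) \<omega> * Z (t j) \<omega> \<partial>M)"
    using t by (intro Bochner_Integration.integral_sum ii) auto
  also have "\<dots> = (\<Sum>j\<le>K. \<integral>\<omega>. indicator (E j) \<omega> * Z T \<omega> \<partial>M)" by (intro sum.cong step) auto
  also have "\<dots> = (\<integral>\<omega>. (\<Sum>j\<le>K. indicator (E j) \<omega> * Z T \<omega>) \<partial>M)"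
    using T_pos by (intro Bochner_Integration.integral_sum[symmetric] ii) auto
  also have "\<dots> = (\<integral>\<omega>. Z T \<omega> \<partial>M)"
    by (rule Bochner_Integration.integral_cong[OF refl eqT[symmetric]])
  finally show "(\<integral>\<omega>. Z (t (J \<omega>)) \<omega> \<partial>M) = (\<integral>\<omega>. Z T \<omega> \<partial>M)" .
qed

text \<open>\<open>F c\<close> is known to be contained in \<open>M\<close> only for c in [0,T]; the
  bounds on \<theta> settle the remaining levels.\<close>

lemma stopping_time_borel_measurable:
  assumes "stopping_time F \<theta>" "\<And>\<omega>. \<omega> \<in> space M \<Longrightarrow> 0 \<le> \<theta> \<omega> \<and> \<theta> \<omega> \<le> T"
  shows "\<theta> \<in> borel_measurable M"
proof (rule borel_measurableI_le)
  fix c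
  consider "c < 0" | "T \<le> c" | "0 \<le> c" "c \<le> T" by linarith
  then show "{\<omega> \<in> space M. \<theta> \<omega> \<le> c} \<in> sets M"
  proof cases
    case 1
    then have "{\<omega> \<in> space M. \<theta> \<omega> \<le> c} = {}" using assms(2) by fastforce
    then show ?thesis by (metis sets.empty_sets)
  next
    case 2
    then have "{\<omega> \<in> space M. \<theta> \<omega> \<le> c} = space M" using assms(2) by fastforce
    then show ?thesis by (metis sets.top)
  next
    case 3
    then show ?thesis using stopping_timeD[OF assms(1), of c] sets_F_subset[of c] by (auto simp: pred_def space_F)
  qed
qed

text \<open>
  Approximating \<open>\<theta>\<close> from above by grid-valued stopping times reduces optional stopping for the martingales
  \<open>L\<^sup>2 - Q\<close> stopped at \<open>\<sigma> k\<close> to a finite sum; Fatou's lemma replaces uniform integrability. With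
  \<open>\<theta> = min t (\<tau> n)\<close> this bounds a localized \<open>L\<close> in \<open>L\<^sup>2\<close>, which makes \<open>L\<close> a true martingale.
\<close>

lemma local_martingale_second_moment:
  assumes L: "local_martingale M F T L" and Q: "is_predictable_quadratic_variation M F T L Q"
    and \<theta>: "stopping_time F \<theta>" "\<And>\<omega>. \<omega> \<in> space M \<Longrightarrow> 0 \<le> \<theta> \<omega> \<and> \<theta> \<omega> \<le> T"
    and fin: "(\<integral>\<^sup>+\<omega>. ennreal (Q T \<omega>) \<partial>M) < \<infinity>"
  shows "(\<integral>\<^sup>+\<omega>. ennreal ((L (\<theta> \<omega>) \<omega>)\<^sup>2) \<partial>M) \<le> (\<integral>\<^sup>+\<omega>. ennreal (Q T \<omega>) \<partial>M)"
proof -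
  have Lm: "L t \<in> borel_measurable M" if "t \<in> {0..T}" for t
    using L that by (intro measurable_from_F[of t]) (auto simp: local_martingale_def adapted_def)
  have Lc: "AE \<omega> in M. cadlag_on T (\<lambda>t. L t \<omega>)" using L by (simp add: local_martingale_def)
  \<comment> \<open>Evaluation at a random time needs joint measurability, hence the versions
    \<open>L'\<close> and \<open>Q'\<close>.\<close>
  obtain L' where L'[measurable]: "(\<lambda>(\<omega>, t). L' t \<omega>) \<in> borel_measurable (M \<Otimes>\<^sub>M lborel)"
    and L'L: "AE \<omega> in M. \<forall>t\<in>{0..T}. L' t \<omega> = L t \<omega>"
    using cadlag_measurable_version[OF Lm Lc] by blast
  define Q' where "Q' t \<omega> = (if t \<in> {0..T} then Q t \<omega> else 0)" for t \<omega>
  have Q'[measurable]: "(\<lambda>(\<omega>, t). Q' t \<omega>) \<in> borel_measurable (M \<Otimes>\<^sub>M lborel)"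
    using Q unfolding Q'_def by (intro predictable_measurable_version) (simp add: is_predictable_quadratic_variation_def)
  have Qp: "AE \<omega> in M. cadlag_on T (\<lambda>t. Q t \<omega>) \<and> mono_on {0..T} (\<lambda>t. Q t \<omega>) \<and> Q 0 \<omega> = (L 0 \<omega>)\<^sup>2"
    using Q by (simp add: is_predictable_quadratic_variation_def)
  obtain \<sigma> where \<sigma>: "\<And>n. stopping_time F (\<sigma> n)"
      "\<And>n \<omega>. \<omega> \<in> space M \<Longrightarrow> 0 \<le> \<sigma> n \<omega> \<and> \<sigma> n \<omega> \<le> \<sigma> (Suc n) \<omega> \<and> \<sigma> n \<omega> \<le> T"
      "AE \<omega> in M. \<exists>n. \<sigma> n \<omega> = T"
      "\<And>n. martingale M F T (\<lambda>t \<omega>. if 0 < \<sigma> n \<omega> then (L (min t (\<sigma> n \<omega>)) \<omega>)\<^sup>2 - Q (min t (\<sigma> n \<omega>)) \<omega> else 0)"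
    using Q unfolding is_predictable_quadratic_variation_def local_martingale_def by blast
  have [measurable]: "\<sigma> n \<in> borel_measurable M" for n
    using \<sigma>(1,2) by (intro stopping_time_borel_measurable) auto
  have [measurable]: "\<theta> \<in> borel_measurable M" by (intro stopping_time_borel_measurable \<theta>)
  have QT: "Q' T = Q T" using T_pos by (auto simp: Q'_def)
  have [measurable]: "Q T \<in> borel_measurable M"
    unfolding QT[symmetric] using measurable_compose[of "\<lambda>\<omega>. (\<omega>, T)" M, OF _ Q'] by simp
  have QT0: "AE \<omega> in M. 0 \<le> Q T \<omega>"
    using Qp
  proof eventually_elim
    case (elim \<omega>)
    then have "Q 0 \<omega> \<le> Q T \<omega>" using T_pos mono_onD[of "{0..T}" "\<lambda>t. Q t \<omega>" 0 T] by simp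
    then show ?case using elim zero_le_power2[of "L 0 \<omega>"] by linarith
  qed
  have QTi: "integrable M (Q T)"
    using fin QT0 by (intro integrableI_nonneg) auto
  \<comment> \<open>\<open>J\<close> is the least j such that \<theta> is at most
    \<open>tk k j\<close>. Hence \<open>\<theta>k\<close> is \<theta> rounded up to a grid of mesh
    \<open>T / Suc k\<close> ending at T, and the event \<open>J = j\<close> is known at time
    \<open>tk k j\<close>.\<close>
  define tk where "tk k j = T * real j / real (Suc k)" for k j
  define J where "J k \<omega> = nat \<lceil>\<theta> \<omega> * real (Suc k) / T\<rceil>" for k \<omega>
  define \<theta>k where "\<theta>k k \<omega> = tk k (J k \<omega>)" for k \<omega>
  have tk0: "0 \<le> tk k j" for k j using T_pos by (simp add: tk_def)
  have Jle: "J k \<omega> \<le> j \<longleftrightarrow> \<theta> \<omega> \<le> tk k j" for k j \<omega>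
    unfolding J_def tk_def nat_ceiling_le_eq using T_pos by (simp add: field_simps)
  have tkT: "tk k (Suc k) = T" for k by (simp add: tk_def)
  have JK: "J k \<omega> \<le> Suc k" if "\<omega> \<in> space M" for k \<omega> using \<theta>(2)[OF that] by (simp add: Jle tkT)
  have tkle: "tk k j \<le> T" if "j \<le> Suc k" for k j
    using that T_pos by (simp add: tk_def field_simps del: of_nat_Suc)
  have Jset: "{\<omega> \<in> space M. J k \<omega> = j} \<in> sets (F (tk k j))" for k j
  proof -
    have *: "{\<omega> \<in> space M. J k \<omega> \<le> i} \<in> sets (F (tk k i))" for i
      using stopping_timeD[OF \<theta>(1), of "tk k i"] by (simp add: Jle pred_def space_F)
    show ?thesis
    proof (cases j)
      case 0
      then show ?thesis using *[of 0] by simp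
    next
      case (Suc i)
      have "tk k i \<le> tk k j" using T_pos Suc by (simp add: tk_def divide_right_mono)
      then have "{\<omega> \<in> space M. J k \<omega> \<le> i} \<in> sets (F (tk k j))" using *[of i] sets_F_mono by blast
      then have "{\<omega> \<in> space M. J k \<omega> \<le> j} - {\<omega> \<in> space M. J k \<omega> \<le> i} \<in> sets (F (tk k j))" using *[of j] by blast
      moreover have "{\<omega> \<in> space M. J k \<omega> \<le> j} - {\<omega> \<in> space M. J k \<omega> \<le> i} = {\<omega> \<in> space M. J k \<omega> = j}" using Suc by auto
      ultimately show ?thesis by simp
    qed
  qed
  have \<theta>k0: "0 \<le> \<theta>k k \<omega>" for k \<omega> by (simp add: \<theta>k_def tk0)
  have \<theta>kT: "\<theta>k k \<omega> \<le> T" if "\<omega> \<in> space M" for k \<omega> using JK[OF that] by (simp add: \<theta>k_def tkle)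
  have \<theta>kge: "\<theta> \<omega> \<le> \<theta>k k \<omega>" for k \<omega> using Jle[of k \<omega> "J k \<omega>"] by (simp add: \<theta>k_def)
  have \<theta>kle: "\<theta>k k \<omega> \<le> \<theta> \<omega> + T / real (Suc k)" if "\<omega> \<in> space M" for k \<omega>
  proof -
    have "0 \<le> \<theta> \<omega> * real (Suc k) / T" using \<theta>(2)[OF that] T_pos by simp
    then have "real (J k \<omega>) \<le> \<theta> \<omega> * real (Suc k) / T + 1" unfolding J_def by linarith
    then have "T * real (J k \<omega>) / real (Suc k) \<le> T * (\<theta> \<omega> * real (Suc k) / T + 1) / real (Suc k)"
      using T_pos by (intro divide_right_mono mult_left_mono) auto
    also have "\<dots> = \<theta> \<omega> + T / real (Suc k)" using T_pos by (simp add: field_simps del: of_nat_Suc)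
    finally show ?thesis by (simp add: \<theta>k_def tk_def)
  qed
  have \<theta>klim: "(\<lambda>k. \<theta>k k \<omega>) \<longlonglongrightarrow> \<theta> \<omega>" if "\<omega> \<in> space M" for \<omega>
  proof (rule tendsto_sandwich[OF _ _ tendsto_const[of "\<theta> \<omega>"]])
    show "(\<lambda>n. \<theta> \<omega> + T / real (Suc n)) \<longlonglongrightarrow> \<theta> \<omega>"
      using tendsto_add[OF tendsto_const[of "\<theta> \<omega>"] LIMSEQ_Suc[OF lim_const_over_n[of T]]] by simp
  qed (use \<theta>kge \<theta>kle[OF that] in auto)
  have [measurable]: "\<theta>k k \<in> borel_measurable M" for k
    unfolding \<theta>k_def[abs_def] tk_def J_def by measurable
  have ZT: "(\<integral>\<omega>. Z T \<omega> \<partial>M) = 0" if Z: "martingale M F T Z" "AE \<omega> in M. Z 0 \<omega> = 0" for Z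
  proof -
    interpret sigma_finite_subalgebra M "F 0" using sigma_finite_subalgebra_F T_pos by simp
    have i: "integrable M (Z T)" "integrable M (Z 0)" using Z T_pos by (auto simp: martingale_def)
    have "(\<integral>\<omega>. Z T \<omega> \<partial>M) = (\<integral>\<omega>. real_cond_exp M (F 0) (Z T) \<omega> \<partial>M)"
      using real_cond_exp_int(2)[OF i(1)] by simp
    also have "\<dots> = (\<integral>\<omega>. Z 0 \<omega> \<partial>M)"
      using Z(1) T_pos i by (intro integral_cong_AE) (auto simp: martingale_def)
    also have "\<dots> = 0" using Z(2) i by (intro integral_eq_zero_AE)
    finally show ?thesis .
  qed
  \<comment> \<open>One index k drives both approximations, the grid of mesh
    \<open>T / Suc k\<close> and the localizing time \<open>\<sigma> k\<close>.\<close>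
  define u where "u k \<omega> = ennreal (if 0 < \<sigma> k \<omega> then (L' (min (\<theta>k k \<omega>) (\<sigma> k \<omega>)) \<omega>)\<^sup>2 else 0)" for k \<omega>
  define q where "q k \<omega> = (if 0 < \<sigma> k \<omega> then Q' (min (\<theta>k k \<omega>) (\<sigma> k \<omega>)) \<omega> else 0)" for k \<omega>
  have [measurable]: "(\<lambda>\<omega>. L' (f \<omega>) \<omega>) \<in> borel_measurable M" if [measurable]: "f \<in> borel_measurable M" for f
    using measurable_compose[of "\<lambda>\<omega>. (\<omega>, f \<omega>)" M, OF _ L'] by simp
  have [measurable]: "(\<lambda>\<omega>. Q' (f \<omega>) \<omega>) \<in> borel_measurable M" if [measurable]: "f \<in> borel_measurable M" for f
    using measurable_compose[of "\<lambda>\<omega>. (\<omega>, f \<omega>)" M, OF _ Q'] by simp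
  have um[measurable]: "u k \<in> borel_measurable M" for k unfolding u_def[abs_def] by measurable
  have [measurable]: "q k \<in> borel_measurable M" for k unfolding q_def[abs_def] by measurable
  have qb: "AE \<omega> in M. 0 \<le> q k \<omega> \<and> q k \<omega> \<le> Q T \<omega>" for k
  proof -
    have sp: "AE \<omega> in M. \<omega> \<in> space M" by simp
    show ?thesis using Qp QT0 sp
    proof eventually_elim
      case (elim \<omega>)
      define s where "s = min (\<theta>k k \<omega>) (\<sigma> k \<omega>)"
      have s: "s \<in> {0..T}" using \<theta>k0[of k \<omega>] \<theta>kT[of \<omega> k] \<sigma>(2)[of \<omega> k] elim(3) by (auto simp: s_def)
      have "Q 0 \<omega> \<le> Q s \<omega>" "Q s \<omega> \<le> Q T \<omega>"
        using elim(1) s T_pos mono_onD[of "{0..T}" "\<lambda>t. Q t \<omega>" 0 s] mono_onD[of "{0..T}" "\<lambda>t. Q t \<omega>" s T] by auto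
      then have "0 \<le> Q s \<omega>" "Q s \<omega> \<le> Q T \<omega>" using elim(1) zero_le_power2[of "L 0 \<omega>"] by linarith+
      then show ?case using s elim(2) by (auto simp: q_def s_def[symmetric] Q'_def)
    qed
  qed
  have qi: "integrable M (q k)" for k
    by (rule Bochner_Integration.integrable_bound[OF QTi _ eventually_mono[OF qb[of k]]]) auto
  have ub: "(\<integral>\<^sup>+\<omega>. u k \<omega> \<partial>M) \<le> (\<integral>\<^sup>+\<omega>. ennreal (Q T \<omega>) \<partial>M)" for k
  proof -
    let ?Z = "\<lambda>t \<omega>. if 0 < \<sigma> k \<omega> then (L (min t (\<sigma> k \<omega>)) \<omega>)\<^sup>2 - Q (min t (\<sigma> k \<omega>)) \<omega> else 0"
    \<comment> \<open>The bracket starts at \<open>(L 0)\<^sup>2\<close>, so the localized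
      martingale starts at 0 and has mean 0.\<close>
    have Z0: "AE \<omega> in M. ?Z 0 \<omega> = 0" using Qp by eventually_elim (auto simp: min_def)
    note st = martingale_stopped_at_grid[OF \<sigma>(4)[of k], of "Suc k" "tk k" "J k", folded \<theta>k_def]
    have zi: "integrable M (\<lambda>\<omega>. ?Z (\<theta>k k \<omega>) \<omega>)" and z0: "(\<integral>\<omega>. ?Z (\<theta>k k \<omega>) \<omega> \<partial>M) = 0"
      using st JK Jset tk0 tkle ZT[OF \<sigma>(4)[of k] Z0] by auto
    have sp: "AE \<omega> in M. \<omega> \<in> space M" by simp
    have ue: "AE \<omega> in M. u k \<omega> = ennreal (?Z (\<theta>k k \<omega>) \<omega> + q k \<omega>) \<and> 0 \<le> ?Z (\<theta>k k \<omega>) \<omega> + q k \<omega>"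
      using L'L sp
    proof eventually_elim
      case (elim \<omega>)
      have "min (\<theta>k k \<omega>) (\<sigma> k \<omega>) \<in> {0..T}" using \<theta>k0[of k \<omega>] \<theta>kT[of \<omega> k] \<sigma>(2)[of \<omega> k] elim(2) by auto
      then show ?case using elim(1) by (auto simp: u_def q_def Q'_def)
    qed
    have "(\<integral>\<^sup>+\<omega>. u k \<omega> \<partial>M) = (\<integral>\<^sup>+\<omega>. ennreal (?Z (\<theta>k k \<omega>) \<omega> + q k \<omega>) \<partial>M)"
      by (intro nn_integral_cong_AE eventually_mono[OF ue]) simp
    also have "\<dots> = ennreal (\<integral>\<omega>. ?Z (\<theta>k k \<omega>) \<omega> + q k \<omega> \<partial>M)"
      by (intro nn_integral_eq_integral Bochner_Integration.integrable_add zi qi eventually_mono[OF ue]) simp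
    also have "\<dots> = ennreal (\<integral>\<omega>. q k \<omega> \<partial>M)"
      using Bochner_Integration.integral_add[OF zi qi[of k]] z0 by simp
    also have "\<dots> \<le> ennreal (\<integral>\<omega>. Q T \<omega> \<partial>M)"
      by (intro ennreal_leI integral_mono_AE qi QTi eventually_mono[OF qb[of k]]) simp
    also have "\<dots> = (\<integral>\<^sup>+\<omega>. ennreal (Q T \<omega>) \<partial>M)"
      using QT0 by (intro nn_integral_eq_integral[symmetric] QTi)
    finally show ?thesis .
  qed
  have sp: "AE \<omega> in M. \<omega> \<in> space M" by simp
  have "AE \<omega> in M. liminf (\<lambda>k. u k \<omega>) = ennreal ((L (\<theta> \<omega>) \<omega>)\<^sup>2)"
    using L'L Lc \<sigma>(3) sp
  proof eventually_elim
    case (elim \<omega>)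
    obtain n where n: "\<sigma> n \<omega> = T" using elim(3) by blast
    have \<sigma>T: "\<sigma> k \<omega> = T" if "n \<le> k" for k
      using that by (induction k rule: dec_induct) (use n \<sigma>(2)[OF elim(4)] in \<open>auto intro: antisym\<close>)
    have lim: "(\<lambda>k. L (\<theta>k k \<omega>) \<omega>) \<longlonglongrightarrow> L (\<theta> \<omega>) \<omega>"
    proof (cases "\<theta> \<omega> < T")
      case True
      then have "((\<lambda>t. L t \<omega>) \<longlongrightarrow> L (\<theta> \<omega>) \<omega>) (at_right (\<theta> \<omega>))"
        using elim(2) \<theta>(2)[OF elim(4)] by (auto simp: cadlag_on_def)
      then show ?thesis by (rule right_continuous_sequentially) (use \<theta>klim[OF elim(4)] \<theta>kge in auto)
    next
      case False
      then have "\<theta>k k \<omega> = \<theta> \<omega>" for k using \<theta>kT[OF elim(4), of k] \<theta>kge[of \<omega> k] by linarith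
      then show ?thesis by simp
    qed
    have "(\<lambda>k. u k \<omega>) \<longlonglongrightarrow> ennreal ((L (\<theta> \<omega>) \<omega>)\<^sup>2)"
    proof (rule Lim_transform_eventually)
      show "(\<lambda>k. ennreal ((L (\<theta>k k \<omega>) \<omega>)\<^sup>2)) \<longlonglongrightarrow> ennreal ((L (\<theta> \<omega>) \<omega>)\<^sup>2)"
        using lim by (intro tendsto_ennrealI tendsto_power)
      show "\<forall>\<^sub>F k in sequentially. ennreal ((L (\<theta>k k \<omega>) \<omega>)\<^sup>2) = u k \<omega>"
        using eventually_ge_at_top[of n]
      proof eventually_elim
        case (elim k)
        then show ?case using \<sigma>T[OF elim] T_pos \<theta>kT[OF \<open>\<omega> \<in> space M\<close>, of k] \<theta>k0[of k \<omega>]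
            \<open>\<forall>t\<in>{0..T}. L' t \<omega> = L t \<omega>\<close> by (auto simp: u_def min_def)
      qed
    qed
    then show ?case by (intro lim_imp_Liminf) auto
  qed
  then have "(\<integral>\<^sup>+\<omega>. ennreal ((L (\<theta> \<omega>) \<omega>)\<^sup>2) \<partial>M) = (\<integral>\<^sup>+\<omega>. liminf (\<lambda>k. u k \<omega>) \<partial>M)"
    by (intro nn_integral_cong_AE) (auto elim!: eventually_mono)
  also have "\<dots> \<le> liminf (\<lambda>k. \<integral>\<^sup>+\<omega>. u k \<omega> \<partial>M)" by (rule nn_integral_liminf) (rule um)
  also have "\<dots> \<le> liminf (\<lambda>k::nat. \<integral>\<^sup>+\<omega>. ennreal (Q T \<omega>) \<partial>M)"
    using ub by (intro Liminf_mono) auto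
  also have "\<dots> = (\<integral>\<^sup>+\<omega>. ennreal (Q T \<omega>) \<partial>M)" by (simp add: Liminf_const)
  finally show ?thesis .
qed

text \<open>The identity holds for the localized processes \<open>Z n\<close>. They are bounded in
  L2 uniformly in n and eventually agree with \<open>L\<close> along almost every path, hence
  converge to it in L1 at both times.\<close>

lemma local_martingale_L2_imp_martingale:
  assumes L: "local_martingale M F T L" and Q: "is_predictable_quadratic_variation M F T L Q"
    and fin: "(\<integral>\<^sup>+\<omega>. ennreal (Q T \<omega>) \<partial>M) < \<infinity>"
    and st: "0 \<le> s" "s \<le> t" "t \<le> T" and B: "B \<in> sets (F s)"
  shows "(\<integral>\<omega>. indicator B \<omega> * L t \<omega> \<partial>M) = (\<integral>\<omega>. indicator B \<omega> * L s \<omega> \<partial>M)"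
proof -
  define C where "C = enn2real (\<integral>\<^sup>+\<omega>. ennreal (Q T \<omega>) \<partial>M)"
  have C: "(\<integral>\<^sup>+\<omega>. ennreal (Q T \<omega>) \<partial>M) = ennreal C" "0 \<le> C" using fin by (auto simp: C_def)
  have Lm: "L t \<in> borel_measurable M" if "t \<in> {0..T}" for t
    using L that by (intro measurable_from_F[of t]) (auto simp: local_martingale_def adapted_def)
  obtain \<tau> where \<tau>: "\<And>n. stopping_time F (\<tau> n)"
      "\<And>n \<omega>. \<omega> \<in> space M \<Longrightarrow> 0 \<le> \<tau> n \<omega> \<and> \<tau> n \<omega> \<le> \<tau> (Suc n) \<omega> \<and> \<tau> n \<omega> \<le> T"
      "AE \<omega> in M. \<exists>n. \<tau> n \<omega> = T"
      "\<And>n. martingale M F T (\<lambda>t \<omega>. if 0 < \<tau> n \<omega> then L (min t (\<tau> n \<omega>)) \<omega> else 0)"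
    using L unfolding local_martingale_def by blast
  define Z where "Z n t \<omega> = (if 0 < \<tau> n \<omega> then L (min t (\<tau> n \<omega>)) \<omega> else 0)" for n t \<omega>
  have ZM: "martingale M F T (Z n)" for n using \<tau>(4)[of n] by (simp add: Z_def[abs_def])
  have Zi: "integrable M (Z n r)" if "r \<in> {0..T}" for n r using ZM[of n] that by (auto simp: martingale_def)
  have B': "B \<in> sets M" using B sets_F_subset[of s] st by auto
  have conv: "(\<lambda>n. \<integral>\<omega>. indicator B \<omega> * Z n r \<omega> \<partial>M) \<longlonglongrightarrow> (\<integral>\<omega>. indicator B \<omega> * L r \<omega> \<partial>M)"
    if r: "r \<in> {0..T}" for r
  proof -
    have L2: "(\<integral>\<^sup>+\<omega>. ennreal ((L r \<omega>)\<^sup>2) \<partial>M) \<le> ennreal C"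
      using local_martingale_second_moment[OF L Q stopping_time_const _ fin, of r] r unfolding C(1) by simp
    have Z2: "(\<integral>\<^sup>+\<omega>. ennreal ((Z n r \<omega>)\<^sup>2) \<partial>M) \<le> ennreal C" for n
    proof -
      have "(\<integral>\<^sup>+\<omega>. ennreal ((Z n r \<omega>)\<^sup>2) \<partial>M) \<le> (\<integral>\<^sup>+\<omega>. ennreal ((L (min r (\<tau> n \<omega>)) \<omega>)\<^sup>2) \<partial>M)"
        by (intro nn_integral_mono) (simp add: Z_def)
      also have "\<dots> \<le> ennreal C" unfolding C(1)[symmetric]
      proof (rule local_martingale_second_moment[OF L Q _ _ fin, where \<theta>="\<lambda>\<omega>. min r (\<tau> n \<omega>)"])
        show "stopping_time F (\<lambda>\<omega>. min r (\<tau> n \<omega>))"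
          by (rule stopping_time_min[OF stopping_time_const \<tau>(1)])
        show "0 \<le> min r (\<tau> n \<omega>) \<and> min r (\<tau> n \<omega>) \<le> T" if "\<omega> \<in> space M" for \<omega>
          using r \<tau>(2)[OF that, of n] by auto
      qed
      finally show ?thesis .
    qed
    have ev: "AE \<omega> in M. \<forall>\<^sub>F n in sequentially. Z n r \<omega> = L r \<omega>"
    proof -
      have sp: "AE \<omega> in M. \<omega> \<in> space M" by simp
      show ?thesis using \<tau>(3) sp
      proof eventually_elim
        case (elim \<omega>)
        obtain n where n: "\<tau> n \<omega> = T" using elim(1) by blast
        have "\<tau> k \<omega> = T" if "n \<le> k" for k
          using that by (induction k rule: dec_induct) (use n \<tau>(2)[OF elim(2)] in \<open>auto intro: antisym\<close>)
        then have "Z k r \<omega> = L r \<omega>" if "n \<le> k" for k using T_pos r that by (simp add: Z_def)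
        then show ?case unfolding eventually_sequentially by blast
      qed
    qed
    have Zm: "Z n r \<in> borel_measurable M" for n using borel_measurable_integrable[OF Zi[OF r]] .
    have Li: "integrable M (L r)"
      by (rule square_integrable_imp_integrable[OF Lm[OF r] integrableI_nonneg])
         (use le_less_trans[OF L2 ennreal_less_top] Lm[OF r] in auto)
    have l1: "(\<lambda>n. \<integral>\<omega>. \<bar>Z n r \<omega> - L r \<omega>\<bar> \<partial>M) \<longlonglongrightarrow> 0"
      by (rule L1_convergence_of_L2_bounded[where f="\<lambda>n. Z n r", OF Zm Lm[OF r] Z2 L2 C(2) ev])
    have iZ: "integrable M (\<lambda>\<omega>. indicator B \<omega> * Z n r \<omega>)" for n
      using Zi[OF r] B' by (intro integrable_bounded_mult[where c=1]) auto
    have iL: "integrable M (\<lambda>\<omega>. indicator B \<omega> * L r \<omega>)"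
      using Li B' by (intro integrable_bounded_mult[where c=1]) auto
    have "norm ((\<integral>\<omega>. indicator B \<omega> * Z n r \<omega> \<partial>M) - (\<integral>\<omega>. indicator B \<omega> * L r \<omega> \<partial>M)) \<le> (\<integral>\<omega>. \<bar>Z n r \<omega> - L r \<omega>\<bar> \<partial>M)" for n
    proof -
      have "norm ((\<integral>\<omega>. indicator B \<omega> * Z n r \<omega> \<partial>M) - (\<integral>\<omega>. indicator B \<omega> * L r \<omega> \<partial>M))
        = norm (\<integral>\<omega>. indicator B \<omega> * Z n r \<omega> - indicator B \<omega> * L r \<omega> \<partial>M)"
        by (simp only: Bochner_Integration.integral_diff[OF iZ iL])
      also have "\<dots> \<le> (\<integral>\<omega>. norm (indicator B \<omega> * Z n r \<omega> - indicator B \<omega> * L r \<omega>) \<partial>M)"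
        by (rule integral_norm_bound)
      also have "\<dots> \<le> (\<integral>\<omega>. \<bar>Z n r \<omega> - L r \<omega>\<bar> \<partial>M)"
        using iZ[of n] iL Zi[OF r, of n] Li by (intro integral_mono) (auto simp: indicator_def)
      finally show ?thesis .
    qed
    then show ?thesis
      by (intro LIM_zero_cancel[OF Lim_null_comparison[OF always_eventually l1]]) blast
  qed
  have eq: "(\<integral>\<omega>. indicator B \<omega> * Z n t \<omega> \<partial>M) = (\<integral>\<omega>. indicator B \<omega> * Z n s \<omega> \<partial>M)" for n
  proof -
    interpret sigma_finite_subalgebra M "F s" using sigma_finite_subalgebra_F st by simp
    have iZ: "integrable M (\<lambda>\<omega>. indicator B \<omega> * Z n t \<omega>)"
      using Zi[of t n] st B' by (intro integrable_bounded_mult[where c=1]) auto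
    have "(\<integral>\<omega>. indicator B \<omega> * Z n t \<omega> \<partial>M) = (\<integral>\<omega>. indicator B \<omega> * real_cond_exp M (F s) (Z n t) \<omega> \<partial>M)"
    proof (rule real_cond_exp_intg(2)[symmetric, OF iZ])
      show "Z n t \<in> borel_measurable M" using borel_measurable_integrable[OF Zi[of t n]] st by simp
    qed (use B in simp)
    also have "\<dots> = (\<integral>\<omega>. indicator B \<omega> * Z n s \<omega> \<partial>M)"
    proof (rule integral_cong_AE)
      have "AE \<omega> in M. real_cond_exp M (F s) (Z n t) \<omega> = Z n s \<omega>"
        using ZM[of n] st by (auto simp: martingale_def)
      then show "AE \<omega> in M. indicator B \<omega> * real_cond_exp M (F s) (Z n t) \<omega> = indicator B \<omega> * Z n s \<omega>"
        by eventually_elim simp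
      show "(\<lambda>\<omega>. indicator B \<omega> * Z n s \<omega>) \<in> borel_measurable M"
        using borel_measurable_integrable[OF Zi[of s n]] st B' by simp
      show "(\<lambda>\<omega>. indicator B \<omega> * real_cond_exp M (F s) (Z n t) \<omega>) \<in> borel_measurable M"
        using B' by simp
    qed
    finally show ?thesis .
  qed
  have "(\<lambda>n. \<integral>\<omega>. indicator B \<omega> * Z n t \<omega> \<partial>M) \<longlonglongrightarrow> (\<integral>\<omega>. indicator B \<omega> * L s \<omega> \<partial>M)"
    unfolding eq using conv[of s] st by simp
  moreover have "(\<lambda>n. \<integral>\<omega>. indicator B \<omega> * Z n t \<omega> \<partial>M) \<longlonglongrightarrow> (\<integral>\<omega>. indicator B \<omega> * L t \<omega> \<partial>M)"
    using conv[of t] st by simp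
  ultimately show ?thesis by (metis LIMSEQ_unique)
qed

subsection \<open>Square integrable processes\<close>

interpretation Pr: pair_sigma_finite M lborel ..

text \<open>
  Processes live on all of \<open>\<real>\<close>, with arbitrary values outside \<open>[0,T]\<close>; \<open>tr v\<close> cuts them off there and moves
  to the product space \<open>\<Omega> \<times> \<real>\<close>.
\<close>

definition tr :: "(real \<Rightarrow> 'a \<Rightarrow> real) \<Rightarrow> 'a \<times> real \<Rightarrow> real" where
  "tr v x = indicator {0..T} (snd x) * v (snd x) (fst x)"

text \<open>Membership in L2 of the product space, without passing to equivalence classes. The
  condition is placed on the cut-off process because nothing is known outside [0,T].\<close>

definition sqint :: "(real \<Rightarrow> 'a \<Rightarrow> real) \<Rightarrow> bool" where
  "sqint v \<longleftrightarrow> tr v \<in> borel_measurable (M \<Otimes>\<^sub>M lborel) \<and> integrable (M \<Otimes>\<^sub>M lborel) (\<lambda>x. (tr v x)\<^sup>2)"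

definition ip :: "(real \<Rightarrow> 'a \<Rightarrow> real) \<Rightarrow> (real \<Rightarrow> 'a \<Rightarrow> real) \<Rightarrow> real" where
  "ip u v = (\<integral>x. tr u x * tr v x \<partial>(M \<Otimes>\<^sub>M lborel))"

definition cum :: "(real \<Rightarrow> 'a \<Rightarrow> real) \<Rightarrow> real \<Rightarrow> 'a \<Rightarrow> real" where
  "cum v t \<omega> = (LBINT s:{0..t}. v s \<omega>)"

lemma tr_simps:
  "tr (\<lambda>t \<omega>. u t \<omega> + v t \<omega>) x = tr u x + tr v x"
  "tr (\<lambda>t \<omega>. u t \<omega> - v t \<omega>) x = tr u x - tr v x"
  "tr (\<lambda>t \<omega>. c * v t \<omega>) x = c * tr v x"
  by (auto simp: tr_def algebra_simps)

lemma sqint_measurable: "sqint v \<Longrightarrow> tr v \<in> borel_measurable (M \<Otimes>\<^sub>M lborel)"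
  by (simp add: sqint_def)

lemma sqint_mult:
  assumes "sqint u" "sqint v"
  shows "integrable (M \<Otimes>\<^sub>M lborel) (\<lambda>x. tr u x * tr v x)"
  using integrable_mult_of_squares[of "tr u" "M \<Otimes>\<^sub>M lborel" "tr v"] assms by (simp add: sqint_def)

lemma sqint_add: "sqint u \<Longrightarrow> sqint v \<Longrightarrow> sqint (\<lambda>t \<omega>. u t \<omega> + v t \<omega>)"
  using sqint_mult[of u v] unfolding sqint_def tr_simps[abs_def]
  by (auto simp: power2_sum mult.assoc)

lemma sqint_cmult: "sqint v \<Longrightarrow> sqint (\<lambda>t \<omega>. c * v t \<omega>)"
  unfolding sqint_def tr_simps[abs_def] by (auto simp: power_mult_distrib)

lemma sqint_diff: "sqint u \<Longrightarrow> sqint v \<Longrightarrow> sqint (\<lambda>t \<omega>. u t \<omega> - v t \<omega>)"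
  using sqint_add[of u "\<lambda>t \<omega>. - 1 * v t \<omega>"] sqint_cmult[of v "-1"] by simp

lemma ip_commute: "ip u v = ip v u"
  by (simp add: ip_def mult.commute)

lemma ip_add_left: "sqint u \<Longrightarrow> sqint v \<Longrightarrow> sqint w \<Longrightarrow> ip (\<lambda>t \<omega>. u t \<omega> + v t \<omega>) w = ip u w + ip v w"
  by (simp add: ip_def tr_simps distrib_right sqint_mult)

lemma ip_diff_left: "sqint u \<Longrightarrow> sqint v \<Longrightarrow> sqint w \<Longrightarrow> ip (\<lambda>t \<omega>. u t \<omega> - v t \<omega>) w = ip u w - ip v w"
  by (simp add: ip_def tr_simps left_diff_distrib sqint_mult)

lemma ip_cmult_left: "ip (\<lambda>t \<omega>. c * v t \<omega>) w = c * ip v w"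
  by (simp add: ip_def tr_simps mult.assoc)

lemma ip_add_right: "sqint u \<Longrightarrow> sqint v \<Longrightarrow> sqint w \<Longrightarrow> ip w (\<lambda>t \<omega>. u t \<omega> + v t \<omega>) = ip w u + ip w v"
  by (simp add: ip_commute[of w] ip_add_left)

lemma ip_diff_right: "sqint u \<Longrightarrow> sqint v \<Longrightarrow> sqint w \<Longrightarrow> ip w (\<lambda>t \<omega>. u t \<omega> - v t \<omega>) = ip w u - ip w v"
  by (simp add: ip_commute[of w] ip_diff_left)

lemma ip_cmult_right: "ip w (\<lambda>t \<omega>. c * v t \<omega>) = c * ip w v"
  by (simp add: ip_commute[of w] ip_cmult_left)

lemma ip_nonneg: "0 \<le> ip v v"
  by (simp add: ip_def)

lemma ip_zeroD:
  assumes "sqint v" "ip v v = 0"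
  shows "AE x in M \<Otimes>\<^sub>M lborel. tr v x = 0"
proof -
  have "AE x in M \<Otimes>\<^sub>M lborel. tr v x * tr v x = 0"
    using assms(2) sqint_mult[OF assms(1) assms(1)] unfolding ip_def
    by (subst (asm) integral_nonneg_eq_0_iff_AE) auto
  then show ?thesis by simp
qed

lemma AE_pairD: "AE x in M \<Otimes>\<^sub>M lborel. Q x \<Longrightarrow> AE \<omega> in M. AE t in lborel. Q (\<omega>, t)"
  by (rule Pr.AE_pair)

text \<open>The exceptional set is contained in the product of a null set with the real line, which
  is null whether or not \<open>Q\<close> is measurable. Identities that hold along almost every
  path enter the product space in this way.\<close>

lemma AE_pair_fstI:
  fixes Q :: "'a \<Rightarrow> real \<Rightarrow> bool"
  assumes "AE \<omega> in M. \<forall>t. Q \<omega> t"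
  shows "AE x in M \<Otimes>\<^sub>M lborel. Q (fst x) (snd x)"
proof -
  obtain N where N: "N \<in> null_sets M" "{\<omega> \<in> space M. \<not> (\<forall>t. Q \<omega> t)} \<subseteq> N"
    using assms by (auto simp: eventually_ae_filter)
  have "N \<times> (UNIV :: real set) \<in> null_sets (M \<Otimes>\<^sub>M lborel)"
    using N(1) by (intro lborel.times_in_null_sets1) auto
  then show ?thesis by (rule AE_I') (use N(2) in \<open>force simp: space_pair_measure\<close>)
qed

lemma tr_eqI: "AE \<omega> in M. \<forall>t\<in>{0..T}. u t \<omega> = v t \<omega> \<Longrightarrow> AE x in M \<Otimes>\<^sub>M lborel. tr u x = tr v x"
  by (drule AE_pair_fstI[of "\<lambda>\<omega> t. t \<in> {0..T} \<longrightarrow> u t \<omega> = v t \<omega>", unfolded Ball_def[symmetric]])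
     (auto simp: tr_def indicator_def elim!: eventually_mono)

lemma ip_cong:
  assumes "AE x in M \<Otimes>\<^sub>M lborel. tr u x = tr u' x" "sqint u" "sqint u'" "sqint v"
  shows "ip u v = ip u' v"
  unfolding ip_def using assms(2-4)[THEN sqint_measurable]
  by (intro integral_cong_AE borel_measurable_times eventually_mono[OF assms(1)]) auto

lemma LBINT_tr: "(LBINT t:{0..T}. u t \<omega> * v t \<omega>) = (\<integral>t. tr u (\<omega>, t) * tr v (\<omega>, t) \<partial>lborel)"
  by (auto simp: set_lebesgue_integral_def tr_def indicator_def intro!: Bochner_Integration.integral_cong)

lemma set_integrable_tr: "set_integrable lborel {0..T} (\<lambda>t. v t \<omega>) \<longleftrightarrow> integrable lborel (\<lambda>t. tr v (\<omega>, t))"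
  by (simp add: set_integrable_def tr_def)

lemma set_integrable_tr2: "set_integrable lborel {0..T} (\<lambda>t. u t \<omega> * v t \<omega>) \<longleftrightarrow> integrable lborel (\<lambda>t. tr u (\<omega>, t) * tr v (\<omega>, t))"
  unfolding set_integrable_def by (intro Bochner_Integration.integrable_cong) (auto simp: tr_def indicator_def)

lemma ip_eq:
  assumes "sqint u" "sqint v"
  shows "ip u v = (\<integral>\<omega>. (LBINT t:{0..T}. u t \<omega> * v t \<omega>) \<partial>M)"
    and "integrable M (\<lambda>\<omega>. LBINT t:{0..T}. u t \<omega> * v t \<omega>)"
    and "AE \<omega> in M. set_integrable lborel {0..T} (\<lambda>t. u t \<omega> * v t \<omega>)"
  using Pr.integral_fst'[OF sqint_mult[OF assms]] Pr.integrable_fst'[OF sqint_mult[OF assms]]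
    Pr.AE_integrable_fst'[OF sqint_mult[OF assms]]
  by (simp_all add: LBINT_tr ip_def set_integrable_tr2)

lemma integrable_prod:
  fixes f :: "'a \<Rightarrow> real" and g :: "real \<Rightarrow> real"
  assumes f: "integrable M f" and g: "integrable lborel g"
  shows "integrable (M \<Otimes>\<^sub>M lborel) (\<lambda>x. f (fst x) * g (snd x))"
proof -
  note [measurable] = borel_measurable_integrable[OF f] borel_measurable_integrable[OF g]
  show ?thesis
  proof (rule Pr.Fubini_integrable)
    show "integrable M (\<lambda>x. \<integral>y. norm (f (fst (x, y)) * g (snd (x, y))) \<partial>lborel)"
      using f by (simp add: abs_mult)
    show "AE x in M. integrable lborel (\<lambda>y. f (fst (x, y)) * g (snd (x, y)))"
      using g by simp
  qed measurable
qed

lemma integrable_indicator_Icc: "integrable lborel (indicat_real {0..T})"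
  using T_pos by (intro integrable_real_indicator) auto

lemma sqint_rv:
  assumes [measurable]: "f \<in> borel_measurable M" and f: "integrable M (\<lambda>\<omega>. (f \<omega>)\<^sup>2)"
  shows "sqint (\<lambda>t. f)"
proof -
  have [measurable]: "tr (\<lambda>t. f) \<in> borel_measurable (M \<Otimes>\<^sub>M lborel)"
    unfolding tr_def[abs_def] by measurable
  moreover have "integrable (M \<Otimes>\<^sub>M lborel) (\<lambda>x. (tr (\<lambda>t. f) x)\<^sup>2)"
    by (rule Bochner_Integration.integrable_bound[OF integrable_prod[OF f integrable_indicator_Icc]])
       (auto simp: tr_def indicator_def power_mult_distrib)
  ultimately show ?thesis by (simp add: sqint_def)
qed

lemma sqint_bounded_mult:
  assumes c: "continuous_on UNIV c" and v: "sqint v"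
  shows "sqint (\<lambda>t \<omega>. c t * v t \<omega>)"
proof -
  have "bounded (c ` {0..T})"
    by (intro compact_imp_bounded compact_continuous_image continuous_on_subset[OF c]) auto
  then obtain B where "\<forall>x\<in>c ` {0..T}. norm x \<le> B" unfolding bounded_iff by blast
  then have B: "\<And>t. t \<in> {0..T} \<Longrightarrow> \<bar>c t\<bar> \<le> B" by auto
  have [measurable]: "c \<in> borel_measurable borel" using c by (rule borel_measurable_continuous_onI)
  have [measurable]: "tr v \<in> borel_measurable (M \<Otimes>\<^sub>M lborel)" and i: "integrable (M \<Otimes>\<^sub>M lborel) (\<lambda>x. (tr v x)\<^sup>2)"
    using v by (auto simp: sqint_def)
  have e: "tr (\<lambda>t \<omega>. c t * v t \<omega>) x = c (snd x) * tr v x" for x by (simp add: tr_def)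
  have [measurable]: "tr (\<lambda>t \<omega>. c t * v t \<omega>) \<in> borel_measurable (M \<Otimes>\<^sub>M lborel)"
    unfolding e[abs_def] by measurable
  moreover have "integrable (M \<Otimes>\<^sub>M lborel) (\<lambda>x. (tr (\<lambda>t \<omega>. c t * v t \<omega>) x)\<^sup>2)"
  proof (rule Bochner_Integration.integrable_bound[OF integrable_mult_right[OF i, of "B\<^sup>2"]])
    show "AE x in M \<Otimes>\<^sub>M lborel. norm ((tr (\<lambda>t \<omega>. c t * v t \<omega>) x)\<^sup>2) \<le> norm (B\<^sup>2 * (tr v x)\<^sup>2)"
    proof (rule AE_I2)
      fix x :: "'a \<times> real"
      have "(c (snd x))\<^sup>2 \<le> B\<^sup>2" if "snd x \<in> {0..T}"
        using B[OF that] by (metis abs_le_square_iff abs_of_nonneg abs_ge_zero order_trans)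
      then show "norm ((tr (\<lambda>t \<omega>. c t * v t \<omega>) x)\<^sup>2) \<le> norm (B\<^sup>2 * (tr v x)\<^sup>2)"
        by (auto simp: e power_mult_distrib tr_def indicator_def intro: mult_right_mono)
    qed
  qed measurable
  ultimately show ?thesis by (simp add: sqint_def)
qed

lemma sqint_deterministic: "continuous_on UNIV c \<Longrightarrow> sqint (\<lambda>t \<omega>. c t)"
  using sqint_bounded_mult[OF _ sqint_rv[of "\<lambda>_. 1"], of c] by simp

lemma sqint_set_integrable: "sqint v \<Longrightarrow> AE \<omega> in M. set_integrable lborel {0..T} (\<lambda>t. v t \<omega>)"
  using ip_eq(3)[of v "\<lambda>_ _. 1"] sqint_deterministic[of "\<lambda>_. 1"] by simp

lemma cum_eq_tr: "t \<in> {0..T} \<Longrightarrow> cum v t \<omega> = (\<integral>s. indicator {0..t} s * tr v (\<omega>, s) \<partial>lborel)"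
  by (auto simp: cum_def set_lebesgue_integral_def tr_def indicator_def intro!: Bochner_Integration.integral_cong)

text \<open>Cauchy-Schwarz in time, read off from the integral of
  \<open>(\<bar>v s \<omega>\<bar> - a / T)\<^sup>2\<close> being nonnegative, where a is the
  integral of \<open>\<bar>v s \<omega>\<bar>\<close>. The bound is the same for all t, so it
  controls \<open>cum v\<close> at fixed times and as a process.\<close>

lemma cum_square_bound:
  assumes v: "sqint v"
  shows "AE \<omega> in M. \<forall>t\<in>{0..T}. (cum v t \<omega>)\<^sup>2 \<le> T * (LBINT s:{0..T}. v s \<omega> * v s \<omega>)"
  using sqint_set_integrable[OF v] ip_eq(3)[OF v v]
proof eventually_elim
  case (elim \<omega>)
  show ?case
  proof
    fix t assume t: "t \<in> {0..T}"
    have 1: "set_integrable lborel {0..T} (\<lambda>s. \<bar>v s \<omega>\<bar>)" using elim(1) by (rule set_integrable_abs)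
    define a where "a = (LBINT s:{0..T}. \<bar>v s \<omega>\<bar>)"
    have "\<bar>cum v t \<omega>\<bar> \<le> (LBINT s:{0..t}. \<bar>v s \<omega>\<bar>)"
      unfolding cum_def using set_integral_norm_bound[of lborel "{0..t}" "\<lambda>s. v s \<omega>"]
        set_integrable_subset[OF elim(1), of "{0..t}"] t by simp
    also have "\<dots> \<le> a" unfolding a_def set_lebesgue_integral_def
      using t 1 set_integrable_subset[OF 1, of "{0..t}"] by (intro integral_mono) (auto simp: set_integrable_def indicator_def)
    finally have ca: "\<bar>cum v t \<omega>\<bar> \<le> a" .
    have c1: "set_integrable lborel {0..T} (\<lambda>s. c)" for c :: real by (rule borel_integrable_atLeastAtMost') simp
    have cc: "(LBINT s:{0..T}. (c::real)) = c * T" for c using T_pos by (simp add: set_lebesgue_integral_def)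
    have "0 \<le> (LBINT s:{0..T}. (\<bar>v s \<omega>\<bar> - a / T)\<^sup>2)"
      unfolding set_lebesgue_integral_def by (intro integral_nonneg_AE) auto
    also have "(\<lambda>s. (\<bar>v s \<omega>\<bar> - a / T)\<^sup>2) = (\<lambda>s. v s \<omega> * v s \<omega> + (a/T)\<^sup>2 - (2 * (a / T)) * \<bar>v s \<omega>\<bar>)"
      by (auto simp: power2_diff power2_eq_square algebra_simps)
    also have "(LBINT s:{0..T}. v s \<omega> * v s \<omega> + (a/T)\<^sup>2 - (2 * (a / T)) * \<bar>v s \<omega>\<bar>) = (LBINT s:{0..T}. v s \<omega> * v s \<omega>) + (a/T)\<^sup>2 * T - (2 * (a / T)) * a"
      using elim(2) 1 c1 by (subst set_integral_diff set_integral_add; simp add: set_integrable_mult_right set_integral_add cc a_def)+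
    also have "\<dots> = (LBINT s:{0..T}. v s \<omega> * v s \<omega>) - a\<^sup>2 / T"
      using T_pos by (simp add: power2_eq_square field_simps)
    finally have "a\<^sup>2 \<le> T * (LBINT s:{0..T}. v s \<omega> * v s \<omega>)" using T_pos by (simp add: field_simps)
    moreover have "(cum v t \<omega>)\<^sup>2 \<le> a\<^sup>2" using ca by (metis abs_le_square_iff abs_of_nonneg abs_ge_zero order_trans)
    ultimately show "(cum v t \<omega>)\<^sup>2 \<le> T * (LBINT s:{0..T}. v s \<omega> * v s \<omega>)" by linarith
  qed
qed

lemma cum_rv:
  assumes v: "sqint v" and t: "t \<in> {0..T}"
  shows "cum v t \<in> borel_measurable M" "integrable M (\<lambda>\<omega>. (cum v t \<omega>)\<^sup>2)"
proof -
  have [measurable]: "tr v \<in> borel_measurable (M \<Otimes>\<^sub>M lborel)" using v by (rule sqint_measurable)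
  show m[measurable]: "cum v t \<in> borel_measurable M"
    unfolding cum_eq_tr[OF t, abs_def] by measurable
  show "integrable M (\<lambda>\<omega>. (cum v t \<omega>)\<^sup>2)"
  proof (rule Bochner_Integration.integrable_bound[OF integrable_mult_right[OF ip_eq(2)[OF v v], of T]])
    show "AE \<omega> in M. norm ((cum v t \<omega>)\<^sup>2) \<le> norm (T * (LBINT s:{0..T}. v s \<omega> * v s \<omega>))"
      using cum_square_bound[OF v] by eventually_elim (use t in \<open>auto intro: order_trans[OF _ abs_ge_self]\<close>)
  qed measurable
qed

lemma sqint_cum:
  assumes v: "sqint v"
  shows "sqint (cum v)"
proof -
  have [measurable]: "tr v \<in> borel_measurable (M \<Otimes>\<^sub>M lborel)" using v by (rule sqint_measurable)
  have e: "tr (cum v) = (\<lambda>x. indicator {0..T} (snd x) * (\<integral>s. (if 0 \<le> s \<and> s \<le> snd x then tr v (fst x, s) else 0) \<partial>lborel))"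
    by (auto simp: tr_def[of "cum v"] cum_eq_tr indicator_def fun_eq_iff intro!: Bochner_Integration.integral_cong)
  have [measurable]: "tr (cum v) \<in> borel_measurable (M \<Otimes>\<^sub>M lborel)"
    unfolding e by measurable
  have b: "AE x in M \<Otimes>\<^sub>M lborel. norm ((tr (cum v) x)\<^sup>2) \<le> norm (T * (LBINT s:{0..T}. v s (fst x) * v s (fst x)) * indicator {0..T} (snd x))"
  proof -
    have "AE \<omega> in M. \<forall>t. t \<in> {0..T} \<longrightarrow> (cum v t \<omega>)\<^sup>2 \<le> T * (LBINT s:{0..T}. v s \<omega> * v s \<omega>)"
      using cum_square_bound[OF v] by eventually_elim auto
    from AE_pair_fstI[OF this] show ?thesis
      by eventually_elim (auto simp: tr_def indicator_def intro: order_trans[OF _ abs_ge_self])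
  qed
  have "integrable (M \<Otimes>\<^sub>M lborel) (\<lambda>x. (tr (cum v) x)\<^sup>2)"
    by (rule Bochner_Integration.integrable_bound[OF integrable_prod[OF integrable_mult_right[OF ip_eq(2)[OF v v], of T] integrable_indicator_Icc] _ b])
       measurable
  then show ?thesis by (simp add: sqint_def)
qed

lemma cum_add:
  assumes "sqint u" "sqint v"
  shows "AE \<omega> in M. \<forall>t\<in>{0..T}. cum (\<lambda>t \<omega>. u t \<omega> + v t \<omega>) t \<omega> = cum u t \<omega> + cum v t \<omega>"
  using assms[THEN sqint_set_integrable]
proof eventually_elim
  case (elim \<omega>)
  then show ?case by (auto simp: cum_def intro!: set_integral_add(2) set_integrable_subset[where A="{0..T}"])
qed

lemma cum_cmult: "cum (\<lambda>t \<omega>. c * v t \<omega>) t \<omega> = c * cum v t \<omega>"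
  by (simp add: cum_def)

lemma cum_cong:
  assumes "AE x in M \<Otimes>\<^sub>M lborel. tr u x = tr v x" "sqint u" "sqint v"
  shows "AE \<omega> in M. \<forall>t\<in>{0..T}. cum u t \<omega> = cum v t \<omega>"
  using AE_pairD[OF assms(1)] assms(2,3)[THEN sqint_set_integrable]
proof eventually_elim
  case (elim \<omega>)
  have [measurable]: "(\<lambda>s. tr u (\<omega>, s)) \<in> borel_measurable lborel" "(\<lambda>s. tr v (\<omega>, s)) \<in> borel_measurable lborel"
    using elim(2,3) unfolding set_integrable_tr by auto
  show ?case
  proof
    fix t assume t: "t \<in> {0..T}"
    show "cum u t \<omega> = cum v t \<omega>" unfolding cum_eq_tr[OF t]
      using elim(1) by (intro integral_cong_AE) (auto elim!: eventually_mono)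
  qed
qed

text \<open>The definition of progressive measurability lives on [0,t] with time as first
  coordinate. Extension by 0 to the real line keeps \<open>F t\<close> as the other factor, which
  makes integrals up to t \<open>F t\<close>-measurable.\<close>

lemma progressive_joint:
  assumes v: "progressively_measurable F T v" and t: "t \<in> {0..T}"
  shows "(\<lambda>(\<omega>, s). indicator {0..t} s * v s \<omega>) \<in> borel_measurable (F t \<Otimes>\<^sub>M lborel)"
proof -
  have 1: "(\<lambda>(s, \<omega>). v s \<omega>) \<in> borel_measurable (restrict_space borel {0..t} \<Otimes>\<^sub>M F t)"
    using v t by (simp add: progressively_measurable_def)
  have "prod.swap \<in> measurable (restrict_space (F t \<Otimes>\<^sub>M lborel) (space (F t) \<times> {0..t})) (restrict_space borel {0..t} \<Otimes>\<^sub>M F t)"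
  proof (rule measurable_pair)
    have "snd \<in> measurable (restrict_space (F t \<Otimes>\<^sub>M lborel) (space (F t) \<times> {0..t})) (restrict_space borel {0..t})"
      by (intro measurable_restrict_space2 measurable_restrict_space1) (auto simp: space_restrict_space)
    then show "fst \<circ> prod.swap \<in> measurable (restrict_space (F t \<Otimes>\<^sub>M lborel) (space (F t) \<times> {0..t})) (restrict_space borel {0..t})"
      by (simp add: comp_def)
    have "fst \<in> measurable (restrict_space (F t \<Otimes>\<^sub>M lborel) (space (F t) \<times> {0..t})) (F t)"
      by (intro measurable_restrict_space1) simp
    then show "snd \<circ> prod.swap \<in> measurable (restrict_space (F t \<Otimes>\<^sub>M lborel) (space (F t) \<times> {0..t})) (F t)"
      by (simp add: comp_def)
  qed
  from measurable_compose[OF this 1]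
  have "(\<lambda>(\<omega>, s). v s \<omega>) \<in> borel_measurable (restrict_space (F t \<Otimes>\<^sub>M lborel) (space (F t) \<times> {0..t}))"
    by (simp add: case_prod_beta')
  then have "(\<lambda>x. indicator (space (F t) \<times> {0..t}) x * (\<lambda>(\<omega>, s). v s \<omega>) x) \<in> borel_measurable (F t \<Otimes>\<^sub>M lborel)"
    by (subst (asm) borel_measurable_restrict_space_iff) (auto simp: space_pair_measure)
  then show ?thesis
    by (rule measurable_cong[THEN iffD1, rotated]) (auto simp: space_pair_measure indicator_def)
qed

lemma measurable_ident_F: "t \<in> {0..T} \<Longrightarrow> (\<lambda>x. x) \<in> measurable M (F t)"
  using sets_F_subset[of t] by (intro measurableI) (auto simp: space_F intro: sets.Int)

lemma progressive_tr:
  assumes v: "progressively_measurable F T v"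
  shows "tr v \<in> borel_measurable (M \<Otimes>\<^sub>M lborel)"
proof -
  have "(\<lambda>x. (fst x, snd x)) \<in> measurable (M \<Otimes>\<^sub>M lborel) (F T \<Otimes>\<^sub>M lborel)"
    using T_pos measurable_compose[OF measurable_fst measurable_ident_F[of T]] by (intro measurable_Pair) auto
  from measurable_compose[OF this progressive_joint[OF v, of T]] T_pos
  show ?thesis by (simp add: tr_def[abs_def])
qed

lemma progressive_adapted:
  assumes v: "progressively_measurable F T v" and t: "t \<in> {0..T}"
  shows "v t \<in> borel_measurable (F t)" "cum v t \<in> borel_measurable (F t)"
proof -
  note m[measurable] = progressive_joint[OF v t]
  have "(\<lambda>\<omega>. (\<omega>, t)) \<in> measurable (F t) (F t \<Otimes>\<^sub>M lborel)" by simp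
  note * = measurable_compose[OF this m]
  have e: "(\<lambda>\<omega>. case (\<omega>, t) of (\<omega>, s) \<Rightarrow> indicator {0..t} s * v s \<omega>) = v t"
    using t by (simp add: fun_eq_iff)
  show "v t \<in> borel_measurable (F t)" using * unfolding e .
  have "(\<lambda>\<omega>. \<integral>s. indicator {0..t} s * v s \<omega> \<partial>lborel) \<in> borel_measurable (F t)"
    by (intro lborel.borel_measurable_lebesgue_integral) simp
  then show "cum v t \<in> borel_measurable (F t)"
    by (simp add: cum_def[abs_def] set_lebesgue_integral_def)
qed

text \<open>Tonelli turns the iterated integral of the definition into a product integral;
  progressive measurability supplies the joint measurability for it.\<close>

lemma admissible_iff: "v \<in> admissible M F T \<longleftrightarrow> progressively_measurable F T v \<and> sqint v"
proof (cases "progressively_measurable F T v")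
  case True
  note m[measurable] = progressive_tr[OF True]
  have "(\<integral>\<^sup>+\<omega>. (\<integral>\<^sup>+s\<in>{0..T}. ennreal ((v s \<omega>)\<^sup>2) \<partial>lborel) \<partial>M) = (\<integral>\<^sup>+\<omega>. (\<integral>\<^sup>+s. ennreal ((tr v (\<omega>, s))\<^sup>2) \<partial>lborel) \<partial>M)"
    by (intro nn_integral_cong) (auto simp: tr_def indicator_def)
  also have "\<dots> = (\<integral>\<^sup>+x. ennreal ((tr v x)\<^sup>2) \<partial>(M \<Otimes>\<^sub>M lborel))"
    by (rule lborel.nn_integral_fst) measurable
  finally have e: "(\<integral>\<^sup>+\<omega>. (\<integral>\<^sup>+s\<in>{0..T}. ennreal ((v s \<omega>)\<^sup>2) \<partial>lborel) \<partial>M) = (\<integral>\<^sup>+x. ennreal ((tr v x)\<^sup>2) \<partial>(M \<Otimes>\<^sub>M lborel))" .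
  show ?thesis using True unfolding admissible_def mem_Collect_eq e sqint_def
    by (auto simp: integrable_iff_bounded)
qed (simp add: admissible_def)

lemma admissible_combine:
  assumes "u \<in> admissible M F T" "v \<in> admissible M F T"
  shows "(\<lambda>t \<omega>. u t \<omega> + c * v t \<omega>) \<in> admissible M F T"
proof -
  have "progressively_measurable F T (\<lambda>t \<omega>. u t \<omega> + c * v t \<omega>)"
    using assms unfolding admissible_iff progressively_measurable_def
    by (auto simp: case_prod_beta' intro!: borel_measurable_add borel_measurable_times)
  then show ?thesis using assms by (auto simp: admissible_iff intro!: sqint_add sqint_cmult)
qed

lemma admissible_deterministic:
  assumes "continuous_on UNIV c"
  shows "(\<lambda>t \<omega>. c t) \<in> admissible M F T"
proof -
  have [measurable]: "c \<in> borel_measurable borel" using assms by (rule borel_measurable_continuous_onI)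
  have "progressively_measurable F T (\<lambda>t \<omega>. c t)"
    unfolding progressively_measurable_def case_prod_beta'
    by (auto intro!: measurable_compose[OF measurable_fst] measurable_restrict_space1)
  then show ?thesis using sqint_deterministic[OF assms] by (simp add: admissible_iff)
qed

text \<open>The kernel splits into \<open>exp (- \<rho> * t)\<close> and
  \<open>exp (\<rho> * s)\<close>. The convolution becomes \<open>cum\<close> between two continuous
  factors and falls under the closure rules for \<open>sqint\<close>.\<close>

lemma transient_impact_eq:
  "transient_impact \<gamma> \<rho> y v t \<omega> = exp (- \<rho> * t) * y + \<gamma> * (exp (- \<rho> * t) * cum (\<lambda>s \<omega>. exp (\<rho> * s) * v s \<omega>) t \<omega>)"
proof -
  have e: "exp (- \<rho> * (t - s)) * v s \<omega> = exp (- \<rho> * t) * (exp (\<rho> * s) * v s \<omega>)" for s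
  proof -
    have "exp (- \<rho> * (t - s)) = exp (- \<rho> * t) * exp (\<rho> * s)"
      by (simp add: exp_add[symmetric] right_diff_distrib)
    then show ?thesis by simp
  qed
  show ?thesis unfolding transient_impact_def cum_def e by simp
qed

lemma sqint_transient_impact:
  assumes "sqint v"
  shows "sqint (transient_impact \<gamma> \<rho> y v)"
proof -
  have "sqint (\<lambda>t \<omega>. exp (- \<rho> * t) * y + \<gamma> * (exp (- \<rho> * t) * cum (\<lambda>s \<omega>. exp (\<rho> * s) * v s \<omega>) t \<omega>))"
    using assms by (intro sqint_add sqint_cmult sqint_bounded_mult[of "\<lambda>t. exp (- \<rho> * t)"] sqint_cum
        sqint_bounded_mult[of "\<lambda>t. exp (\<rho> * t)"] sqint_deterministic continuous_intros)
  then show ?thesis by (simp add: transient_impact_eq[abs_def])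
qed

lemma inventory_eq: "inventory x v t \<omega> = x - cum v t \<omega>"
  by (simp add: inventory_def cum_def)

lemma sqint_inventory: "sqint v \<Longrightarrow> sqint (inventory x v)"
  using sqint_diff[OF sqint_deterministic[of "\<lambda>_. x"] sqint_cum[of v]] by (simp add: inventory_eq[abs_def])

lemma T_in: "T \<in> {0..T}" using T_pos by simp

lemma inventory_rv:
  assumes "sqint v" "t \<in> {0..T}"
  shows "inventory x v t \<in> borel_measurable M" "integrable M (\<lambda>\<omega>. (inventory x v t \<omega>)\<^sup>2)"
proof -
  note c = cum_rv[OF assms]
  have i: "integrable M (cum v t)" by (rule square_integrable_imp_integrable[OF c])
  show "inventory x v t \<in> borel_measurable M" unfolding inventory_eq[abs_def] using c(1) by simp
  show "integrable M (\<lambda>\<omega>. (inventory x v t \<omega>)\<^sup>2)" unfolding inventory_eq power2_diff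
    using c i by auto
qed

section \<open>Duality formulas and martingales tested on sets\<close>

lemma ip_const:
  assumes f: "f \<in> borel_measurable M" "integrable M (\<lambda>\<omega>. (f \<omega>)\<^sup>2)" and h: "sqint h"
  shows "ip (\<lambda>t. f) h = (\<integral>\<omega>. cum h T \<omega> * f \<omega> \<partial>M)"
  unfolding ip_eq(1)[OF sqint_rv[OF f] h] by (simp add: cum_def mult.commute)

text \<open>Integration by parts along each path, then expectation. Together with
  \<open>ip_const\<close> this says that the adjoint of \<open>cum\<close> integrates from t to T,
  so a direction h can be freed from its integral.\<close>

lemma ip_by_parts:
  assumes u: "sqint u" and h: "sqint h"
  shows "ip u (cum h) + ip (cum u) h = (\<integral>\<omega>. cum h T \<omega> * cum u T \<omega> \<partial>M)"
proof -
  note i = ip_eq[OF u sqint_cum[OF h]] and j = ip_eq[OF sqint_cum[OF u] h]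
  have "ip u (cum h) + ip (cum u) h = (\<integral>\<omega>. (LBINT t:{0..T}. u t \<omega> * cum h t \<omega>) + (LBINT t:{0..T}. cum u t \<omega> * h t \<omega>) \<partial>M)"
    using i j by simp
  also have "\<dots> = (\<integral>\<omega>. cum h T \<omega> * cum u T \<omega> \<partial>M)"
  proof (rule integral_cong_AE)
    show "AE \<omega> in M. (LBINT t:{0..T}. u t \<omega> * cum h t \<omega>) + (LBINT t:{0..T}. cum u t \<omega> * h t \<omega>) = cum h T \<omega> * cum u T \<omega>"
      using i(3) j(3) sqint_set_integrable[OF u] sqint_set_integrable[OF h]
    proof eventually_elim
      case (elim \<omega>)
      have c0: "cum v 0 \<omega> = 0" for v unfolding cum_def by (rule LBINT_refl)
      have "(LBINT t:{0..T}. u t \<omega> * cum h t \<omega> + cum u t \<omega> * h t \<omega>) = cum u T \<omega> * cum h T \<omega> - cum u 0 \<omega> * cum h 0 \<omega>"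
        using T_pos elim(3,4) by (intro ac_by_parts(2)) (simp_all add: c0, simp_all add: cum_def)
      then show ?case using elim(1,2) by (simp add: c0 set_integral_add mult.commute)
    qed
  qed (use i(2) j(2) cum_rv(1)[OF u T_in] cum_rv(1)[OF h T_in] in auto)
  finally show ?thesis .
qed

text \<open>The martingale property in integrated form. Equalities of this kind pass to versions and
  can be integrated over time.\<close>

definition martingale_increments :: "(real \<Rightarrow> 'a \<Rightarrow> real) \<Rightarrow> bool" where
  "martingale_increments K \<longleftrightarrow> (\<forall>s t B. 0 \<le> s \<longrightarrow> s \<le> t \<longrightarrow> t \<le> T \<longrightarrow> B \<in> sets (F s) \<longrightarrow>
    (\<integral>\<omega>. indicator B \<omega> * K t \<omega> \<partial>M) = (\<integral>\<omega>. indicator B \<omega> * K s \<omega> \<partial>M))"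

text \<open>Square integrable as a process and at every single time: values at T and at a fixed t
  occur in the formulas, and the class of \<open>K\<close> on the product space does not determine
  them.\<close>

definition L2_process :: "(real \<Rightarrow> 'a \<Rightarrow> real) \<Rightarrow> bool" where
  "L2_process K \<longleftrightarrow> sqint K \<and> (\<forall>t\<in>{0..T}. K t \<in> borel_measurable M \<and> integrable M (\<lambda>\<omega>. (K t \<omega>)\<^sup>2))"

lemma L2_processD:
  assumes "L2_process K"
  shows "sqint K" "t \<in> {0..T} \<Longrightarrow> K t \<in> borel_measurable M" "t \<in> {0..T} \<Longrightarrow> integrable M (\<lambda>\<omega>. (K t \<omega>)\<^sup>2)"
    "t \<in> {0..T} \<Longrightarrow> integrable M (K t)"
  using assms by (auto simp: L2_process_def intro: square_integrable_imp_integrable)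

lemma L2_process_cum: "sqint v \<Longrightarrow> L2_process (cum v)"
  using cum_rv by (simp add: L2_process_def sqint_cum)

lemma L2_process_inventory: "sqint v \<Longrightarrow> L2_process (inventory x v)"
  using inventory_rv by (simp add: L2_process_def sqint_inventory)

lemma L2_process_transient_impact:
  assumes v: "sqint v"
  shows "L2_process (transient_impact \<gamma> \<rho> y v)"
  unfolding L2_process_def
proof (intro conjI ballI sqint_transient_impact v)
  fix t assume t: "t \<in> {0..T}"
  have e: "sqint (\<lambda>s \<omega>. exp (\<rho> * s) * v s \<omega>)"
    by (intro sqint_bounded_mult v continuous_intros)
  note c = cum_rv[OF e t]
  have i: "integrable M (cum (\<lambda>s \<omega>. exp (\<rho> * s) * v s \<omega>) t)" by (rule square_integrable_imp_integrable[OF c])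
  show "transient_impact \<gamma> \<rho> y v t \<in> borel_measurable M" unfolding transient_impact_eq[abs_def] using c(1) by simp
  show "integrable M (\<lambda>\<omega>. (transient_impact \<gamma> \<rho> y v t \<omega>)\<^sup>2)" unfolding transient_impact_eq power2_sum power_mult_distrib
    using c i by auto
qed

text \<open>Exchanging the integrals leaves, for almost every t, the mean of \<open>h t\<close>
  times an increment after t. It vanishes because \<open>h t\<close> is
  \<open>F t\<close>-measurable.\<close>

lemma ip_martingale_increment:
  assumes N: "L2_process N" "martingale_increments N" and h: "h \<in> admissible M F T"
  shows "ip (\<lambda>t \<omega>. N T \<omega> - N t \<omega>) h = 0"
proof -
  define B where "B t \<omega> = N T \<omega> - N t \<omega>" for t \<omega>
  have hs: "sqint h" using h by (simp add: admissible_iff)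
  note NT = L2_processD(2,3)[OF N(1) T_in]
  have B: "sqint B" unfolding B_def[abs_def] by (intro sqint_diff L2_processD(1)[OF N(1)] sqint_rv NT)
  have i: "integrable (M \<Otimes>\<^sub>M lborel) (\<lambda>(\<omega>, t). tr B (\<omega>, t) * tr h (\<omega>, t))"
    using sqint_mult[OF B hs] by (simp add: case_prod_unfold)
  have ae: "AE t in lborel. (\<integral>\<omega>. tr B (\<omega>, t) * tr h (\<omega>, t) \<partial>M) = 0"
    using Pr.AE_integrable_snd[OF i]
  proof eventually_elim
    case (elim t)
    show ?case
    proof (cases "t \<in> {0..T}")
      case True
      interpret sigma_finite_subalgebra M "F t" using sigma_finite_subalgebra_F True by simp
      have hB: "integrable M (\<lambda>\<omega>. h t \<omega> * B t \<omega>)" using elim True by (simp add: tr_def mult.commute)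
      have hF: "h t \<in> borel_measurable (F t)" using progressive_adapted(1)[of h t] h True by (simp add: admissible_iff)
      note Nt = L2_processD(4)[OF N(1) True] L2_processD(4)[OF N(1) T_in]
      have Bi: "integrable M (B t)" unfolding B_def[abs_def] using Nt by simp
      have "AE \<omega> in M. real_cond_exp M (F t) (B t) \<omega> = 0"
      proof (rule real_cond_exp_charact[OF _ Bi])
        fix C assume C: "C \<in> sets (F t)"
        then have CM: "C \<in> sets M" using sets_F_subset[of t] True by auto
        have "integrable M (\<lambda>\<omega>. indicator C \<omega> * N T \<omega>)" "integrable M (\<lambda>\<omega>. indicator C \<omega> * N t \<omega>)"
          using Nt CM by (auto intro!: integrable_bounded_mult[where c=1])
        moreover have "(\<integral>\<omega>. indicator C \<omega> * N T \<omega> \<partial>M) = (\<integral>\<omega>. indicator C \<omega> * N t \<omega> \<partial>M)"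
          using N(2) C True unfolding martingale_increments_def by auto
        ultimately show "(\<integral>\<omega>\<in>C. B t \<omega> \<partial>M) = (\<integral>\<omega>\<in>C. 0 \<partial>M)"
          by (simp add: set_lebesgue_integral_def B_def right_diff_distrib)
      qed auto
      then have "(\<integral>\<omega>. h t \<omega> * real_cond_exp M (F t) (B t) \<omega> \<partial>M) = (\<integral>\<omega>. 0 \<partial>M)"
        using hF True measurable_from_F[of t "h t"] by (intro integral_cong_AE) (auto elim!: eventually_mono)
      then have "(\<integral>\<omega>. h t \<omega> * B t \<omega> \<partial>M) = 0"
        using real_cond_exp_intg(2)[OF hB hF] Bi by simp
      then show ?thesis using True by (simp add: tr_def mult.commute)
    qed (simp add: tr_def)
  qed
  have "ip B h = (\<integral>t. (\<integral>\<omega>. tr B (\<omega>, t) * tr h (\<omega>, t) \<partial>M) \<partial>lborel)"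
    unfolding ip_def using Pr.integral_snd[OF i] by (simp add: case_prod_unfold)
  also have "\<dots> = 0" using ae by (rule integral_eq_zero_AE)
  finally show ?thesis by (simp add: B_def[abs_def])
qed

lemma L2_processI:
  assumes m: "tr X \<in> borel_measurable (M \<Otimes>\<^sub>M lborel)"
    and C: "\<And>t. t \<in> {0..T} \<Longrightarrow> (\<integral>\<^sup>+\<omega>. ennreal ((X t \<omega>)\<^sup>2) \<partial>M) \<le> ennreal C"
  shows "L2_process X"
proof -
  note [measurable] = m
  have "(\<integral>\<^sup>+x. ennreal ((tr X x)\<^sup>2) \<partial>(M \<Otimes>\<^sub>M lborel)) = (\<integral>\<^sup>+t. (\<integral>\<^sup>+\<omega>. ennreal ((tr X (\<omega>, t))\<^sup>2) \<partial>M) \<partial>lborel)"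
    by (rule Pr.nn_integral_snd[symmetric]) measurable
  also have "\<dots> \<le> (\<integral>\<^sup>+t. ennreal C * indicator {0..T} t \<partial>lborel)"
    by (intro nn_integral_mono) (auto simp: tr_def indicator_def intro: C)
  also have "\<dots> < \<infinity>" using T_pos by (simp add: nn_integral_cmult_indicator ennreal_mult_less_top)
  finally have "sqint X" by (auto simp: sqint_def intro!: integrableI_nonneg)
  moreover have "X t \<in> borel_measurable M" if t: "t \<in> {0..T}" for t
  proof -
    have "(\<lambda>\<omega>. (\<omega>, t)) \<in> measurable M (M \<Otimes>\<^sub>M lborel)" by simp
    note * = measurable_compose[OF this m]
    have e: "(\<lambda>\<omega>. tr X (\<omega>, t)) = X t" using t by (simp add: tr_def fun_eq_iff)
    show ?thesis using * unfolding e .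
  qed
  moreover have "integrable M (\<lambda>\<omega>. (X t \<omega>)\<^sup>2)" if t: "t \<in> {0..T}" "X t \<in> borel_measurable M" for t
    by (rule integrableI_nonneg) (use t le_less_trans[OF C[OF t(1)] ennreal_less_top] in auto)
  ultimately show ?thesis by (auto simp: L2_process_def)
qed

lemma L2_process_version:
  assumes m: "\<And>t. t \<in> {0..T} \<Longrightarrow> X t \<in> borel_measurable M" and cl: "AE \<omega> in M. cadlag_on T (\<lambda>t. X t \<omega>)"
    and C: "\<And>t. t \<in> {0..T} \<Longrightarrow> (\<integral>\<^sup>+\<omega>. ennreal ((X t \<omega>)\<^sup>2) \<partial>M) \<le> ennreal C"
  obtains X' where "L2_process X'" "AE \<omega> in M. \<forall>t\<in>{0..T}. X' t \<omega> = X t \<omega>"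
proof -
  obtain X' where X': "(\<lambda>(\<omega>, t). X' t \<omega>) \<in> borel_measurable (M \<Otimes>\<^sub>M lborel)" "AE \<omega> in M. \<forall>t\<in>{0..T}. X' t \<omega> = X t \<omega>"
    using cadlag_measurable_version[OF m cl] by blast
  have "L2_process X'"
  proof (rule L2_processI)
    have [measurable]: "(\<lambda>x. X' (snd x) (fst x)) \<in> borel_measurable (M \<Otimes>\<^sub>M lborel)" using X'(1) by (simp add: case_prod_unfold)
    show "tr X' \<in> borel_measurable (M \<Otimes>\<^sub>M lborel)" unfolding tr_def[abs_def] by measurable
    fix t assume t: "t \<in> {0..T}"
    have "(\<integral>\<^sup>+\<omega>. ennreal ((X' t \<omega>)\<^sup>2) \<partial>M) = (\<integral>\<^sup>+\<omega>. ennreal ((X t \<omega>)\<^sup>2) \<partial>M)"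
    proof (rule nn_integral_cong_AE)
      show "AE \<omega> in M. ennreal ((X' t \<omega>)\<^sup>2) = ennreal ((X t \<omega>)\<^sup>2)" using X'(2) by eventually_elim (use t in auto)
    qed
    then show "(\<integral>\<^sup>+\<omega>. ennreal ((X' t \<omega>)\<^sup>2) \<partial>M) \<le> ennreal C" using C[OF t] by simp
  qed
  then show ?thesis using X'(2) by (rule that)
qed

lemma martingale_increments_version:
  assumes m: "\<And>t. t \<in> {0..T} \<Longrightarrow> X t \<in> borel_measurable M" and X': "L2_process X'" "AE \<omega> in M. \<forall>t\<in>{0..T}. X' t \<omega> = X t \<omega>"
    and inc: "\<And>s t B. 0 \<le> s \<Longrightarrow> s \<le> t \<Longrightarrow> t \<le> T \<Longrightarrow> B \<in> sets (F s) \<Longrightarrow>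
      (\<integral>\<omega>. indicator B \<omega> * X t \<omega> \<partial>M) = (\<integral>\<omega>. indicator B \<omega> * X s \<omega> \<partial>M)"
  shows "martingale_increments X'"
  unfolding martingale_increments_def
proof (intro allI impI)
  fix s t B assume st: "0 \<le> s" "s \<le> t" "t \<le> T" and B: "B \<in> sets (F s)"
  have BM: "B \<in> sets M" using B sets_F_subset[of s] st by auto
  have e: "(\<integral>\<omega>. indicator B \<omega> * X' r \<omega> \<partial>M) = (\<integral>\<omega>. indicator B \<omega> * X r \<omega> \<partial>M)" if r: "r \<in> {0..T}" for r
  proof (rule integral_cong_AE)
    show "AE \<omega> in M. indicator B \<omega> * X' r \<omega> = indicator B \<omega> * X r \<omega>" using X'(2) by eventually_elim (use r in auto)
    show "(\<lambda>\<omega>. indicator B \<omega> * X' r \<omega>) \<in> borel_measurable M" using L2_processD(2)[OF X'(1) r] BM by simp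
    show "(\<lambda>\<omega>. indicator B \<omega> * X r \<omega>) \<in> borel_measurable M" using m[OF r] BM by simp
  qed
  show "(\<integral>\<omega>. indicator B \<omega> * X' t \<omega> \<partial>M) = (\<integral>\<omega>. indicator B \<omega> * X' s \<omega> \<partial>M)"
    using e[of t] e[of s] inc[OF st B] st by simp
qed

text \<open>For the moment bound, conditioning on \<open>F t\<close> shows that
  \<open>(N t)\<^sup>2\<close> and \<open>N t * N T\<close> have the same mean, and twice the
  product is at most the sum of the squares. The bound is uniform in time, as
  \<open>L2_process_version\<close> requires.\<close>

lemma square_integrable_martingale_facts:
  assumes N: "square_integrable_martingale M F T N"
  shows "\<And>t. t \<in> {0..T} \<Longrightarrow> N t \<in> borel_measurable M"
    and "\<And>s t B. 0 \<le> s \<Longrightarrow> s \<le> t \<Longrightarrow> t \<le> T \<Longrightarrow> B \<in> sets (F s) \<Longrightarrow>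
      (\<integral>\<omega>. indicator B \<omega> * N t \<omega> \<partial>M) = (\<integral>\<omega>. indicator B \<omega> * N s \<omega> \<partial>M)"
    and "\<And>t. t \<in> {0..T} \<Longrightarrow> (\<integral>\<^sup>+\<omega>. ennreal ((N t \<omega>)\<^sup>2) \<partial>M) \<le> ennreal (\<integral>\<omega>. (N T \<omega>)\<^sup>2 \<partial>M)"
proof -
  have Ni: "integrable M (N t)" and N2: "integrable M (\<lambda>\<omega>. (N t \<omega>)\<^sup>2)" and NF: "N t \<in> borel_measurable (F t)" if "t \<in> {0..T}" for t
    using N that by (auto simp: square_integrable_martingale_def martingale_def adapted_def)
  have Nc: "AE \<omega> in M. real_cond_exp M (F s) (N t) \<omega> = N s \<omega>" if "0 \<le> s" "s \<le> t" "t \<le> T" for s t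
    using N that by (auto simp: square_integrable_martingale_def martingale_def)
  show Nm: "N t \<in> borel_measurable M" if "t \<in> {0..T}" for t using borel_measurable_integrable[OF Ni[OF that]] .
  show "(\<integral>\<omega>. indicator B \<omega> * N t \<omega> \<partial>M) = (\<integral>\<omega>. indicator B \<omega> * N s \<omega> \<partial>M)"
    if st: "0 \<le> s" "s \<le> t" "t \<le> T" and B: "B \<in> sets (F s)" for s t B
  proof -
    interpret sigma_finite_subalgebra M "F s" using sigma_finite_subalgebra_F st by simp
    have BM: "B \<in> sets M" using B sets_F_subset[of s] st by auto
    have t: "t \<in> {0..T}" and s: "s \<in> {0..T}" using st by auto
    have iB: "integrable M (\<lambda>\<omega>. indicator B \<omega> * N t \<omega>)"
      using Ni[OF t] BM by (intro integrable_bounded_mult[where c=1]) auto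
    have "(\<integral>\<omega>. indicator B \<omega> * N t \<omega> \<partial>M) = (\<integral>\<omega>. indicator B \<omega> * real_cond_exp M (F s) (N t) \<omega> \<partial>M)"
      by (rule real_cond_exp_intg(2)[symmetric, OF iB]) (use B Nm[OF t] in simp_all)
    also have "\<dots> = (\<integral>\<omega>. indicator B \<omega> * N s \<omega> \<partial>M)"
    proof (rule integral_cong_AE)
      show "AE \<omega> in M. indicator B \<omega> * real_cond_exp M (F s) (N t) \<omega> = indicator B \<omega> * N s \<omega>"
        using Nc[OF st] by eventually_elim simp
    qed (use BM Nm[OF s] in simp_all)
    finally show ?thesis .
  qed
  show "(\<integral>\<^sup>+\<omega>. ennreal ((N t \<omega>)\<^sup>2) \<partial>M) \<le> ennreal (\<integral>\<omega>. (N T \<omega>)\<^sup>2 \<partial>M)" if t: "t \<in> {0..T}" for t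
  proof -
    interpret sigma_finite_subalgebra M "F t" using sigma_finite_subalgebra_F t by simp
    have i: "integrable M (\<lambda>\<omega>. N t \<omega> * N T \<omega>)"
      by (intro integrable_mult_of_squares Nm N2 t T_in)
    have "(\<integral>\<omega>. N t \<omega> * N T \<omega> \<partial>M) = (\<integral>\<omega>. N t \<omega> * real_cond_exp M (F t) (N T) \<omega> \<partial>M)"
      by (rule real_cond_exp_intg(2)[symmetric, OF i NF[OF t] Nm[OF T_in]])
    also have "\<dots> = (\<integral>\<omega>. (N t \<omega>)\<^sup>2 \<partial>M)"
    proof (rule integral_cong_AE)
      show "AE \<omega> in M. N t \<omega> * real_cond_exp M (F t) (N T) \<omega> = (N t \<omega>)\<^sup>2"
        using Nc[of t T] t by (auto elim!: eventually_mono simp: power2_eq_square)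
    qed (use Nm[OF t] in simp_all)
    finally have 1: "(\<integral>\<omega>. (N t \<omega>)\<^sup>2 \<partial>M) = (\<integral>\<omega>. N t \<omega> * N T \<omega> \<partial>M)" by simp
    have "(\<integral>\<omega>. 2 * (N t \<omega> * N T \<omega>) \<partial>M) \<le> (\<integral>\<omega>. (N t \<omega>)\<^sup>2 + (N T \<omega>)\<^sup>2 \<partial>M)"
    proof (rule integral_mono)
      show "2 * (N t \<omega> * N T \<omega>) \<le> (N t \<omega>)\<^sup>2 + (N T \<omega>)\<^sup>2" for \<omega>
        using sum_squares_bound[of "N t \<omega>" "N T \<omega>"] by (simp add: mult.assoc)
    qed (use i N2[OF t] N2[OF T_in] in simp_all)
    then have "(\<integral>\<omega>. (N t \<omega>)\<^sup>2 \<partial>M) \<le> (\<integral>\<omega>. (N T \<omega>)\<^sup>2 \<partial>M)"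
      using i N2[OF t] N2[OF T_in] 1 by simp
    moreover have "(\<integral>\<^sup>+\<omega>. ennreal ((N t \<omega>)\<^sup>2) \<partial>M) = ennreal (\<integral>\<omega>. (N t \<omega>)\<^sup>2 \<partial>M)"
      by (rule nn_integral_eq_integral[OF N2[OF t]]) simp
    ultimately show ?thesis by (simp add: ennreal_leI)
  qed
qed

text \<open>The second moments of \<open>L\<close> are bounded by the mean of the bracket at T,
  those of \<open>A\<close> by the mean squared total variation, as \<open>A\<close> starts at 0.
  \<open>L\<close> is replaced by a version, while \<open>A\<close> keeps its paths because the
  feedback formula integrates against them.\<close>

lemma H2_L2_process:
  assumes H: "H2_semimartingale M F T P L A"
  obtains L' where "L2_process L'" "martingale_increments L'" "L2_process A"
    "AE \<omega> in M. \<forall>t\<in>{0..T}. L' t \<omega> + A t \<omega> = P t \<omega>"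
    "AE \<omega> in M. total_variation (\<lambda>t. A t \<omega>) 0 T < \<infinity> \<and> (\<forall>s\<in>{0..<T}. ((\<lambda>t. A t \<omega>) \<longlongrightarrow> A s \<omega>) (at_right s))"
proof -
  have PLA: "AE \<omega> in M. \<forall>t\<in>{0..T}. P t \<omega> = L t \<omega> + A t \<omega>" and L: "local_martingale M F T L" and Ap: "predictable M F T A"
    and A: "AE \<omega> in M. A 0 \<omega> = 0 \<and> cadlag_on T (\<lambda>t. A t \<omega>) \<and> total_variation (\<lambda>t. A t \<omega>) 0 T < \<infinity>"
    and ATV: "(\<integral>\<^sup>+\<omega>. (total_variation (\<lambda>t. A t \<omega>) 0 T)\<^sup>2 \<partial>M) < \<infinity>"
    using H by (auto simp: H2_semimartingale_def)
  obtain Q where Q: "is_predictable_quadratic_variation M F T L Q" and fin: "(\<integral>\<^sup>+\<omega>. ennreal (Q T \<omega>) \<partial>M) < \<infinity>"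
    using H by (auto simp: H2_semimartingale_def)
  have Lm: "L t \<in> borel_measurable M" if "t \<in> {0..T}" for t
    using L that by (intro measurable_from_F[of t]) (auto simp: local_martingale_def adapted_def)
  have Lc: "AE \<omega> in M. cadlag_on T (\<lambda>t. L t \<omega>)" using L by (simp add: local_martingale_def)
  have Lb: "(\<integral>\<^sup>+\<omega>. ennreal ((L t \<omega>)\<^sup>2) \<partial>M) \<le> ennreal (enn2real (\<integral>\<^sup>+\<omega>. ennreal (Q T \<omega>) \<partial>M))" if "t \<in> {0..T}" for t
    using local_martingale_second_moment[OF L Q stopping_time_const _ fin, of t] that fin by simp
  obtain L' where L': "L2_process L'" "AE \<omega> in M. \<forall>t\<in>{0..T}. L' t \<omega> = L t \<omega>"
    using L2_process_version[OF Lm Lc Lb] by blast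
  have inc: "martingale_increments L'"
    by (rule martingale_increments_version[OF Lm L' local_martingale_L2_imp_martingale[OF L Q fin]])
  have A2: "L2_process A"
  proof (rule L2_processI)
    have "tr A = (\<lambda>(\<omega>, t). if t \<in> {0..T} then A t \<omega> else 0)" by (auto simp: tr_def indicator_def fun_eq_iff)
    then show "tr A \<in> borel_measurable (M \<Otimes>\<^sub>M lborel)" using predictable_measurable_version[OF Ap] by simp
    fix t assume t: "t \<in> {0..T}"
    have "(\<integral>\<^sup>+\<omega>. ennreal ((A t \<omega>)\<^sup>2) \<partial>M) \<le> (\<integral>\<^sup>+\<omega>. (total_variation (\<lambda>t. A t \<omega>) 0 T)\<^sup>2 \<partial>M)"
    proof (rule nn_integral_mono_AE)
      show "AE \<omega> in M. ennreal ((A t \<omega>)\<^sup>2) \<le> (total_variation (\<lambda>t. A t \<omega>) 0 T)\<^sup>2"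
        using A
      proof eventually_elim
        case (elim \<omega>)
        have "ennreal \<bar>A t \<omega>\<bar> \<le> total_variation (\<lambda>t. A t \<omega>) 0 T"
          using total_variation_ge_abs[of 0 0 t T "\<lambda>t. A t \<omega>"] t elim by simp
        then have "(ennreal \<bar>A t \<omega>\<bar>)\<^sup>2 \<le> (total_variation (\<lambda>t. A t \<omega>) 0 T)\<^sup>2" by (intro power_mono) auto
        then show ?case by (simp add: ennreal_power)
      qed
    qed
    then show "(\<integral>\<^sup>+\<omega>. ennreal ((A t \<omega>)\<^sup>2) \<partial>M) \<le> ennreal (enn2real (\<integral>\<^sup>+\<omega>. (total_variation (\<lambda>t. A t \<omega>) 0 T)\<^sup>2 \<partial>M))"
      using ATV by simp
  qed
  show ?thesis
  proof (rule that[OF L'(1) inc A2])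
    show "AE \<omega> in M. \<forall>t\<in>{0..T}. L' t \<omega> + A t \<omega> = P t \<omega>" using L'(2) PLA by eventually_elim auto
    show "AE \<omega> in M. total_variation (\<lambda>t. A t \<omega>) 0 T < \<infinity> \<and> (\<forall>s\<in>{0..<T}. ((\<lambda>t. A t \<omega>) \<longlongrightarrow> A s \<omega>) (at_right s))"
      using A by eventually_elim (auto simp: cadlag_on_def)
  qed
qed

subsection \<open>The payoff as a concave quadratic functional\<close>

text \<open>The signal \<open>S\<close> and the terminal price \<open>p\<close> are free parameters,
  so that the problems for \<nu> and for a competing mean field differ in \<open>S\<close>
  alone.\<close>

definition payoff :: "(real \<Rightarrow> 'a \<Rightarrow> real) \<Rightarrow> ('a \<Rightarrow> real) \<Rightarrow> real \<Rightarrow> real \<Rightarrow> real \<Rightarrow> real \<Rightarrow> (real \<Rightarrow> 'a \<Rightarrow> real) \<Rightarrow> real" where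
  "payoff S p lam \<phi> varrho x v =
    ip S v - lam * ip v v - \<phi> * ip (inventory x v) (inventory x v)
    + (\<integral>\<omega>. inventory x v T \<omega> * (p \<omega> - varrho * inventory x v T \<omega>) \<partial>M)"

text \<open>A deviation h lowers the inventory by \<open>cum h\<close>, which accounts for the signs
  of the inventory terms.\<close>

definition payoff_gradient :: "(real \<Rightarrow> 'a \<Rightarrow> real) \<Rightarrow> ('a \<Rightarrow> real) \<Rightarrow> real \<Rightarrow> real \<Rightarrow> real \<Rightarrow> real \<Rightarrow> (real \<Rightarrow> 'a \<Rightarrow> real) \<Rightarrow> (real \<Rightarrow> 'a \<Rightarrow> real) \<Rightarrow> real" where
  "payoff_gradient S p lam \<phi> varrho x v h =
    ip S h - 2 * lam * ip v h + 2 * \<phi> * ip (inventory x v) (cum h)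
    - (\<integral>\<omega>. cum h T \<omega> * (p \<omega> - 2 * varrho * inventory x v T \<omega>) \<partial>M)"

definition payoff_curvature :: "real \<Rightarrow> real \<Rightarrow> real \<Rightarrow> (real \<Rightarrow> 'a \<Rightarrow> real) \<Rightarrow> real" where
  "payoff_curvature lam \<phi> varrho h = lam * ip h h + \<phi> * ip (cum h) (cum h) + varrho * (\<integral>\<omega>. (cum h T \<omega>)\<^sup>2 \<partial>M)"

text \<open>The integrand along \<open>P\<close> agrees almost surely with the one along the version
  \<open>P'\<close>, and completeness makes it measurable, so its Bochner integral is a genuine
  one.\<close>

lemma objective_eq_payoff:
  assumes w: "sqint w" and \<nu>: "sqint \<nu>" and P': "sqint P'" and PT: "P' T \<in> borel_measurable M" "integrable M (\<lambda>\<omega>. (P' T \<omega>)\<^sup>2)"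
    and PP: "AE \<omega> in M. \<forall>t\<in>{0..T}. P' t \<omega> = P t \<omega>"
  shows "objective M T \<kappa> \<gamma> \<rho> lam \<phi> varrho y P x w \<nu> =
    payoff (\<lambda>t \<omega>. P' t \<omega> - \<kappa> * transient_impact \<gamma> \<rho> y \<nu> t \<omega>) (P' T) lam \<phi> varrho x w"
proof -
  define S where "S t \<omega> = P' t \<omega> - \<kappa> * transient_impact \<gamma> \<rho> y \<nu> t \<omega>" for t \<omega>
  define X where "X = inventory x w"
  have S: "sqint S" unfolding S_def[abs_def] by (intro sqint_diff sqint_cmult sqint_transient_impact P' \<nu>)
  have X: "sqint X" unfolding X_def by (rule sqint_inventory[OF w])
  note XT = inventory_rv[OF w T_in, of x, folded X_def]
  define g where "g \<omega> = (LBINT t:{0..T}. S t \<omega> * w t \<omega>) - lam * (LBINT t:{0..T}. w t \<omega> * w t \<omega>)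
        - \<phi> * (LBINT t:{0..T}. X t \<omega> * X t \<omega>) + X T \<omega> * (P' T \<omega> - varrho * X T \<omega>)" for \<omega>
  define f where "f \<omega> = (LBINT t:{0..T}. (P t \<omega> - \<kappa> * transient_impact \<gamma> \<rho> y \<nu> t \<omega>) * w t \<omega>)
        - lam * (LBINT t:{0..T}. (w t \<omega>)\<^sup>2)
        - \<phi> * (LBINT t:{0..T}. (X t \<omega>)\<^sup>2)
        + X T \<omega> * (P T \<omega> - varrho * X T \<omega>)" for \<omega>
  have i: "integrable M (\<lambda>\<omega>. X T \<omega> * (P' T \<omega> - varrho * X T \<omega>))"
    using integrable_mult_of_squares[OF XT PT] integrable_mult_of_squares[OF XT XT]
    by (simp add: right_diff_distrib mult.left_commute[of "X T _" varrho])
  have gi: "integrable M g" unfolding g_def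
    by (intro Bochner_Integration.integrable_add Bochner_Integration.integrable_diff integrable_mult_right ip_eq(2) S X w i)
  have "AE \<omega> in M. g \<omega> = f \<omega>" using PP
  proof eventually_elim
    case (elim \<omega>)
    have "(LBINT t:{0..T}. S t \<omega> * w t \<omega>) = (LBINT t:{0..T}. (P t \<omega> - \<kappa> * transient_impact \<gamma> \<rho> y \<nu> t \<omega>) * w t \<omega>)"
      using elim by (intro set_lebesgue_integral_cong) (auto simp: S_def)
    moreover have "P' T \<omega> = P T \<omega>" using elim T_in by blast
    ultimately show ?case by (simp add: g_def f_def power2_eq_square)
  qed
  then have "(\<integral>\<omega>. f \<omega> \<partial>M) = (\<integral>\<omega>. g \<omega> \<partial>M)"
    using borel_measurable_AE_eq[of g f] gi by (intro integral_cong_AE) auto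
  also have "\<dots> = payoff S (P' T) lam \<phi> varrho x w"
    unfolding payoff_def ip_eq(1)[OF S w] ip_eq(1)[OF w w] X_def[symmetric] ip_eq(1)[OF X X] g_def
    using ip_eq(2)[OF S w] ip_eq(2)[OF w w] ip_eq(2)[OF X X] i by simp
  finally show ?thesis by (simp add: objective_def f_def[abs_def] X_def S_def[abs_def] Let_def)
qed

text \<open>A quadratic functional has no remainder term. Inventories are affine in the control only
  almost surely, namely where the controls are integrable in time, hence the detour through
  \<open>X'\<close>.\<close>

lemma payoff_expand:
  assumes v: "sqint v" and h: "sqint h" and S: "sqint S" and p: "p \<in> borel_measurable M" "integrable M (\<lambda>\<omega>. (p \<omega>)\<^sup>2)"
  shows "payoff S p lam \<phi> varrho x (\<lambda>t \<omega>. v t \<omega> + e * h t \<omega>) =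
    payoff S p lam \<phi> varrho x v + e * payoff_gradient S p lam \<phi> varrho x v h - e\<^sup>2 * payoff_curvature lam \<phi> varrho h"
proof -
  define w where "w t \<omega> = v t \<omega> + e * h t \<omega>" for t \<omega>
  define X where "X = inventory x v"
  define H where "H = cum h"
  define X' where "X' t \<omega> = X t \<omega> - e * H t \<omega>" for t \<omega>
  note eh = sqint_cmult[OF h, of e]
  have w: "sqint w" unfolding w_def[abs_def] by (intro sqint_add v eh)
  have X: "sqint X" unfolding X_def by (rule sqint_inventory[OF v])
  have H: "sqint H" unfolding H_def by (rule sqint_cum[OF h])
  note eH = sqint_cmult[OF H, of e]
  have X': "sqint X'" unfolding X'_def[abs_def] by (intro sqint_diff X eH)
  have inv: "AE \<omega> in M. \<forall>t\<in>{0..T}. inventory x w t \<omega> = X' t \<omega>"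
    using cum_add[OF v eh] by eventually_elim (auto simp: w_def[abs_def] inventory_eq X'_def X_def H_def cum_cmult)
  have tr: "AE z in M \<Otimes>\<^sub>M lborel. tr (inventory x w) z = tr X' z" by (rule tr_eqI[OF inv])
  have xx: "ip (inventory x w) (inventory x w) = ip X' X'"
    using ip_cong[OF tr sqint_inventory[OF w] X' sqint_inventory[OF w]] ip_cong[OF tr sqint_inventory[OF w] X' X']
    by (simp add: ip_commute)
  have xx': "ip X' X' = ip X X - 2 * e * ip X H + e\<^sup>2 * ip H H"
    unfolding X'_def[abs_def] using X H eH
    by (simp add: ip_diff_left ip_diff_right sqint_diff ip_cmult_left ip_cmult_right ip_commute[of H X] power2_eq_square algebra_simps)
  have ww: "ip w w = ip v v + 2 * e * ip v h + e\<^sup>2 * ip h h"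
    unfolding w_def[abs_def] using v h eh
    by (simp add: ip_add_left ip_add_right sqint_add ip_cmult_left ip_cmult_right ip_commute[of h v] power2_eq_square algebra_simps)
  have sw: "ip S w = ip S v + e * ip S h"
    unfolding w_def[abs_def] using S v eh by (simp add: ip_add_right ip_cmult_right)
  note XT = inventory_rv[OF v T_in, of x, folded X_def]
  note HT = cum_rv[OF h T_in, folded H_def]
  note i = integrable_mult_of_squares[OF XT p] integrable_mult_of_squares[OF HT p] integrable_mult_of_squares[OF XT XT]
    integrable_mult_of_squares[OF XT HT] integrable_mult_of_squares[OF HT HT]
  have a: "(\<integral>\<omega>. inventory x w T \<omega> * (p \<omega> - varrho * inventory x w T \<omega>) \<partial>M) = (\<integral>\<omega>. X' T \<omega> * (p \<omega> - varrho * X' T \<omega>) \<partial>M)"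
  proof (rule integral_cong_AE)
    show "AE \<omega> in M. inventory x w T \<omega> * (p \<omega> - varrho * inventory x w T \<omega>) = X' T \<omega> * (p \<omega> - varrho * X' T \<omega>)"
      using inv by eventually_elim (use T_in in auto)
  qed (use p(1) inventory_rv(1)[OF w T_in, of x] XT HT in \<open>auto simp: X'_def\<close>)
  have b: "X' T \<omega> * (p \<omega> - varrho * X' T \<omega>) = (X T \<omega> * p \<omega> - varrho * (X T \<omega> * X T \<omega>))
      - e * (H T \<omega> * p \<omega> - 2 * varrho * (X T \<omega> * H T \<omega>)) - e\<^sup>2 * varrho * (H T \<omega> * H T \<omega>)" for \<omega>
    by (simp add: X'_def power2_eq_square algebra_simps)
  have c: "(\<integral>\<omega>. X' T \<omega> * (p \<omega> - varrho * X' T \<omega>) \<partial>M) = ((\<integral>\<omega>. X T \<omega> * p \<omega> \<partial>M) - varrho * (\<integral>\<omega>. X T \<omega> * X T \<omega> \<partial>M))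
      - e * ((\<integral>\<omega>. H T \<omega> * p \<omega> \<partial>M) - 2 * varrho * (\<integral>\<omega>. X T \<omega> * H T \<omega> \<partial>M)) - e\<^sup>2 * varrho * (\<integral>\<omega>. H T \<omega> * H T \<omega> \<partial>M)"
    unfolding b using i by simp
  have b1: "X T \<omega> * (p \<omega> - varrho * X T \<omega>) = X T \<omega> * p \<omega> - varrho * (X T \<omega> * X T \<omega>)"
    "H T \<omega> * (p \<omega> - 2 * varrho * X T \<omega>) = H T \<omega> * p \<omega> - 2 * varrho * (X T \<omega> * H T \<omega>)"
    for \<omega>
    by (simp_all add: algebra_simps)
  have c1: "(\<integral>\<omega>. X T \<omega> * (p \<omega> - varrho * X T \<omega>) \<partial>M) = (\<integral>\<omega>. X T \<omega> * p \<omega> \<partial>M) - varrho * (\<integral>\<omega>. X T \<omega> * X T \<omega> \<partial>M)"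
    "(\<integral>\<omega>. H T \<omega> * (p \<omega> - 2 * varrho * X T \<omega>) \<partial>M) = (\<integral>\<omega>. H T \<omega> * p \<omega> \<partial>M) - 2 * varrho * (\<integral>\<omega>. X T \<omega> * H T \<omega> \<partial>M)"
    unfolding b1 using i by simp_all
  have qH: "(\<integral>\<omega>. (H T \<omega>)\<^sup>2 \<partial>M) = (\<integral>\<omega>. H T \<omega> * H T \<omega> \<partial>M)" by (simp add: power2_eq_square)
  show ?thesis
    unfolding w_def[symmetric, abs_def] payoff_def payoff_gradient_def payoff_curvature_def X_def[symmetric] H_def[symmetric]
      xx xx' ww sw a c c1 qH
    by (simp add: algebra_simps)
qed

lemma payoff_curvature_nonneg:
  assumes "0 < lam" "0 < \<phi>" "0 < varrho"
  shows "lam * ip h h \<le> payoff_curvature lam \<phi> varrho h"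
  using assms ip_nonneg[of "cum h"] by (simp add: payoff_curvature_def)

lemma payoff_maximum_iff:
  assumes v: "v \<in> admissible M F T" and S: "sqint S" and p: "p \<in> borel_measurable M" "integrable M (\<lambda>\<omega>. (p \<omega>)\<^sup>2)"
    and pos: "0 < lam" "0 < \<phi>" "0 < varrho"
  shows "(\<forall>w\<in>admissible M F T. payoff S p lam \<phi> varrho x w \<le> payoff S p lam \<phi> varrho x v) \<longleftrightarrow>
    (\<forall>h\<in>admissible M F T. payoff_gradient S p lam \<phi> varrho x v h = 0)"
proof safe
  fix h assume max: "\<forall>w\<in>admissible M F T. payoff S p lam \<phi> varrho x w \<le> payoff S p lam \<phi> varrho x v"
    and h: "h \<in> admissible M F T"
  have "e * payoff_gradient S p lam \<phi> varrho x v h - e\<^sup>2 * payoff_curvature lam \<phi> varrho h \<le> 0" for e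
    using max[rule_format, OF admissible_combine[OF v h, of e]] v h payoff_expand[OF _ _ S p, of v h lam \<phi> varrho x e]
    by (simp add: admissible_iff)
  then show "payoff_gradient S p lam \<phi> varrho x v h = 0" by (rule quadratic_nonpos_imp_zero)
next
  fix w assume g: "\<forall>h\<in>admissible M F T. payoff_gradient S p lam \<phi> varrho x v h = 0" and w: "w \<in> admissible M F T"
  define h where "h t \<omega> = w t \<omega> + (-1) * v t \<omega>" for t \<omega>
  have h: "h \<in> admissible M F T" unfolding h_def[abs_def] by (rule admissible_combine[OF w v])
  have wh: "w = (\<lambda>t \<omega>. v t \<omega> + 1 * h t \<omega>)" by (simp add: h_def fun_eq_iff)
  have "payoff S p lam \<phi> varrho x (\<lambda>t \<omega>. v t \<omega> + 1 * h t \<omega>) = payoff S p lam \<phi> varrho x v - payoff_curvature lam \<phi> varrho h"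
    using payoff_expand[OF _ _ S p, of v h lam \<phi> varrho x 1] g h v by (simp add: admissible_iff)
  moreover have "0 \<le> payoff_curvature lam \<phi> varrho h"
    using payoff_curvature_nonneg[OF pos, of h] pos ip_nonneg[of h] by (meson mult_nonneg_nonneg less_imp_le order_trans)
  ultimately show "payoff S p lam \<phi> varrho x w \<le> payoff S p lam \<phi> varrho x v"
    unfolding wh[symmetric] by simp
qed

text \<open>Subtraction eliminates the initial position and the terminal price; what remains is
  linear in the change of control and in the change of signal.\<close>

lemma payoff_gradient_diff:
  assumes v: "sqint v" and w: "sqint w" and h: "sqint h" and S: "sqint S" and S': "sqint S'"
    and p: "p \<in> borel_measurable M" "integrable M (\<lambda>\<omega>. (p \<omega>)\<^sup>2)"
  shows "payoff_gradient S' p lam \<phi> varrho x w h - payoff_gradient S p lam \<phi> varrho x v h =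
    ip (\<lambda>t \<omega>. S' t \<omega> - S t \<omega>) h - 2 * lam * ip (\<lambda>t \<omega>. w t \<omega> - v t \<omega>) h
    - 2 * \<phi> * ip (cum (\<lambda>t \<omega>. w t \<omega> - v t \<omega>)) (cum h)
    - 2 * varrho * (\<integral>\<omega>. cum (\<lambda>t \<omega>. w t \<omega> - v t \<omega>) T \<omega> * cum h T \<omega> \<partial>M)"
proof -
  define d where "d t \<omega> = w t \<omega> - v t \<omega>" for t \<omega>
  have d: "sqint d" unfolding d_def[abs_def] by (rule sqint_diff[OF w v])
  have D: "AE \<omega> in M. \<forall>t\<in>{0..T}. inventory x w t \<omega> = inventory x v t \<omega> - cum d t \<omega>"
    using cum_add[OF v d] by eventually_elim (auto simp: d_def[abs_def] inventory_eq)
  have sD: "sqint (\<lambda>t \<omega>. inventory x v t \<omega> - cum d t \<omega>)"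
    by (intro sqint_diff sqint_inventory sqint_cum v d)
  have 1: "ip (inventory x w) (cum h) = ip (inventory x v) (cum h) - ip (cum d) (cum h)"
    using ip_cong[OF tr_eqI[OF D] sqint_inventory[OF w] sD sqint_cum[OF h]]
      ip_diff_left[OF sqint_inventory[OF v] sqint_cum[OF d] sqint_cum[OF h]] by simp
  note XT = inventory_rv[OF v T_in, of x] and XW = inventory_rv[OF w T_in, of x]
  note HT = cum_rv[OF h T_in] and DT = cum_rv[OF d T_in]
  have 2: "(\<integral>\<omega>. cum h T \<omega> * (p \<omega> - 2 * varrho * inventory x w T \<omega>) \<partial>M)
     = (\<integral>\<omega>. cum h T \<omega> * (p \<omega> - 2 * varrho * inventory x v T \<omega>) + 2 * varrho * (cum d T \<omega> * cum h T \<omega>) \<partial>M)"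
  proof (rule integral_cong_AE)
    show "AE \<omega> in M. cum h T \<omega> * (p \<omega> - 2 * varrho * inventory x w T \<omega>) = cum h T \<omega> * (p \<omega> - 2 * varrho * inventory x v T \<omega>) + 2 * varrho * (cum d T \<omega> * cum h T \<omega>)"
      using D
    proof eventually_elim
      case (elim \<omega>)
      then have e: "inventory x w T \<omega> = inventory x v T \<omega> - cum d T \<omega>" using T_in by blast
      show ?case unfolding e by (simp add: algebra_simps)
    qed
  qed (use p XT XW HT DT in auto)
  have 3: "integrable M (\<lambda>\<omega>. cum h T \<omega> * (p \<omega> - 2 * varrho * inventory x v T \<omega>))"
    using integrable_mult_of_squares[OF HT p] integrable_mult_of_squares[OF HT XT]
    by (simp add: right_diff_distrib mult.left_commute[of "cum h T _"])
  have 4: "(\<integral>\<omega>. cum h T \<omega> * (p \<omega> - 2 * varrho * inventory x w T \<omega>) \<partial>M)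
     = (\<integral>\<omega>. cum h T \<omega> * (p \<omega> - 2 * varrho * inventory x v T \<omega>) \<partial>M) + 2 * varrho * (\<integral>\<omega>. cum d T \<omega> * cum h T \<omega> \<partial>M)"
    unfolding 2 using 3 integrable_mult_of_squares[OF DT HT] by simp
  have 5: "ip d h = ip w h - ip v h" unfolding d_def[abs_def] by (rule ip_diff_left[OF w v h])
  show ?thesis
    unfolding payoff_gradient_def 1 4 d_def[symmetric, abs_def] ip_diff_left[OF S' S h] 5
    by (simp add: algebra_simps)
qed

text \<open>Converse of \<open>AE_pairD\<close>; it rests on the measurability of the set where the
  two cut-off processes agree.\<close>

lemma sqint_AE_pairI:
  assumes "sqint u" "sqint v" "AE \<omega> in M. AE t in lborel. tr u (\<omega>, t) = tr v (\<omega>, t)"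
  shows "AE x in M \<Otimes>\<^sub>M lborel. tr u x = tr v x"
proof (rule Pr.AE_pair_measure)
  note [measurable] = assms(1,2)[THEN sqint_measurable]
  show "{x \<in> space (M \<Otimes>\<^sub>M lborel). tr u x = tr v x} \<in> sets (M \<Otimes>\<^sub>M lborel)" by measurable
qed (use assms(3) in auto)

text \<open>Equilibria are described with Lebesgue measure restricted to [0,T], the Hilbert space
  arguments with the cut-off \<open>tr\<close> on the whole line; this lemma and
  \<open>AE_restrict_pairI\<close> translate.\<close>

lemma AE_restrict_pairD:
  assumes "AE x in M \<Otimes>\<^sub>M restrict_space lborel {0..T}. Q x"
  shows "AE \<omega> in M. AE t in lborel. t \<in> {0..T} \<longrightarrow> Q (\<omega>, t)"
proof -
  interpret rs: sigma_finite_measure "restrict_space (lborel :: real measure) {0..T}"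
    by (rule sigma_finite_measure_restrict_space) (auto intro: lborel.sigma_finite_measure_axioms)
  interpret P': pair_sigma_finite M "restrict_space (lborel :: real measure) {0..T}" ..
  show ?thesis using P'.AE_pair[OF assms] by (simp add: AE_restrict_space_iff)
qed

lemma AE_restrict_pairI:
  assumes u: "sqint u" and v: "sqint v" and ae: "AE x in M \<Otimes>\<^sub>M lborel. tr u x = tr v x"
  shows "AE (\<omega>, t) in M \<Otimes>\<^sub>M restrict_space lborel {0..T}. u t \<omega> = v t \<omega>"
proof -
  interpret rs: sigma_finite_measure "restrict_space (lborel :: real measure) {0..T}"
    by (rule sigma_finite_measure_restrict_space) (auto intro: lborel.sigma_finite_measure_axioms)
  interpret P': pair_sigma_finite M "restrict_space (lborel :: real measure) {0..T}" ..
  have id: "(\<lambda>x. (fst x, snd x)) \<in> measurable (M \<Otimes>\<^sub>M restrict_space lborel {0..T}) (M \<Otimes>\<^sub>M lborel)"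
  proof (rule measurable_Pair)
    have "(\<lambda>x. x) \<in> measurable (restrict_space lborel {0..T}) (lborel :: real measure)"
      by (rule measurable_restrict_space1) simp
    from measurable_compose[OF measurable_snd this]
    show "snd \<in> measurable (M \<Otimes>\<^sub>M restrict_space lborel {0..T}) lborel" by simp
  qed simp
  have [measurable]: "tr u \<in> borel_measurable (M \<Otimes>\<^sub>M restrict_space lborel {0..T})" "tr v \<in> borel_measurable (M \<Otimes>\<^sub>M restrict_space lborel {0..T})"
    using measurable_compose[OF id sqint_measurable[OF u]] measurable_compose[OF id sqint_measurable[OF v]] by simp_all
  have "AE x in M \<Otimes>\<^sub>M restrict_space lborel {0..T}. tr u x = tr v x"
  proof (rule P'.AE_pair_measure)
    show "{x \<in> space (M \<Otimes>\<^sub>M restrict_space lborel {0..T}). tr u x = tr v x} \<in> sets (M \<Otimes>\<^sub>M restrict_space lborel {0..T})" by measurable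
    show "AE \<omega> in M. AE t in restrict_space lborel {0..T}. tr u (\<omega>, t) = tr v (\<omega>, t)"
      using AE_pairD[OF ae] by eventually_elim (auto simp: AE_restrict_space_iff elim!: eventually_mono)
  qed
  moreover have "AE x in M \<Otimes>\<^sub>M restrict_space lborel {0..T}. snd x \<in> {0..T}"
    by (rule AE_I2) (auto simp: space_pair_measure space_restrict_space)
  ultimately show ?thesis by eventually_elim (auto simp: tr_def)
qed

text \<open>The bilinear form with \<open>payoff_curvature\<close> on its diagonal; the second
  derivative of the payoff is minus twice this form.\<close>

definition curvature_form :: "real \<Rightarrow> real \<Rightarrow> real \<Rightarrow> (real \<Rightarrow> 'a \<Rightarrow> real) \<Rightarrow> (real \<Rightarrow> 'a \<Rightarrow> real) \<Rightarrow> real" where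
  "curvature_form lam \<phi> varrho d h =
    lam * ip d h + \<phi> * ip (cum d) (cum h) + varrho * (\<integral>\<omega>. cum d T \<omega> * cum h T \<omega> \<partial>M)"

lemma curvature_form_diff:
  assumes d: "sqint d" and e: "sqint e" and h: "sqint h"
  shows "curvature_form lam \<phi> varrho (\<lambda>t \<omega>. d t \<omega> - e t \<omega>) h = curvature_form lam \<phi> varrho d h - curvature_form lam \<phi> varrho e h"
proof -
  define f where "f t \<omega> = d t \<omega> - e t \<omega>" for t \<omega>
  have f: "sqint f" unfolding f_def[abs_def] by (rule sqint_diff[OF d e])
  have c: "AE \<omega> in M. \<forall>t\<in>{0..T}. cum f t \<omega> = cum d t \<omega> - cum e t \<omega>"
    using cum_add[OF e f] by eventually_elim (auto simp: f_def[abs_def])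
  have sdiff: "sqint (\<lambda>t \<omega>. cum d t \<omega> - cum e t \<omega>)" by (intro sqint_diff sqint_cum d e)
  have 1: "ip (cum f) (cum h) = ip (cum d) (cum h) - ip (cum e) (cum h)"
    using ip_cong[OF tr_eqI[OF c] sqint_cum[OF f] sdiff sqint_cum[OF h]]
      ip_diff_left[OF sqint_cum[OF d] sqint_cum[OF e] sqint_cum[OF h]] by simp
  note rv = cum_rv[OF d T_in] and rve = cum_rv[OF e T_in] and rvf = cum_rv[OF f T_in] and rvh = cum_rv[OF h T_in]
  have "(\<integral>\<omega>. cum f T \<omega> * cum h T \<omega> \<partial>M) = (\<integral>\<omega>. cum d T \<omega> * cum h T \<omega> - cum e T \<omega> * cum h T \<omega> \<partial>M)"
  proof (rule integral_cong_AE)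
    show "AE \<omega> in M. cum f T \<omega> * cum h T \<omega> = cum d T \<omega> * cum h T \<omega> - cum e T \<omega> * cum h T \<omega>"
      using c
    proof eventually_elim
      case (elim \<omega>)
      then have "cum f T \<omega> = cum d T \<omega> - cum e T \<omega>" using T_in by blast
      then show ?case by (simp only: left_diff_distrib)
    qed
  qed (use rv rve rvf rvh in auto)
  also have "\<dots> = (\<integral>\<omega>. cum d T \<omega> * cum h T \<omega> \<partial>M) - (\<integral>\<omega>. cum e T \<omega> * cum h T \<omega> \<partial>M)"
    by (intro Bochner_Integration.integral_diff integrable_mult_of_squares rv rve rvh)
  finally have 2: "(\<integral>\<omega>. cum f T \<omega> * cum h T \<omega> \<partial>M) = (\<integral>\<omega>. cum d T \<omega> * cum h T \<omega> \<partial>M) - (\<integral>\<omega>. cum e T \<omega> * cum h T \<omega> \<partial>M)" .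
  have 3: "ip f h = ip d h - ip e h" unfolding f_def[abs_def] by (rule ip_diff_left[OF d e h])
  show ?thesis unfolding f_def[symmetric, abs_def] curvature_form_def 1 2 3 by (simp add: algebra_simps)
qed

lemma curvature_form_nonpos_imp_zero:
  assumes pos: "0 < lam" "0 < \<phi>" "0 < varrho" and d: "sqint d" and le: "curvature_form lam \<phi> varrho d d \<le> 0"
  shows "AE x in M \<Otimes>\<^sub>M lborel. tr d x = 0"
proof (rule ip_zeroD[OF d])
  have "curvature_form lam \<phi> varrho d d = payoff_curvature lam \<phi> varrho d"
    by (simp add: curvature_form_def payoff_curvature_def power2_eq_square)
  then have "lam * ip d d \<le> 0" using payoff_curvature_nonneg[OF pos, of d] le by linarith
  then show "ip d d = 0" using ip_nonneg[of d] pos by (simp add: mult_le_0_iff)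
qed

lemma ip_transient_nonneg:
  assumes d: "sqint d" and \<rho>: "0 < \<rho>"
  shows "0 \<le> ip (\<lambda>t \<omega>. exp (- \<rho> * t) * cum (\<lambda>s \<omega>. exp (\<rho> * s) * d s \<omega>) t \<omega>) d"
proof -
  have s: "sqint (\<lambda>t \<omega>. exp (- \<rho> * t) * cum (\<lambda>s \<omega>. exp (\<rho> * s) * d s \<omega>) t \<omega>)"
    using d by (intro sqint_bounded_mult[of "\<lambda>t. exp (- \<rho> * t)"] sqint_bounded_mult[of "\<lambda>t. exp (\<rho> * t)"] sqint_cum continuous_intros)
  show ?thesis unfolding ip_eq(1)[OF s d]
  proof (rule integral_nonneg_AE)
    show "AE \<omega> in M. 0 \<le> (LBINT t:{0..T}. exp (- \<rho> * t) * cum (\<lambda>s \<omega>. exp (\<rho> * s) * d s \<omega>) t \<omega> * d t \<omega>)"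
      using sqint_set_integrable[OF d]
      by eventually_elim (use exponential_kernel_nonneg[of T \<rho>] T_pos \<rho> in \<open>simp add: cum_def\<close>)
  qed
qed

text \<open>The term with y cancels, and the rest is linear in the flow. The assumption is made
  almost everywhere because mean fields are compared only in that sense.\<close>

lemma transient_impact_diff:
  assumes v: "sqint v" and d: "sqint d" and w: "sqint w" and ae: "AE x in M \<Otimes>\<^sub>M lborel. tr w x = tr v x + tr d x"
  shows "AE \<omega> in M. \<forall>t\<in>{0..T}. transient_impact \<gamma> \<rho> y w t \<omega> - transient_impact \<gamma> \<rho> y v t \<omega>
    = \<gamma> * (exp (- \<rho> * t) * cum (\<lambda>s \<omega>. exp (\<rho> * s) * d s \<omega>) t \<omega>)"
proof -
  have e: "sqint (\<lambda>s \<omega>. exp (\<rho> * s) * f s \<omega>)" if "sqint f" for f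
    using that by (intro sqint_bounded_mult continuous_intros)
  have "AE x in M \<Otimes>\<^sub>M lborel. tr (\<lambda>s \<omega>. exp (\<rho> * s) * w s \<omega>) x = tr (\<lambda>s \<omega>. exp (\<rho> * s) * v s \<omega> + exp (\<rho> * s) * d s \<omega>) x"
    using ae by eventually_elim (auto simp: tr_def indicator_def algebra_simps split: if_splits)
  from cum_cong[OF this e[OF w] sqint_add[OF e[OF v] e[OF d]]] cum_add[OF e[OF v] e[OF d]]
  show ?thesis
  proof eventually_elim
    case (elim \<omega>)
    then show ?case by (auto simp: transient_impact_eq algebra_simps)
  qed
qed

end

subsection \<open>Equilibrium strategies\<close>

text \<open>The system (MF) after clean-up: \<open>P\<close> is split into \<open>L + A\<close>, the
  martingales \<open>L\<close> and \<open>N\<close> are L2 versions known through their integrated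
  martingale property, and inventory and impact are the explicit functionals of \<nu>.\<close>

locale fbsde_core = usual_filtered_prob_space M F T
  for M :: "'a measure" and F T +
  fixes \<kappa> \<gamma> \<rho> lam \<phi> varrho y xbar :: real
    and \<nu> L A N :: "real \<Rightarrow> 'a \<Rightarrow> real"
  assumes pos: "0 < \<kappa>" "0 < \<gamma>" "0 < \<rho>" "0 < lam" "0 < \<phi>" "0 < varrho"
    and nu: "\<nu> \<in> admissible M F T"
    and L2: "L2_process L" "L2_process A" "L2_process N"
    and incr: "martingale_increments L" "martingale_increments N"
    and impact_dynamics: "AE \<omega> in M. \<forall>t\<in>{0..T}. transient_impact \<gamma> \<rho> y \<nu> t \<omega> =
      y + (LBINT s:{0..t}. - \<rho> * transient_impact \<gamma> \<rho> y \<nu> s \<omega> + \<gamma> * \<nu> s \<omega>)"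
    and dynamics: "AE \<omega> in M. \<forall>t\<in>{0..T}. \<nu> t \<omega> = \<nu> 0 \<omega> + (L t \<omega> + A t \<omega> - (L 0 \<omega> + A 0 \<omega>)) / (2 * lam)
      + (LBINT s:{0..t}. \<kappa> * \<rho> / (2 * lam) * transient_impact \<gamma> \<rho> y \<nu> s \<omega> - \<kappa> * \<gamma> / (2 * lam) * \<nu> s \<omega>
          - \<phi> / lam * inventory xbar \<nu> s \<omega>)
      + (N t \<omega> - N 0 \<omega>)"
    and terminal: "AE \<omega> in M. \<nu> T \<omega> = varrho / lam * inventory xbar \<nu> T \<omega> - \<kappa> / (2 * lam) * transient_impact \<gamma> \<rho> y \<nu> T \<omega>"
begin

interpretation Pr: pair_sigma_finite M lborel ..

abbreviation "R \<equiv> R_fun lam \<phi> varrho"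
abbreviation "dR \<equiv> dR_fun lam \<phi> varrho"
abbreviation "X \<equiv> inventory xbar \<nu>"
abbreviation "Y \<equiv> transient_impact \<gamma> \<rho> y \<nu>"

definition S where "S t \<omega> = L t \<omega> + A t \<omega> - \<kappa> * Y t \<omega>"
definition PT where "PT \<omega> = L T \<omega> + A T \<omega>"

section \<open>Optimality of \<nu> and of the shifted strategies\<close>

lemma sq_nu: "sqint \<nu>" using nu by (simp add: admissible_iff)

lemmas L2_X = L2_process_inventory[OF sq_nu, of xbar] and L2_Y = L2_process_transient_impact[OF sq_nu, of \<gamma> \<rho> y]

lemma sq_S: "sqint S"
  unfolding S_def[abs_def] by (intro sqint_diff sqint_add sqint_cmult L2_processD(1) L2 L2_Y)

lemma PT_rv: "PT \<in> borel_measurable M" "integrable M (\<lambda>\<omega>. (PT \<omega>)\<^sup>2)"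
proof -
  note l = L2_processD(2,3)[OF L2(1) T_in] and a = L2_processD(2,3)[OF L2(2) T_in]
  show "PT \<in> borel_measurable M" unfolding PT_def[abs_def] using l a by simp
  show "integrable M (\<lambda>\<omega>. (PT \<omega>)\<^sup>2)" unfolding PT_def power2_sum
    using integrable_mult_of_squares[OF l a] l a by (simp add: mult.assoc)
qed

text \<open>The terms with \<kappa> in the drift of \<nu> are \<open>- \<kappa> / (2 * lam)\<close>
  times the drift of \<open>Y\<close>; they integrate to \<open>Y t - y\<close>, and \<rho> and
  \<gamma> disappear.\<close>

lemma dynamics_integrated:
  "AE \<omega> in M. \<forall>t\<in>{0..T}. \<nu> t \<omega> = \<nu> 0 \<omega> + (L t \<omega> + A t \<omega> - (L 0 \<omega> + A 0 \<omega>)) / (2 * lam)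
      - \<kappa> / (2 * lam) * (Y t \<omega> - y) - \<phi> / lam * cum X t \<omega> + (N t \<omega> - N 0 \<omega>)"
  using dynamics impact_dynamics sqint_set_integrable[OF sq_nu] sqint_set_integrable[OF L2_processD(1)[OF L2_X]]
    sqint_set_integrable[OF L2_processD(1)[OF L2_Y]]
proof eventually_elim
  case (elim \<omega>)
  show ?case
  proof
    fix t assume t: "t \<in> {0..T}"
    have i: "set_integrable lborel {0..t} (\<lambda>s. \<nu> s \<omega>)" "set_integrable lborel {0..t} (\<lambda>s. X s \<omega>)" "set_integrable lborel {0..t} (\<lambda>s. Y s \<omega>)"
      using t by (auto intro: set_integrable_subset[OF elim(3)] set_integrable_subset[OF elim(4)] set_integrable_subset[OF elim(5)])
    have "(LBINT s:{0..t}. \<kappa> * \<rho> / (2 * lam) * Y s \<omega> - \<kappa> * \<gamma> / (2 * lam) * \<nu> s \<omega> - \<phi> / lam * X s \<omega>)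
      = (LBINT s:{0..t}. - \<kappa> / (2 * lam) * (- \<rho> * Y s \<omega> + \<gamma> * \<nu> s \<omega>) - \<phi> / lam * X s \<omega>)"
      by (intro set_lebesgue_integral_cong) (auto simp: algebra_simps)
    also have "\<dots> = (LBINT s:{0..t}. - \<kappa> / (2 * lam) * (- \<rho> * Y s \<omega> + \<gamma> * \<nu> s \<omega>)) - (LBINT s:{0..t}. \<phi> / lam * X s \<omega>)"
      by (intro set_integral_diff(2) set_integrable_mult_right set_integral_add(1) i)
    also have "\<dots> = - \<kappa> / (2 * lam) * (LBINT s:{0..t}. - \<rho> * Y s \<omega> + \<gamma> * \<nu> s \<omega>) - \<phi> / lam * cum X t \<omega>"
      by (simp only: set_integral_mult_right cum_def)
    also have "(LBINT s:{0..t}. - \<rho> * Y s \<omega> + \<gamma> * \<nu> s \<omega>) = Y t \<omega> - y" using elim(2) t by fastforce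
    finally show "\<nu> t \<omega> = \<nu> 0 \<omega> + (L t \<omega> + A t \<omega> - (L 0 \<omega> + A 0 \<omega>)) / (2 * lam)
      - \<kappa> / (2 * lam) * (Y t \<omega> - y) - \<phi> / lam * cum X t \<omega> + (N t \<omega> - N 0 \<omega>)"
      using elim(1) t by fastforce
  qed
qed

text \<open>The left-hand side is the Riesz representative of the derivative of the payoff at \<open>\<nu>\<close>.\<close>

lemma adjoint_identity:
  "AE \<omega> in M. \<forall>t\<in>{0..T}. S t \<omega> - 2 * lam * \<nu> t \<omega> + 2 * \<phi> * (cum X T \<omega> - cum X t \<omega>) - PT \<omega> + 2 * varrho * X T \<omega>
     = 2 * lam * (N T \<omega> - N t \<omega>)"
  using dynamics_integrated terminal
proof eventually_elim
  case (elim \<omega>)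
  show ?case
  proof
    fix t assume t: "t \<in> {0..T}"
    \<comment> \<open>Collects the terms that do not depend on time; they cancel between t and
      T.\<close>
    define c where "c = 2 * lam * \<nu> 0 \<omega> - (L 0 \<omega> + A 0 \<omega>) + \<kappa> * y - 2 * lam * N 0 \<omega>"
    have *: "2 * lam * \<nu> s \<omega> = c + (L s \<omega> + A s \<omega>) - \<kappa> * Y s \<omega> - 2 * \<phi> * cum X s \<omega> + 2 * lam * N s \<omega>" if "s \<in> {0..T}" for s
    proof -
      have k: "2 * lam * (a / (2 * lam)) = a" "2 * lam * (\<kappa> / (2 * lam) * a) = \<kappa> * a" "2 * lam * (\<phi> / lam * a) = 2 * \<phi> * a" for a
        using pos by auto
      show ?thesis
        unfolding elim(1)[rule_format, OF that] distrib_left right_diff_distrib k c_def by (simp add: algebra_simps)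
    qed
    have "2 * lam * \<nu> T \<omega> = 2 * varrho * X T \<omega> - \<kappa> * Y T \<omega>" using elim(2) pos by (simp add: field_simps)
    with *[OF t] *[OF T_in] show "S t \<omega> - 2 * lam * \<nu> t \<omega> + 2 * \<phi> * (cum X T \<omega> - cum X t \<omega>) - PT \<omega> + 2 * varrho * X T \<omega>
     = 2 * lam * (N T \<omega> - N t \<omega>)"
      by (simp add: S_def PT_def algebra_simps)
  qed
qed

text \<open>The shift z of the inventory against \<open>X\<close> has to solve z'' = (\<phi>/lam) z
  with z(0) = x - xbar and - lam z'(T) = varrho z(T). The solution is z(t) = (x - xbar) R(T - t) /
  R(T), and the added trading rate is - z'.\<close>

definition strategy :: "real \<Rightarrow> real \<Rightarrow> 'a \<Rightarrow> real" where
  "strategy x t \<omega> = \<nu> t \<omega> + (x - xbar) * (dR (T - t) / R T)"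

lemma RT_pos: "0 < R T" using R_fun_pos[of lam \<phi> varrho T] pos T_pos by simp

lemma strategy_admissible: "strategy x \<in> admissible M F T"
  unfolding strategy_def[abs_def] using RT_pos
  by (intro admissible_combine nu admissible_deterministic continuous_intros continuous_R_fun) auto

lemma sq_strategy: "sqint (strategy x)" using strategy_admissible by (simp add: admissible_iff)

lemma cum_shift: "t \<in> {0..T} \<Longrightarrow> cum (\<lambda>t \<omega>. dR (T - t) / R T) t \<omega> = 1 - R (T - t) / R T"
proof -
  assume t: "t \<in> {0..T}"
  have "- R (T - t) / R T = - R (T - 0) / R T + (LBINT s:{0..t}. dR (T - s) / R T)"
    using t pos RT_pos continuous_R_fun
    by (intro LBINT_FTC) (auto intro!: derivative_eq_intros DERIV_chain'[OF _ R_fun_deriv(1)] continuous_intros)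
  then show ?thesis using RT_pos by (simp add: cum_def)
qed

lemma inventory_strategy:
  "AE \<omega> in M. \<forall>t\<in>{0..T}. inventory x (strategy x) t \<omega> = X t \<omega> + (x - xbar) * (R (T - t) / R T)"
proof -
  have "sqint (\<lambda>t \<omega>. (x - xbar) * (dR (T - t) / R T))"
    using RT_pos by (intro sqint_cmult sqint_deterministic continuous_intros continuous_R_fun) auto
  from cum_add[OF sq_nu this] show ?thesis
  proof eventually_elim
    case (elim \<omega>)
    show ?case
    proof
      fix t assume t: "t \<in> {0..T}"
      have "cum (strategy x) t \<omega> = cum \<nu> t \<omega> + (x - xbar) * (1 - R (T - t) / R T)"
        using elim t cum_cmult[of "x - xbar" "\<lambda>t \<omega>. dR (T - t) / R T" t \<omega>] cum_shift[OF t, of \<omega>]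
        by (simp add: strategy_def[abs_def])
      then show "inventory x (strategy x) t \<omega> = X t \<omega> + (x - xbar) * (R (T - t) / R T)"
        by (simp add: inventory_eq algebra_simps)
    qed
  qed
qed

text \<open>The equation for \<open>R\<close> integrated over the remaining time, with lam R'(0) =
  varrho R(0) at the end. It makes the shift of the strategy contribute nothing to the left-hand
  side of \<open>adjoint_identity\<close>.\<close>

lemma shift_identity:
  assumes "t \<in> {0..T}"
  shows "lam * dR (T - t) = \<phi> * ((LBINT s:{0..T}. R (T - s)) - (LBINT s:{0..t}. R (T - s))) + varrho * R 0"
proof -
  have i: "set_integrable lborel {0..T} (\<lambda>s. R (T - s))"
    by (intro borel_integrable_atLeastAtMost' continuous_on_subset[OF continuous_R_fun(1)]) simp
  have "- lam / \<phi> * dR (T - T) = - lam / \<phi> * dR (T - t) + (LBINT s:{t..T}. R (T - s))"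
    using assms pos continuous_R_fun
    by (intro LBINT_FTC) (auto intro!: derivative_eq_intros DERIV_chain'[OF _ R_fun_deriv(2)])
  moreover have "lam * dR 0 = varrho * R 0" using pos by (simp add: dR_fun_def R_fun_def)
  ultimately show ?thesis using LBINT_Icc_tail[OF _ _ i, of t] assms pos by (simp add: field_simps)
qed

lemma adjoint_identity_strategy:
  "AE \<omega> in M. \<forall>t\<in>{0..T}. S t \<omega> - 2 * lam * strategy x t \<omega> + 2 * \<phi> * (cum (inventory x (strategy x)) T \<omega> - cum (inventory x (strategy x)) t \<omega>)
     - PT \<omega> + 2 * varrho * inventory x (strategy x) T \<omega> = 2 * lam * (N T \<omega> - N t \<omega>)"
proof -
  have r: "sqint (\<lambda>t \<omega>. (x - xbar) * (R (T - t) / R T))"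
    using RT_pos by (intro sqint_cmult sqint_deterministic continuous_intros continuous_R_fun) auto
  have X: "sqint X" by (rule L2_processD(1)[OF L2_X])
  have "AE \<omega> in M. \<forall>t\<in>{0..T}. cum (inventory x (strategy x)) t \<omega> = cum (\<lambda>t \<omega>. X t \<omega> + (x - xbar) * (R (T - t) / R T)) t \<omega>"
    by (intro cum_cong tr_eqI inventory_strategy sqint_inventory sq_strategy sqint_add X r)
  then show ?thesis using cum_add[OF X r] adjoint_identity inventory_strategy[of x]
  proof eventually_elim
    case (elim \<omega>)
    show ?case
    proof
      fix t assume t: "t \<in> {0..T}"
      define q where "q = (x - xbar) / R T"
      have c: "cum (inventory x (strategy x)) s \<omega> = cum X s \<omega> + q * (LBINT r:{0..s}. R (T - r))" if "s \<in> {0..T}" for s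
        using elim(1,2) that by (simp add: cum_cmult) (simp add: cum_def q_def)
      have inv: "inventory x (strategy x) T \<omega> = X T \<omega> + q * R 0" using elim(4) T_in by (fastforce simp: q_def)
      have st: "strategy x t \<omega> = \<nu> t \<omega> + q * dR (T - t)" by (simp add: strategy_def q_def)
      have s: "q * (lam * dR (T - t)) = q * (\<phi> * ((LBINT s:{0..T}. R (T - s)) - (LBINT s:{0..t}. R (T - s))) + varrho * R 0)"
        using shift_identity[OF t] by simp
      have "S t \<omega> - 2 * lam * \<nu> t \<omega> + 2 * \<phi> * (cum X T \<omega> - cum X t \<omega>) - PT \<omega> + 2 * varrho * X T \<omega>
         = 2 * lam * (N T \<omega> - N t \<omega>)" using elim(3) t by blast
      then show "S t \<omega> - 2 * lam * strategy x t \<omega> + 2 * \<phi> * (cum (inventory x (strategy x)) T \<omega> - cum (inventory x (strategy x)) t \<omega>)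
     - PT \<omega> + 2 * varrho * inventory x (strategy x) T \<omega> = 2 * lam * (N T \<omega> - N t \<omega>)"
        using s unfolding c[OF t] c[OF T_in] inv st by (simp add: algebra_simps)
    qed
  qed
qed

lemma strategy_first_order:
  assumes h: "h \<in> admissible M F T"
  shows "payoff_gradient S PT lam \<phi> varrho x (strategy x) h = 0"
proof -
  define Xv where "Xv = inventory x (strategy x)"
  have hs: "sqint h" using h by (simp add: admissible_iff)
  have Xv: "L2_process Xv" unfolding Xv_def by (rule L2_process_inventory[OF sq_strategy])
  note sX = L2_processD(1)[OF Xv]
  note U = L2_process_cum[OF sX]
  note rvX = L2_processD(2,3)[OF Xv T_in] and rvU = L2_processD(2,3)[OF U T_in]
  note sq = sqint_rv[OF rvX] sqint_rv[OF rvU] sqint_rv[OF PT_rv] L2_processD(1)[OF U] sq_S sq_strategy hs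
  have i: "integrable M (\<lambda>\<omega>. cum h T \<omega> * PT \<omega>)" "integrable M (\<lambda>\<omega>. cum h T \<omega> * Xv T \<omega>)"
    using integrable_mult_of_squares[OF cum_rv[OF hs T_in] PT_rv] integrable_mult_of_squares[OF cum_rv[OF hs T_in] rvX] by auto
  have t: "(\<integral>\<omega>. cum h T \<omega> * (PT \<omega> - 2 * varrho * Xv T \<omega>) \<partial>M) = ip (\<lambda>t. PT) h - 2 * varrho * ip (\<lambda>t. Xv T) h"
  proof -
    have e: "cum h T \<omega> * (PT \<omega> - 2 * varrho * Xv T \<omega>) = cum h T \<omega> * PT \<omega> - 2 * varrho * (cum h T \<omega> * Xv T \<omega>)" for \<omega>
      by (simp add: algebra_simps)
    show ?thesis unfolding ip_const[OF PT_rv hs] ip_const[OF rvX hs] e using i by simp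
  qed
  \<comment> \<open>Taking h out of \<open>cum h\<close> turns the whole gradient into the pairing
    of h with a single process, \<open>B\<close> below.\<close>
  have b: "ip Xv (cum h) = ip (\<lambda>t. cum Xv T) h - ip (cum Xv) h"
    using ip_by_parts[OF sX hs] ip_const[OF rvU hs] by simp
  define B where "B = (\<lambda>t \<omega>. S t \<omega> - 2 * lam * strategy x t \<omega> + 2 * \<phi> * (cum Xv T \<omega> - cum Xv t \<omega>) - PT \<omega> + 2 * varrho * Xv T \<omega>)"
  have B: "sqint B" unfolding B_def mult.assoc by (intro sqint_add sqint_diff sqint_cmult sq)
  have "ip B h = ip S h - 2 * lam * ip (strategy x) h + 2 * \<phi> * (ip (\<lambda>t. cum Xv T) h - ip (cum Xv) h)
      - ip (\<lambda>t. PT) h + 2 * varrho * ip (\<lambda>t. Xv T) h"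
    unfolding B_def mult.assoc using sq
    by (simp add: ip_add_left ip_diff_left ip_cmult_left sqint_add sqint_diff sqint_cmult)
  then have "payoff_gradient S PT lam \<phi> varrho x (strategy x) h = ip B h"
    unfolding payoff_gradient_def Xv_def[symmetric] t b by (simp add: algebra_simps)
  also have "\<dots> = ip (\<lambda>t \<omega>. 2 * lam * (N T \<omega> - N t \<omega>)) h"
    using L2_processD[OF L2(3)] T_in
    by (intro ip_cong tr_eqI adjoint_identity_strategy[of x, folded Xv_def, folded B_def] B hs sqint_cmult sqint_diff sqint_rv)
       (use adjoint_identity_strategy[of x, folded Xv_def] in \<open>simp add: B_def\<close>)
  also have "\<dots> = 2 * lam * ip (\<lambda>t \<omega>. N T \<omega> - N t \<omega>) h" by (rule ip_cmult_left)
  also have "\<dots> = 0" using ip_martingale_increment[OF L2(3) incr(2) h] by simp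
  finally show ?thesis .
qed

text \<open>\<open>parts t g\<close> is the integral of \<open>R (T - s)\<close> against \<open>dg s\<close> over \<open>(t,T]\<close>, defined for every path by parts.\<close>

definition parts :: "real \<Rightarrow> (real \<Rightarrow> real) \<Rightarrow> real" where
  "parts t g = R 0 * g T - R (T - t) * g t + (LBINT s:{t..T}. dR (T - s) * g s)"

section \<open>Weighted integrals of the dynamics and the feedback formula\<close>

lemma dR_mult_integrable: "set_integrable lborel {t..T} g \<Longrightarrow> set_integrable lborel {t..T} (\<lambda>s. dR (T - s) * g s)"
  by (rule set_integrable_Icc_mult[OF continuous_R_fun(2)])

lemma parts_add:
  "set_integrable lborel {t..T} f \<Longrightarrow> set_integrable lborel {t..T} g \<Longrightarrow> parts t (\<lambda>s. f s + g s) = parts t f + parts t g"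
  using set_integral_add(2)[OF dR_mult_integrable dR_mult_integrable, of t f g] by (simp add: parts_def distrib_left)

lemma parts_cmult: "parts t (\<lambda>s. c * g s) = c * parts t g"
proof -
  have "dR (T - s) * (c * g s) = c * (dR (T - s) * g s)" for s by simp
  then show ?thesis by (simp add: parts_def algebra_simps)
qed

lemma LBINT_dR: "t \<in> {0..T} \<Longrightarrow> (LBINT s:{t..T}. dR (T - s)) = R (T - t) - R 0"
proof -
  assume t: "t \<in> {0..T}"
  have "- R (T - T) = - R (T - t) + (LBINT s:{t..T}. dR (T - s))"
    using t pos continuous_R_fun
    by (intro LBINT_FTC) (auto intro!: derivative_eq_intros DERIV_chain'[OF _ R_fun_deriv(1)])
  then show ?thesis by simp
qed

lemma parts_const: "t \<in> {0..T} \<Longrightarrow> parts t (\<lambda>s. c) = 0"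
  by (simp add: parts_def LBINT_dR) (simp add: algebra_simps)

lemma parts_cong: "t \<in> {0..T} \<Longrightarrow> (\<And>s. s \<in> {t..T} \<Longrightarrow> f s = g s) \<Longrightarrow> parts t f = parts t g"
  unfolding parts_def by (intro arg_cong2[where f="(+)"] arg_cong2[where f="(-)"] set_lebesgue_integral_cong) auto

lemma parts_stieltjes:
  assumes t: "t \<in> {0<..<T}" and fin: "total_variation g t T < \<infinity>"
    and rc: "\<And>s. s \<in> {t..<T} \<Longrightarrow> (g \<longlongrightarrow> g s) (at_right s)"
  shows "stieltjes_integral (\<lambda>s. R (T - s) / R (T - t)) g t T = parts t g / R (T - t)"
proof -
  have Rt: "R (T - t) > 0" using t pos by (intro R_fun_pos) auto
  have "stieltjes_integral (\<lambda>s. R (T - s) / R (T - t)) g t T =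
     R (T - T) / R (T - t) * g T - R (T - t) / R (T - t) * g t - (LBINT s:{t..T}. - dR (T - s) / R (T - t) * g s)"
    using t pos Rt continuous_R_fun
    by (intro stieltjes_by_parts(1) fin rc)
      (auto intro!: derivative_eq_intros DERIV_chain'[OF _ R_fun_deriv(1)] continuous_intros)
  moreover have "(LBINT s:{t..T}. - dR (T - s) / R (T - t) * g s) = - (LBINT s:{t..T}. dR (T - s) * g s) / R (T - t)"
  proof -
    have "- dR (T - s) / R (T - t) * g s = (- 1 / R (T - t)) * (dR (T - s) * g s)" for s by simp
    then show ?thesis by (simp only: set_integral_mult_right) simp
  qed
  ultimately show ?thesis using Rt by (simp add: parts_def field_simps)
qed

text \<open>R'' = (\<phi>/lam) R is used here. \<open>parts\<close> of the integrated inventory is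
  the integral of \<open>R (T - s) * Z s\<close>, while the derivative of
  \<open>Z s * dR (T - s)\<close> is \<open>- v s * dR (T - s)\<close> minus \<phi>/lam times the
  same integrand. The integrals cancel and boundary terms remain.\<close>

lemma parts_inventory:
  assumes t: "t \<in> {0..T}" and v: "set_integrable lborel {0..T} v"
    and Z: "\<And>s. s \<in> {0..T} \<Longrightarrow> Z s = x - (LBINT r:{0..s}. v r)" and Zi: "set_integrable lborel {0..T} Z"
  shows "parts t v + \<phi> / lam * parts t (\<lambda>s. LBINT r:{0..s}. Z r) = R 0 * v T - dR 0 * Z T - (R (T - t) * v t - dR (T - t) * Z t)"
proof -
  have sub: "set_integrable lborel {t..T} v" "set_integrable lborel {t..T} Z"
    using t by (auto intro: set_integrable_subset[OF v] set_integrable_subset[OF Zi])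
  have tail: "(LBINT r:{0..s}. f r) = (LBINT r:{0..t}. f r) + (LBINT r:{t..s}. f r)" if "s \<in> {t..T}" "set_integrable lborel {0..T} f" for s and f :: "real \<Rightarrow> real"
    using that t by (intro LBINT_Icc_tail set_integrable_subset[OF that(2)]) auto
  have k: "set_integrable lborel {t..T} (\<lambda>s. - dR (T - s))" "set_integrable lborel {t..T} (\<lambda>s. - (\<phi> / lam * R (T - s)))"
  proof -
    have "continuous_on {t..T} (\<lambda>s. R (T - s))" "continuous_on {t..T} (\<lambda>s. dR (T - s))"
      by (intro continuous_on_subset[OF continuous_R_fun(1)] continuous_on_subset[OF continuous_R_fun(2)] subset_UNIV)+
    then show "set_integrable lborel {t..T} (\<lambda>s. - dR (T - s))" "set_integrable lborel {t..T} (\<lambda>s. - (\<phi> / lam * R (T - s)))"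
      using pos by (auto intro!: borel_integrable_atLeastAtMost' continuous_intros)
  qed
  have fR: "R (T - s) = R (T - t) + (LBINT r:{t..s}. - dR (T - r))" if "s \<in> {t..T}" for s
    using that by (intro LBINT_FTC R_fun_reflect_deriv pos continuous_on_minus continuous_R_fun) auto
  have fdR: "dR (T - s) = dR (T - t) + (LBINT r:{t..s}. - (\<phi> / lam * R (T - r)))" if "s \<in> {t..T}" for s
    using that by (intro LBINT_FTC R_fun_reflect_deriv pos continuous_on_minus continuous_on_mult continuous_on_const continuous_R_fun) auto
  have fZ: "Z s = Z t + (LBINT r:{t..s}. - v r)" if "s \<in> {t..T}" for s
  proof -
    have "(LBINT r:{t..s}. - v r) = - (LBINT r:{t..s}. v r)"
      using that t by (intro set_integral_uminus set_integrable_subset[OF v]) auto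
    then show ?thesis using Z[of s] Z[of t] tail[OF that v] that t by simp
  qed
  define U where "U s = (LBINT r:{0..s}. Z r)" for s
  have fU: "U s = U t + (LBINT r:{t..s}. Z r)" if "s \<in> {t..T}" for s
    unfolding U_def by (rule tail[OF that Zi])
  have mv: "set_integrable lborel {t..T} (\<lambda>s. - v s)" using set_integrable_mult_right[of "-1" lborel "{t..T}" v] sub by simp
  have 1: "(LBINT s:{t..T}. - v s * dR (T - s) + Z s * - (\<phi> / lam * R (T - s))) = Z T * dR (T - T) - Z t * dR (T - t)"
    using t by (intro ac_by_parts(2)[OF _ mv k(2) fZ fdR]) auto
  have 2: "(LBINT s:{t..T}. Z s * R (T - s) + U s * - dR (T - s)) = U T * R (T - T) - U t * R (T - t)"
    using t by (intro ac_by_parts(2)[OF _ sub(2) k(1) fU fR]) auto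
  have ZR: "set_integrable lborel {t..T} (\<lambda>s. R (T - s) * Z s)"
    by (rule set_integrable_Icc_mult[OF continuous_R_fun(1) sub(2)])
  have "set_integrable lborel {t..T} (\<lambda>s. Z s * R (T - s) + U s * - dR (T - s))"
    using t by (intro ac_by_parts(1)[OF _ sub(2) k(1) fU fR]) auto
  from set_integral_diff(1)[OF ZR this] have UdR: "set_integrable lborel {t..T} (\<lambda>s. dR (T - s) * U s)"
    by (simp add: algebra_simps)
  have "(LBINT s:{t..T}. - v s * dR (T - s) + Z s * - (\<phi> / lam * R (T - s)))
     = (LBINT s:{t..T}. (-1) * (dR (T - s) * v s) - \<phi> / lam * (R (T - s) * Z s))"
    by (intro set_lebesgue_integral_cong) (auto simp: algebra_simps)
  also have "\<dots> = (LBINT s:{t..T}. (-1) * (dR (T - s) * v s)) - (LBINT s:{t..T}. \<phi> / lam * (R (T - s) * Z s))"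
    by (intro set_integral_diff(2) set_integrable_mult_right dR_mult_integrable sub ZR)
  also have "\<dots> = - (LBINT s:{t..T}. dR (T - s) * v s) - \<phi> / lam * (LBINT s:{t..T}. R (T - s) * Z s)"
    unfolding set_integral_mult_right by (simp only: mult_minus_left mult_1)
  finally have 3: "Z T * dR (T - T) - Z t * dR (T - t) = - (LBINT s:{t..T}. dR (T - s) * v s) - \<phi> / lam * (LBINT s:{t..T}. R (T - s) * Z s)"
    unfolding 1 .
  have "(LBINT s:{t..T}. Z s * R (T - s) + U s * - dR (T - s)) = (LBINT s:{t..T}. R (T - s) * Z s - dR (T - s) * U s)"
    by (intro set_lebesgue_integral_cong) (auto simp: algebra_simps)
  also have "\<dots> = (LBINT s:{t..T}. R (T - s) * Z s) - (LBINT s:{t..T}. dR (T - s) * U s)"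
    by (intro set_integral_diff(2) ZR UdR)
  finally have 4: "U T * R (T - T) - U t * R (T - t) = (LBINT s:{t..T}. R (T - s) * Z s) - (LBINT s:{t..T}. dR (T - s) * U s)"
    unfolding 2 .
  have 5: "parts t U = (LBINT s:{t..T}. R (T - s) * Z s)"
    using 4 by (simp add: parts_def algebra_simps)
  show ?thesis unfolding U_def[symmetric] 5 using 3 by (simp add: parts_def algebra_simps)
qed

lemma feedback_identity:
  assumes t: "t \<in> {0..T}"
  shows "AE \<omega> in M. 2 * lam * (R (T - t) * \<nu> t \<omega> - dR (T - t) * X t \<omega>) =
    - (parts t (\<lambda>s. A s \<omega>) - \<kappa> * parts t (\<lambda>s. Y s \<omega>) + sqrt (\<phi> / lam) * \<kappa> * Y T \<omega>)
    - parts t (\<lambda>s. L s \<omega>) - 2 * lam * parts t (\<lambda>s. N s \<omega>)"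
  using dynamics_integrated terminal sqint_set_integrable[OF sq_nu] sqint_set_integrable[OF L2_processD(1)[OF L2_X]]
    sqint_set_integrable[OF L2_processD(1)[OF L2_Y]] sqint_set_integrable[OF L2_processD(1)[OF L2(1)]]
    sqint_set_integrable[OF L2_processD(1)[OF L2(2)]] sqint_set_integrable[OF L2_processD(1)[OF L2(3)]]
    sqint_set_integrable[OF sqint_cum[OF L2_processD(1)[OF L2_X]]]
proof eventually_elim
  case (elim \<omega>)
  have sub: "set_integrable lborel {t..T} f" if "set_integrable lborel {0..T} f" for f :: "real \<Rightarrow> real"
    using t that by (auto intro: set_integrable_subset)
  \<comment> \<open>Collects the terms fixed in time, which \<open>parts_const\<close>
    removes.\<close>
  define c where "c = \<nu> 0 \<omega> - (L 0 \<omega> + A 0 \<omega>) / (2 * lam) + \<kappa> / (2 * lam) * y - N 0 \<omega>"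
  define l where "l = 1 / (2 * lam)"
  define k where "k = - \<kappa> / (2 * lam)"
  define p where "p = - (\<phi> / lam)"
  have c1: "set_integrable lborel {0..T} (\<lambda>s. c)" by (rule borel_integrable_atLeastAtMost') simp
  note i = sub[OF c1] sub[OF elim(5)] sub[OF elim(6)] sub[OF elim(7)] sub[OF elim(8)] sub[OF elim(9)]
  have "parts t (\<lambda>s. \<nu> s \<omega>) = parts t (\<lambda>s. c + (l * L s \<omega> + (l * A s \<omega> + (k * Y s \<omega> + (p * cum X s \<omega> + N s \<omega>)))))"
  proof (rule parts_cong[OF t])
    fix s assume "s \<in> {t..T}"
    then have "s \<in> {0..T}" using t by auto
    then show "\<nu> s \<omega> = c + (l * L s \<omega> + (l * A s \<omega> + (k * Y s \<omega> + (p * cum X s \<omega> + N s \<omega>))))"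
      using elim(1)[rule_format, of s] by (simp add: c_def l_def k_def p_def add_divide_distrib diff_divide_distrib right_diff_distrib)
  qed
  also have "\<dots> = l * parts t (\<lambda>s. L s \<omega>) + (l * parts t (\<lambda>s. A s \<omega>) + (k * parts t (\<lambda>s. Y s \<omega>) + (p * parts t (\<lambda>s. cum X s \<omega>) + parts t (\<lambda>s. N s \<omega>))))"
    using i t by (simp add: parts_add parts_cmult parts_const set_integral_add(1) set_integrable_mult_right)
  finally have 1: "parts t (\<lambda>s. \<nu> s \<omega>) = \<dots>" .
  have 2: "parts t (\<lambda>s. \<nu> s \<omega>) + \<phi> / lam * parts t (\<lambda>s. cum X s \<omega>) = R 0 * \<nu> T \<omega> - dR 0 * X T \<omega> - (R (T - t) * \<nu> t \<omega> - dR (T - t) * X t \<omega>)"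
    using parts_inventory[OF t elim(3) _ elim(4), of xbar] by (simp add: inventory_def cum_def)
  \<comment> \<open>The inventory drops out because \<open>dR 0 / R 0 = varrho / lam\<close>. What
    remains, with the factor \<open>R 0 = sqrt (\<phi> / lam)\<close>, becomes the last term of the
    feedback formula.\<close>
  have 3: "R 0 * \<nu> T \<omega> - dR 0 * X T \<omega> = sqrt (\<phi> / lam) * (k * Y T \<omega>)"
    using elim(2) by (simp add: R_fun_def dR_fun_def k_def right_diff_distrib)
  have "R (T - t) * \<nu> t \<omega> - dR (T - t) * X t \<omega> = sqrt (\<phi> / lam) * (k * Y T \<omega>) - l * parts t (\<lambda>s. L s \<omega>) - l * parts t (\<lambda>s. A s \<omega>) - k * parts t (\<lambda>s. Y s \<omega>) - parts t (\<lambda>s. N s \<omega>)"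
    using 1 2 3 by (simp add: p_def)
  then have "2 * lam * (R (T - t) * \<nu> t \<omega> - dR (T - t) * X t \<omega>) = 2 * lam * (sqrt (\<phi> / lam) * (k * Y T \<omega>) - l * parts t (\<lambda>s. L s \<omega>) - l * parts t (\<lambda>s. A s \<omega>) - k * parts t (\<lambda>s. Y s \<omega>) - parts t (\<lambda>s. N s \<omega>))"
    by (simp only:)
  also have "\<dots> = sqrt (\<phi> / lam) * ((2 * lam * k) * Y T \<omega>) - (2 * lam * l) * parts t (\<lambda>s. L s \<omega>)
     - (2 * lam * l) * parts t (\<lambda>s. A s \<omega>) - (2 * lam * k) * parts t (\<lambda>s. Y s \<omega>) - 2 * lam * parts t (\<lambda>s. N s \<omega>)"
    by (simp add: algebra_simps)
  finally have "2 * lam * (R (T - t) * \<nu> t \<omega> - dR (T - t) * X t \<omega>) = \<dots>" .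
  moreover have "2 * lam * k = - \<kappa>" "2 * lam * l = 1" using pos by (simp_all add: k_def l_def)
  ultimately show ?case by simp
qed

text \<open>For martingale increments the mean of \<open>indicator B \<omega> * K s \<omega>\<close>
  is one and the same number for all s in [t,T]. By Fubini the claim becomes that of a constant
  path, where the boundary terms and the integral cancel.\<close>

lemma parts_rv:
  assumes K: "L2_process K" and t: "t \<in> {0..T}"
  shows "integrable M (\<lambda>\<omega>. parts t (\<lambda>s. K s \<omega>))"
    and "martingale_increments K \<Longrightarrow> B \<in> sets (F t) \<Longrightarrow> (\<integral>\<omega>. indicator B \<omega> * parts t (\<lambda>s. K s \<omega>) \<partial>M) = 0"
proof -
  define w where "w s \<omega> = dR (T - s) * K s \<omega>" for s \<omega>
  have w: "sqint w" unfolding w_def[abs_def] by (rule sqint_bounded_mult[OF continuous_R_fun(2) L2_processD(1)[OF K]])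
  note wm[measurable] = sqint_measurable[OF w]
  have wi: "integrable (M \<Otimes>\<^sub>M lborel) (tr w)"
  proof -
    have e: "(\<lambda>x. tr w x * tr (\<lambda>t \<omega>. 1) x) = tr w" by (auto simp: tr_def indicator_def fun_eq_iff)
    show ?thesis using sqint_mult[OF w sqint_deterministic[of "\<lambda>_. 1"]] unfolding e by simp
  qed
  have tri: "(LBINT s:{t..T}. dR (T - s) * K s \<omega>) = (\<integral>s. indicator {t..T} s * tr w (\<omega>, s) \<partial>lborel)" for \<omega>
    using t by (auto simp: set_lebesgue_integral_def tr_def w_def indicator_def intro!: Bochner_Integration.integral_cong)
  have zi: "integrable (M \<Otimes>\<^sub>M lborel) (\<lambda>(\<omega>, s). b \<omega> * (indicator {t..T} s * tr w (\<omega>, s)))"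
    if [measurable]: "b \<in> borel_measurable M" and b: "\<And>\<omega>. \<bar>b \<omega>\<bar> \<le> 1" for b :: "'a \<Rightarrow> real"
  proof (rule Bochner_Integration.integrable_bound[OF wi])
    show "AE x in M \<Otimes>\<^sub>M lborel. norm (case x of (\<omega>, s) \<Rightarrow> b \<omega> * (indicator {t..T} s * tr w (\<omega>, s))) \<le> norm (tr w x)"
    proof (rule AE_I2)
      fix x :: "'a \<times> real"
      have "\<bar>b (fst x)\<bar> * \<bar>tr w x\<bar> \<le> 1 * \<bar>tr w x\<bar>" by (rule mult_right_mono[OF b]) simp
      then show "norm (case x of (\<omega>, s) \<Rightarrow> b \<omega> * (indicator {t..T} s * tr w (\<omega>, s))) \<le> norm (tr w x)"
        by (cases x; cases "snd x \<in> {t..T}") (simp_all add: abs_mult)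
    qed
  qed measurable
  have I: "integrable M (\<lambda>\<omega>. LBINT s:{t..T}. dR (T - s) * K s \<omega>)"
  proof -
    have "integrable (M \<Otimes>\<^sub>M lborel) (\<lambda>(\<omega>, s). 1 * (indicator {t..T} s * tr w (\<omega>, s)))" by (rule zi) auto
    from Pr.integrable_fst[OF this] show ?thesis unfolding tri by simp
  qed
  note KT = L2_processD(4)[OF K T_in] and Kt = L2_processD(4)[OF K t]
  show "integrable M (\<lambda>\<omega>. parts t (\<lambda>s. K s \<omega>))"
    unfolding parts_def
    by (intro Bochner_Integration.integrable_add Bochner_Integration.integrable_diff integrable_mult_right KT Kt I)
  assume incr: "martingale_increments K" and B: "B \<in> sets (F t)"
  have BM[measurable]: "B \<in> sets M" using B sets_F_subset[of t] t by auto
  define e where "e = (\<integral>\<omega>. indicator B \<omega> * K t \<omega> \<partial>M)"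
  have inc: "(\<integral>\<omega>. indicator B \<omega> * K s \<omega> \<partial>M) = e" if "s \<in> {t..T}" for s
    using incr[unfolded martingale_increments_def, rule_format, of t s B] B that t by (simp add: e_def)
  have zB: "integrable (M \<Otimes>\<^sub>M lborel) (\<lambda>(\<omega>, s). indicator B \<omega> * (indicator {t..T} s * tr w (\<omega>, s)))"
    by (rule zi) auto
  have "(\<integral>\<omega>. indicator B \<omega> * (LBINT s:{t..T}. dR (T - s) * K s \<omega>) \<partial>M)
     = (\<integral>\<omega>. (\<integral>s. indicator B \<omega> * (indicator {t..T} s * tr w (\<omega>, s)) \<partial>lborel) \<partial>M)"
    unfolding tri by simp
  also have "\<dots> = (\<integral>s. (\<integral>\<omega>. indicator B \<omega> * (indicator {t..T} s * tr w (\<omega>, s)) \<partial>M) \<partial>lborel)"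
    using Pr.integral_fst[OF zB] Pr.integral_snd[OF zB] by simp
  also have "\<dots> = (\<integral>s. e * (indicator {t..T} s *\<^sub>R dR (T - s)) \<partial>lborel)"
  proof (rule Bochner_Integration.integral_cong[OF refl])
    fix s
    show "(\<integral>\<omega>. indicator B \<omega> * (indicator {t..T} s * tr w (\<omega>, s)) \<partial>M) = e * (indicator {t..T} s *\<^sub>R dR (T - s))"
    proof (cases "s \<in> {t..T}")
      case True
      then have "(\<integral>\<omega>. indicator B \<omega> * (indicator {t..T} s * tr w (\<omega>, s)) \<partial>M) = (\<integral>\<omega>. dR (T - s) * (indicator B \<omega> * K s \<omega>) \<partial>M)"
        using t by (intro Bochner_Integration.integral_cong) (auto simp: tr_def w_def)
      then show ?thesis using inc[OF True] True by simp
    qed simp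
  qed
  also have "\<dots> = e * (R (T - t) - R 0)"
    using LBINT_dR[OF t] by (simp add: set_lebesgue_integral_def)
  finally have J: "(\<integral>\<omega>. indicator B \<omega> * (LBINT s:{t..T}. dR (T - s) * K s \<omega>) \<partial>M) = e * (R (T - t) - R 0)" .
  have bi: "integrable M (\<lambda>\<omega>. indicator B \<omega> * f \<omega>)" if "integrable M f" for f :: "'a \<Rightarrow> real"
    using that by (intro integrable_bounded_mult[where c=1]) auto
  have "(\<integral>\<omega>. indicator B \<omega> * parts t (\<lambda>s. K s \<omega>) \<partial>M) = (\<integral>\<omega>. R 0 * (indicator B \<omega> * K T \<omega>) - R (T - t) * (indicator B \<omega> * K t \<omega>)
      + indicator B \<omega> * (LBINT s:{t..T}. dR (T - s) * K s \<omega>) \<partial>M)"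
    by (intro Bochner_Integration.integral_cong) (auto simp: parts_def algebra_simps)
  also have "\<dots> = R 0 * e - R (T - t) * e + e * (R (T - t) - R 0)"
    using bi[OF KT] bi[OF Kt] bi[OF I] inc[of T] inc[of t] t J by simp
  also have "\<dots> = 0" by (simp add: algebra_simps)
  finally show "(\<integral>\<omega>. indicator B \<omega> * parts t (\<lambda>s. K s \<omega>) \<partial>M) = 0" .
qed

text \<open>\<open>W\<close> is \<open>F t\<close>-measurable and differs from a multiple of
  \<open>G\<close> by terms whose integral over every set of \<open>F t\<close> is 0, so it is that
  multiple of the conditional expectation. \<open>G\<close> is fixed only almost surely, to admit
  Stieltjes integrals whose measurability comes from completeness.\<close>

lemma feedback:
  assumes t: "t \<in> {0<..<T}"
    and G: "AE \<omega> in M. R (T - t) * G \<omega> = parts t (\<lambda>s. A s \<omega>) - \<kappa> * parts t (\<lambda>s. Y s \<omega>) + sqrt (\<phi> / lam) * \<kappa> * Y T \<omega>"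
  shows "AE \<omega> in M. \<nu> t \<omega> = dR (T - t) / R (T - t) * X t \<omega> - 1 / (2 * lam) * real_cond_exp M (F t) G \<omega>"
proof -
  have t': "t \<in> {0..T}" using t by auto
  interpret sigma_finite_subalgebra M "F t" using sigma_finite_subalgebra_F t' by simp
  have Rt: "R (T - t) > 0" using t pos by (intro R_fun_pos) auto
  define W where "W \<omega> = R (T - t) * \<nu> t \<omega> - dR (T - t) * X t \<omega>" for \<omega>
  define G' where "G' \<omega> = (parts t (\<lambda>s. A s \<omega>) - \<kappa> * parts t (\<lambda>s. Y s \<omega>) + sqrt (\<phi> / lam) * \<kappa> * Y T \<omega>) / R (T - t)" for \<omega>
  define Z where "Z \<omega> = parts t (\<lambda>s. L s \<omega>) + 2 * lam * parts t (\<lambda>s. N s \<omega>)" for \<omega>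
  have iL: "integrable M (\<lambda>\<omega>. parts t (\<lambda>s. L s \<omega>))" "integrable M (\<lambda>\<omega>. parts t (\<lambda>s. N s \<omega>))"
    by (intro parts_rv(1) L2 t')+
  have Gi': "integrable M G'" unfolding G'_def[abs_def]
    using parts_rv(1)[OF L2(2) t'] parts_rv(1)[OF L2_Y t'] L2_processD(4)[OF L2_Y T_in] by simp
  have GG: "AE \<omega> in M. G' \<omega> = G \<omega>" using G by eventually_elim (use Rt in \<open>simp add: G'_def field_simps\<close>)
  have Gm: "G \<in> borel_measurable M" using borel_measurable_AE_eq[OF _ GG] Gi' by auto
  have Gi: "integrable M G" using Gi' Gm GG integrable_cong_AE[of G' M G] by auto
  have Zi: "integrable M Z" unfolding Z_def[abs_def] using iL by simp
  have WG: "AE \<omega> in M. - (R (T - t) * G \<omega> + Z \<omega>) / (2 * lam) = W \<omega>"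
    using feedback_identity[OF t'] G by eventually_elim (use pos in \<open>simp add: W_def Z_def field_simps\<close>)
  have WF: "W \<in> borel_measurable (F t)"
    using nu progressive_adapted[of \<nu> t] t' unfolding W_def[abs_def] inventory_eq by (simp add: admissible_iff)
  have Wm: "W \<in> borel_measurable M" using measurable_from_F[of t W] WF t' by simp
  have "integrable M (\<lambda>\<omega>. - (R (T - t) * G \<omega> + Z \<omega>) / (2 * lam))" using Gi Zi by simp
  then have Wi: "integrable M W" using WG Wm integrable_cong_AE[of "\<lambda>\<omega>. - (R (T - t) * G \<omega> + Z \<omega>) / (2 * lam)" M W] by auto
  have "AE \<omega> in M. real_cond_exp M (F t) G \<omega> = - (2 * lam / R (T - t)) * W \<omega>"
  proof (rule real_cond_exp_charact[OF _ Gi])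
    show "integrable M (\<lambda>\<omega>. - (2 * lam / R (T - t)) * W \<omega>)" using Wi by simp
    show "(\<lambda>\<omega>. - (2 * lam / R (T - t)) * W \<omega>) \<in> borel_measurable (F t)" using WF by simp
    fix B assume B: "B \<in> sets (F t)"
    have BM[measurable]: "B \<in> sets M" using B sets_F_subset[of t] t' by auto
    have bi: "integrable M (\<lambda>\<omega>. indicator B \<omega> * f \<omega>)" if "integrable M f" for f :: "'a \<Rightarrow> real"
      using that by (intro integrable_bounded_mult[where c=1]) auto
    have Z0: "(\<integral>\<omega>. indicator B \<omega> * Z \<omega> \<partial>M) = 0"
    proof -
      have "(\<integral>\<omega>. indicator B \<omega> * Z \<omega> \<partial>M) = (\<integral>\<omega>. indicator B \<omega> * parts t (\<lambda>s. L s \<omega>) + 2 * lam * (indicator B \<omega> * parts t (\<lambda>s. N s \<omega>)) \<partial>M)"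
        by (intro Bochner_Integration.integral_cong) (auto simp: Z_def algebra_simps)
      also have "\<dots> = 0"
        using bi[OF iL(1)] bi[OF iL(2)] parts_rv(2)[OF L2(1) t' incr(1) B] parts_rv(2)[OF L2(3) t' incr(2) B] by simp
      finally show ?thesis .
    qed
    have "(\<integral>\<omega>\<in>B. - (2 * lam / R (T - t)) * W \<omega> \<partial>M) = (\<integral>\<omega>. indicator B \<omega> * G \<omega> + 1 / R (T - t) * (indicator B \<omega> * Z \<omega>) \<partial>M)"
      unfolding set_lebesgue_integral_def
    proof (rule integral_cong_AE)
      show "AE \<omega> in M. indicator B \<omega> *\<^sub>R (- (2 * lam / R (T - t)) * W \<omega>) = indicator B \<omega> * G \<omega> + 1 / R (T - t) * (indicator B \<omega> * Z \<omega>)"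
        using WG
      proof eventually_elim
        case (elim \<omega>)
        have "- (2 * lam / R (T - t)) * W \<omega> = G \<omega> + 1 / R (T - t) * Z \<omega>"
          unfolding elim[symmetric] using pos Rt by (simp add: field_simps)
        then show ?case by (simp add: indicator_def)
      qed
    qed (use Wm Gm Zi in auto)
    also have "\<dots> = (\<integral>\<omega>. indicator B \<omega> * G \<omega> \<partial>M)" using bi[OF Gi] bi[OF Zi] Z0 by simp
    finally show "(\<integral>\<omega>\<in>B. G \<omega> \<partial>M) = (\<integral>\<omega>\<in>B. - (2 * lam / R (T - t)) * W \<omega> \<partial>M)"
      by (simp add: set_lebesgue_integral_def)
  qed
  then show ?thesis
  proof eventually_elim
    case (elim \<omega>)
    show ?case unfolding elim W_def using pos Rt by (simp add: field_simps)
  qed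
qed

text \<open>The shift z satisfies - z' = (R'(T - t) / R(T - t)) z, that is, the homogeneous part of
  the feedback law. The conditional expectation is therefore common to all initial
  positions.\<close>

lemma strategy_feedback:
  assumes t: "t \<in> {0<..<T}"
    and G: "AE \<omega> in M. R (T - t) * G \<omega> = parts t (\<lambda>s. A s \<omega>) - \<kappa> * parts t (\<lambda>s. Y s \<omega>) + sqrt (\<phi> / lam) * \<kappa> * Y T \<omega>"
  shows "AE \<omega> in M. strategy x t \<omega> = dR (T - t) / R (T - t) * inventory x (strategy x) t \<omega> - 1 / (2 * lam) * real_cond_exp M (F t) G \<omega>"
  using feedback[OF t G] inventory_strategy[of x]
proof eventually_elim
  case (elim \<omega>)
  have Rt: "R (T - t) > 0" using t pos by (intro R_fun_pos) auto
  have i: "inventory x (strategy x) t \<omega> = X t \<omega> + (x - xbar) * (R (T - t) / R T)" using elim(2) t by force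
  have "dR (T - t) / R (T - t) * ((x - xbar) * (R (T - t) / R T)) = (x - xbar) * (dR (T - t) / R T)"
    using Rt by simp
  then show ?case unfolding i strategy_def distrib_left using elim(1) Rt by simp
qed

lemma strategy_average:
  assumes "(\<lambda>n. (\<Sum>i<n. x i) / real n) \<longlonglongrightarrow> xbar"
  shows "(\<lambda>n. (\<Sum>i<n. strategy (x i) t \<omega>) / real n) \<longlonglongrightarrow> \<nu> t \<omega>"
proof (rule Lim_transform_eventually)
  define g where "g = dR (T - t) / R T"
  show "(\<lambda>n. \<nu> t \<omega> + ((\<Sum>i<n. x i) / real n - xbar) * g) \<longlonglongrightarrow> \<nu> t \<omega>"
    using tendsto_add[OF tendsto_const[of "\<nu> t \<omega>"] tendsto_mult[OF tendsto_diff[OF assms tendsto_const[of xbar]] tendsto_const[of g]]] by simp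
  show "\<forall>\<^sub>F n in sequentially. \<nu> t \<omega> + ((\<Sum>i<n. x i) / real n - xbar) * g = (\<Sum>i<n. strategy (x i) t \<omega>) / real n"
    using eventually_gt_at_top[of 0]
  proof eventually_elim
    case (elim n)
    have "(\<Sum>i<n. strategy (x i) t \<omega>) = real n * \<nu> t \<omega> + ((\<Sum>i<n. x i) - real n * xbar) * g"
      by (simp add: strategy_def g_def sum.distrib sum_distrib_right[symmetric] sum_subtractf sum_divide_distrib[symmetric])
    then show ?case using elim by (simp add: field_simps)
  qed
qed

section \<open>Uniqueness of the equilibrium\<close>

lemma equilibrium_unique:
  assumes x: "(\<lambda>n. (\<Sum>i<n. x i) / real n) \<longlonglongrightarrow> xbar"
    and w: "\<And>i. w i \<in> admissible M F T" and \<mu>: "\<mu> \<in> admissible M F T"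
    and avg: "AE (\<omega>, t) in M \<Otimes>\<^sub>M restrict_space lborel {0..T}. (\<lambda>n. (\<Sum>i<n. w i t \<omega>) / real n) \<longlonglongrightarrow> \<mu> t \<omega>"
    and foc: "\<And>i h. h \<in> admissible M F T \<Longrightarrow>
      payoff_gradient (\<lambda>t \<omega>. L t \<omega> + A t \<omega> - \<kappa> * transient_impact \<gamma> \<rho> y \<mu> t \<omega>) PT lam \<phi> varrho (x i) (w i) h = 0"
  shows "AE (\<omega>, t) in M \<Otimes>\<^sub>M restrict_space lborel {0..T}. w i t \<omega> = strategy (x i) t \<omega>"
proof -
  define S' where "S' t \<omega> = L t \<omega> + A t \<omega> - \<kappa> * transient_impact \<gamma> \<rho> y \<mu> t \<omega>" for t \<omega>
  have sw: "sqint (w i)" for i using w by (simp add: admissible_iff)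
  have sm: "sqint \<mu>" using \<mu> by (simp add: admissible_iff)
  have sS': "sqint S'" unfolding S'_def[abs_def] by (intro sqint_diff sqint_add sqint_cmult L2_processD(1) L2 sqint_transient_impact sm)
  define d where "d i t \<omega> = w i t \<omega> - strategy (x i) t \<omega>" for i t \<omega>
  have sd: "sqint (d i)" for i unfolding d_def[abs_def] by (intro sqint_diff sw sq_strategy)
  have dadm: "d i \<in> admissible M F T" for i
    using admissible_combine[OF w[of i] strategy_admissible[of "x i"], of "-1"] by (simp add: d_def[abs_def])
  \<comment> \<open>Both gradients vanish, so their difference ties the deviation \<open>d i\<close>
    to the change of signal, and the latter does not involve i.\<close>
  have key: "ip (\<lambda>t \<omega>. S' t \<omega> - S t \<omega>) h = 2 * curvature_form lam \<phi> varrho (d i) h" if h: "h \<in> admissible M F T" for h i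
  proof -
    have hs: "sqint h" using h by (simp add: admissible_iff)
    have "payoff_gradient S' PT lam \<phi> varrho (x i) (w i) h = 0" using foc[OF h] by (simp add: S'_def[abs_def])
    then show ?thesis
      using payoff_gradient_diff[OF sq_strategy[of "x i"] sw[of i] hs sq_S sS' PT_rv, where x="x i" and lam=lam and \<phi>=\<phi> and varrho=varrho] strategy_first_order[OF h, of "x i"]
      by (simp add: curvature_form_def d_def[abs_def] algebra_simps)
  qed
  have eq0: "AE z in M \<Otimes>\<^sub>M lborel. tr (d i) z = tr (d 0) z" for i
  proof -
    \<comment> \<open>By \<open>key\<close> for i and for 0, \<open>curvature_form\<close> of this
      difference vanishes against every admissible direction, in particular against h
      itself.\<close>
    define h where "h t \<omega> = d i t \<omega> - d 0 t \<omega>" for t \<omega>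
    have h: "h \<in> admissible M F T" using admissible_combine[OF dadm[of i] dadm[of 0], of "-1"] by (simp add: h_def[abs_def])
    then have hs: "sqint h" by (simp add: admissible_iff)
    have "curvature_form lam \<phi> varrho h h = 0"
      using curvature_form_diff[OF sd[of i] sd[of 0] hs] key[OF h, of i] key[OF h, of 0] by (simp add: h_def[abs_def])
    then have "AE z in M \<Otimes>\<^sub>M lborel. tr h z = 0"
      using curvature_form_nonpos_imp_zero[OF pos(4-6) hs] by simp
    then show ?thesis by eventually_elim (simp add: h_def[abs_def] tr_simps)
  qed
  have mu: "AE z in M \<Otimes>\<^sub>M lborel. tr \<mu> z = tr (\<lambda>t \<omega>. \<nu> t \<omega> + d 0 t \<omega>) z"
  proof (rule sqint_AE_pairI[OF sm sqint_add[OF sq_nu sd]])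
    \<comment> \<open>There are countably many agents, so one null set serves all of them and the
      averages can be compared pointwise.\<close>
    have "AE z in M \<Otimes>\<^sub>M lborel. \<forall>i. tr (d i) z = tr (d 0) z" using eq0 by (subst AE_all_countable) blast
    from AE_pairD[OF this] AE_restrict_pairD[OF avg]
    show "AE \<omega> in M. AE t in lborel. tr \<mu> (\<omega>, t) = tr (\<lambda>t \<omega>. \<nu> t \<omega> + d 0 t \<omega>) (\<omega>, t)"
    proof eventually_elim
      case (elim \<omega>)
      then show ?case
      proof eventually_elim
        case (elim t)
        show ?case
        proof (cases "t \<in> {0..T}")
          case True
          then have di: "w i t \<omega> = strategy (x i) t \<omega> + d 0 t \<omega>" for i
            using elim(1)[rule_format, of i] by (simp add: tr_def d_def)
          have "(\<lambda>n. (\<Sum>i<n. w i t \<omega>) / real n) \<longlonglongrightarrow> \<nu> t \<omega> + d 0 t \<omega>"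
          proof (rule Lim_transform_eventually)
            show "(\<lambda>n. (\<Sum>i<n. strategy (x i) t \<omega>) / real n + d 0 t \<omega>) \<longlonglongrightarrow> \<nu> t \<omega> + d 0 t \<omega>"
              by (intro tendsto_add strategy_average x tendsto_const)
            show "\<forall>\<^sub>F n in sequentially. (\<Sum>i<n. strategy (x i) t \<omega>) / real n + d 0 t \<omega> = (\<Sum>i<n. w i t \<omega>) / real n"
              using eventually_gt_at_top[of 0] by eventually_elim (simp add: di sum.distrib add_divide_distrib)
          qed
          moreover have "(\<lambda>n. (\<Sum>i<n. w i t \<omega>) / real n) \<longlonglongrightarrow> \<mu> t \<omega>" using elim(2) True by simp
          ultimately have "\<mu> t \<omega> = \<nu> t \<omega> + d 0 t \<omega>" by (rule LIMSEQ_unique[symmetric])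
          then show ?thesis by (simp add: tr_def)
        qed (simp add: tr_def)
      qed
    qed
  qed
  have Z: "AE \<omega> in M. \<forall>t\<in>{0..T}. S' t \<omega> - S t \<omega> = - (\<kappa> * \<gamma>) * (exp (- \<rho> * t) * cum (\<lambda>s \<omega>. exp (\<rho> * s) * d 0 s \<omega>) t \<omega>)"
    using transient_impact_diff[OF sq_nu sd[of 0] sm mu[unfolded tr_simps], of \<gamma> \<rho> y]
  proof eventually_elim
    case (elim \<omega>)
    show ?case
    proof
      fix t assume "t \<in> {0..T}"
      from elim[rule_format, OF this]
      have "transient_impact \<gamma> \<rho> y \<mu> t \<omega> = Y t \<omega> + \<gamma> * (exp (- \<rho> * t) * cum (\<lambda>s \<omega>. exp (\<rho> * s) * d 0 s \<omega>) t \<omega>)" by simp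
      then show "S' t \<omega> - S t \<omega> = - (\<kappa> * \<gamma>) * (exp (- \<rho> * t) * cum (\<lambda>s \<omega>. exp (\<rho> * s) * d 0 s \<omega>) t \<omega>)"
        by (simp add: S'_def S_def algebra_simps)
    qed
  qed
  have sZ: "sqint (\<lambda>t \<omega>. exp (- \<rho> * t) * cum (\<lambda>s \<omega>. exp (\<rho> * s) * d 0 s \<omega>) t \<omega>)"
    by (intro sqint_bounded_mult[of "\<lambda>t. exp (- \<rho> * t)"] sqint_bounded_mult[of "\<lambda>t. exp (\<rho> * t)"] sqint_cum continuous_intros sd)
  \<comment> \<open>The change of signal is \<open>- (\<kappa> * \<gamma>)\<close> times the kernel
    operator applied to \<open>d 0\<close>, so its pairing with \<open>d 0\<close> is at most 0. By
    \<open>key\<close> this pairing is twice the curvature at \<open>d 0\<close>, which forces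
    \<open>d 0\<close> to vanish.\<close>
  have "ip (\<lambda>t \<omega>. S' t \<omega> - S t \<omega>) (d 0) = - (\<kappa> * \<gamma>) * ip (\<lambda>t \<omega>. exp (- \<rho> * t) * cum (\<lambda>s \<omega>. exp (\<rho> * s) * d 0 s \<omega>) t \<omega>) (d 0)"
    unfolding ip_cong[OF tr_eqI[OF Z] sqint_diff[OF sS' sq_S] sqint_cmult[OF sZ] sd] by (rule ip_cmult_left)
  also have "\<dots> \<le> 0" using ip_transient_nonneg[OF sd[of 0], of \<rho>] pos by simp
  finally have "curvature_form lam \<phi> varrho (d 0) (d 0) \<le> 0" using key[OF dadm[of 0], of 0] by simp
  then have d0: "AE z in M \<Otimes>\<^sub>M lborel. tr (d 0) z = 0"
    by (rule curvature_form_nonpos_imp_zero[OF pos(4-6) sd])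
  have "AE z in M \<Otimes>\<^sub>M lborel. tr (w i) z = tr (strategy (x i)) z"
    using d0 eq0[of i] by eventually_elim (simp add: d_def[abs_def] tr_simps)
  then show ?thesis by (rule AE_restrict_pairI[OF sw sq_strategy])
qed

end

text \<open>Passage from (MF) to the clean system: solving the linear equation makes
  \<open>Y\<close> explicit, and its integral equation gives the finite variation and
  right-continuity that the Stieltjes integral in the theorem relies on.\<close>

lemma (in usual_filtered_prob_space) fbsde_solution_core:
  assumes pos: "0 < \<kappa>" "0 < \<gamma>" "0 < \<rho>" "0 < lam" "0 < \<phi>" "0 < varrho"
    and sol: "mean_field_fbsde_solution M F T \<kappa> \<gamma> \<rho> lam \<phi> varrho y P xbar X Y \<nu>"
    and L: "L2_process L" "martingale_increments L" and A: "L2_process A"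
    and P: "AE \<omega> in M. \<forall>t\<in>{0..T}. L t \<omega> + A t \<omega> = P t \<omega>"
  obtains N where "fbsde_core M F T \<kappa> \<gamma> \<rho> lam \<phi> varrho y xbar \<nu> L A N"
    "AE \<omega> in M. \<forall>t\<in>{0..T}. Y t \<omega> = transient_impact \<gamma> \<rho> y \<nu> t \<omega>"
    "AE \<omega> in M. total_variation (\<lambda>t. Y t \<omega>) 0 T < \<infinity> \<and> (\<forall>s\<in>{0..<T}. ((\<lambda>t. Y t \<omega>) \<longlongrightarrow> Y s \<omega>) (at_right s))"
proof -
  have nu: "\<nu> \<in> admissible M F T" using sol by (simp add: mean_field_fbsde_solution_def)
  then have sq: "sqint \<nu>" by (simp add: admissible_iff)
  obtain N where N: "square_integrable_martingale M F T N" and eq: "AE \<omega> in M.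
        set_integrable lborel {0..T} (\<lambda>s. X s \<omega>) \<and>
        set_integrable lborel {0..T} (\<lambda>s. Y s \<omega>) \<and>
        (\<forall>t\<in>{0..T}.
          X t \<omega> = xbar - (LBINT s:{0..t}. \<nu> s \<omega>) \<and>
          Y t \<omega> = y + (LBINT s:{0..t}. - \<rho> * Y s \<omega> + \<gamma> * \<nu> s \<omega>) \<and>
          \<nu> t \<omega> = \<nu> 0 \<omega> + (P t \<omega> - P 0 \<omega>) / (2 * lam)
            + (LBINT s:{0..t}. \<kappa> * \<rho> / (2 * lam) * Y s \<omega> - \<kappa> * \<gamma> / (2 * lam) * \<nu> s \<omega>
                 - \<phi> / lam * X s \<omega>)
            + (N t \<omega> - N 0 \<omega>)) \<and>
        \<nu> T \<omega> = varrho / lam * X T \<omega> - \<kappa> / (2 * lam) * Y T \<omega>"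
    using sol unfolding mean_field_fbsde_solution_def by blast
  note Nf = square_integrable_martingale_facts[OF N]
  have Nc: "AE \<omega> in M. cadlag_on T (\<lambda>t. N t \<omega>)" using N by (simp add: square_integrable_martingale_def martingale_def)
  obtain N' where N': "L2_process N'" "AE \<omega> in M. \<forall>t\<in>{0..T}. N' t \<omega> = N t \<omega>"
    using L2_process_version[OF Nf(1) Nc Nf(3)] by blast
  have N'inc: "martingale_increments N'" by (rule martingale_increments_version[OF Nf(1) N' Nf(2)])
  have Yeq: "AE \<omega> in M. \<forall>t\<in>{0..T}. Y t \<omega> = transient_impact \<gamma> \<rho> y \<nu> t \<omega>"
    using eq sqint_set_integrable[OF sq]
  proof eventually_elim
    case (elim \<omega>)
    show ?case
    proof
      fix t assume t: "t \<in> {0..T}"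
      have "Y t \<omega> = exp (- \<rho> * t) * y + \<gamma> * (exp (- \<rho> * t) * (LBINT s:{0..t}. exp (\<rho> * s) * \<nu> s \<omega>))"
        using elim t by (intro linear_ode_solution[where T=T]) auto
      then show "Y t \<omega> = transient_impact \<gamma> \<rho> y \<nu> t \<omega>" by (simp add: transient_impact_eq cum_def)
    qed
  qed
  have Xeq: "AE \<omega> in M. \<forall>t\<in>{0..T}. X t \<omega> = inventory xbar \<nu> t \<omega>"
    using eq by eventually_elim (simp add: inventory_def)
  have core: "fbsde_core M F T \<kappa> \<gamma> \<rho> lam \<phi> varrho y xbar \<nu> L A N'"
  proof (unfold_locales)
    show "AE \<omega> in M. \<forall>t\<in>{0..T}. transient_impact \<gamma> \<rho> y \<nu> t \<omega> =
      y + (LBINT s:{0..t}. - \<rho> * transient_impact \<gamma> \<rho> y \<nu> s \<omega> + \<gamma> * \<nu> s \<omega>)"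
      using eq Yeq
    proof eventually_elim
      case (elim \<omega>)
      show ?case
      proof
        fix t assume t: "t \<in> {0..T}"
        have "(LBINT s:{0..t}. - \<rho> * Y s \<omega> + \<gamma> * \<nu> s \<omega>) = (LBINT s:{0..t}. - \<rho> * transient_impact \<gamma> \<rho> y \<nu> s \<omega> + \<gamma> * \<nu> s \<omega>)"
          using elim(2) t by (intro set_lebesgue_integral_cong) auto
        moreover have "Y t \<omega> = y + (LBINT s:{0..t}. - \<rho> * Y s \<omega> + \<gamma> * \<nu> s \<omega>)" using elim(1) t by blast
        moreover have "Y t \<omega> = transient_impact \<gamma> \<rho> y \<nu> t \<omega>" using elim(2) t by blast
        ultimately show "transient_impact \<gamma> \<rho> y \<nu> t \<omega> =
      y + (LBINT s:{0..t}. - \<rho> * transient_impact \<gamma> \<rho> y \<nu> s \<omega> + \<gamma> * \<nu> s \<omega>)" by simp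
      qed
    qed
    show "AE \<omega> in M. \<forall>t\<in>{0..T}. \<nu> t \<omega> = \<nu> 0 \<omega> + (L t \<omega> + A t \<omega> - (L 0 \<omega> + A 0 \<omega>)) / (2 * lam)
      + (LBINT s:{0..t}. \<kappa> * \<rho> / (2 * lam) * transient_impact \<gamma> \<rho> y \<nu> s \<omega> - \<kappa> * \<gamma> / (2 * lam) * \<nu> s \<omega>
          - \<phi> / lam * inventory xbar \<nu> s \<omega>)
      + (N' t \<omega> - N' 0 \<omega>)"
      using eq Yeq Xeq P N'(2)
    proof eventually_elim
      case (elim \<omega>)
      show ?case
      proof
        fix t assume t: "t \<in> {0..T}"
        have z: "0 \<in> {0..T}" using T_pos by simp
        have i: "(LBINT s:{0..t}. \<kappa> * \<rho> / (2 * lam) * Y s \<omega> - \<kappa> * \<gamma> / (2 * lam) * \<nu> s \<omega> - \<phi> / lam * X s \<omega>)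
          = (LBINT s:{0..t}. \<kappa> * \<rho> / (2 * lam) * transient_impact \<gamma> \<rho> y \<nu> s \<omega> - \<kappa> * \<gamma> / (2 * lam) * \<nu> s \<omega> - \<phi> / lam * inventory xbar \<nu> s \<omega>)"
          using elim(2,3) t by (intro set_lebesgue_integral_cong) auto
        have "\<nu> t \<omega> = \<nu> 0 \<omega> + (P t \<omega> - P 0 \<omega>) / (2 * lam)
            + (LBINT s:{0..t}. \<kappa> * \<rho> / (2 * lam) * Y s \<omega> - \<kappa> * \<gamma> / (2 * lam) * \<nu> s \<omega> - \<phi> / lam * X s \<omega>)
            + (N t \<omega> - N 0 \<omega>)" using elim(1) t by blast
        then show "\<nu> t \<omega> = \<nu> 0 \<omega> + (L t \<omega> + A t \<omega> - (L 0 \<omega> + A 0 \<omega>)) / (2 * lam)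
      + (LBINT s:{0..t}. \<kappa> * \<rho> / (2 * lam) * transient_impact \<gamma> \<rho> y \<nu> s \<omega> - \<kappa> * \<gamma> / (2 * lam) * \<nu> s \<omega>
          - \<phi> / lam * inventory xbar \<nu> s \<omega>)
      + (N' t \<omega> - N' 0 \<omega>)"
          unfolding i using elim(4)[rule_format, OF t] elim(4)[rule_format, OF z] elim(5)[rule_format, OF t] elim(5)[rule_format, OF z]
          by simp
      qed
    qed
    show "AE \<omega> in M. \<nu> T \<omega> = varrho / lam * inventory xbar \<nu> T \<omega> - \<kappa> / (2 * lam) * transient_impact \<gamma> \<rho> y \<nu> T \<omega>"
      using eq Yeq Xeq by eventually_elim (use T_in in auto)
  qed (use pos nu L A N' N'inc in auto)
  have "AE \<omega> in M. total_variation (\<lambda>t. Y t \<omega>) 0 T < \<infinity> \<and> (\<forall>s\<in>{0..<T}. ((\<lambda>t. Y t \<omega>) \<longlongrightarrow> Y s \<omega>) (at_right s))"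
    using eq sqint_set_integrable[OF sq]
  proof eventually_elim
    case (elim \<omega>)
    have g: "set_integrable lborel {0..T} (\<lambda>s. - \<rho> * Y s \<omega> + \<gamma> * \<nu> s \<omega>)"
      using elim by (intro set_integral_add(1) set_integrable_mult_right) auto
    have "\<And>t. t \<in> {0..T} \<Longrightarrow> Y t \<omega> = y + (LBINT s:{0..t}. - \<rho> * Y s \<omega> + \<gamma> * \<nu> s \<omega>)" using elim by blast
    from total_variation_indefinite_integral[OF g this] show ?case by blast
  qed
  then show ?thesis using core Yeq by (intro that)
qed

theorem theorem3p14:
  fixes M :: "'a measure" and F :: "real \<Rightarrow> 'a measure"
    and T \<kappa> \<gamma> \<rho> lam \<phi> varrho y xbar :: real
    and P L A X Y \<nu> :: "real \<Rightarrow> 'a \<Rightarrow> real"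
    and x :: "nat \<Rightarrow> real"
  defines "R \<equiv> R_fun lam \<phi> varrho"
  assumes "usual_filtered_prob_space M F T"
    and "0 < \<kappa>" "0 < \<gamma>" "0 < \<rho>" "0 < lam" "0 < \<phi>" "0 < varrho" "0 < y"
    and "H2_semimartingale M F T P L A"
    and "(\<lambda>N. (\<Sum>i<N. x i) / real N) \<longlonglongrightarrow> xbar"
    and "mean_field_fbsde_solution M F T \<kappa> \<gamma> \<rho> lam \<phi> varrho y P xbar X Y \<nu>"
  shows "\<exists>v. mfg_nash_equilibrium M F T \<kappa> \<gamma> \<rho> lam \<phi> varrho y P x v \<and>
    (\<forall>i. \<forall>t\<in>{0<..<T}. AE \<omega> in M.
      v i t \<omega> = deriv R (T - t) / R (T - t) * inventory (x i) (v i) t \<omega>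
        - 1 / (2 * lam) * real_cond_exp M (F t) (\<lambda>\<omega>.
            stieltjes_integral (\<lambda>s. R (T - s) / R (T - t)) (\<lambda>s. A s \<omega>) t T
            - \<kappa> * stieltjes_integral (\<lambda>s. R (T - s) / R (T - t)) (\<lambda>s. Y s \<omega>) t T
            + sqrt (\<phi> / lam) * (\<kappa> / R (T - t)) * Y T \<omega>) \<omega>) \<and>
    (\<forall>w. mfg_nash_equilibrium M F T \<kappa> \<gamma> \<rho> lam \<phi> varrho y P x w \<longrightarrow>
      (\<forall>i. AE (\<omega>, t) in M \<Otimes>\<^sub>M restrict_space lborel {0..T}. w i t \<omega> = v i t \<omega>))"
proof -
  interpret usual_filtered_prob_space M F T by fact
  note pos = \<open>0 < \<kappa>\<close> \<open>0 < \<gamma>\<close> \<open>0 < \<rho>\<close> \<open>0 < lam\<close> \<open>0 < \<phi>\<close> \<open>0 < varrho\<close>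
  obtain L' where L': "L2_process L'" "martingale_increments L'" and A: "L2_process A"
    and P: "AE \<omega> in M. \<forall>t\<in>{0..T}. L' t \<omega> + A t \<omega> = P t \<omega>"
    and Areg: "AE \<omega> in M. total_variation (\<lambda>t. A t \<omega>) 0 T < \<infinity> \<and> (\<forall>s\<in>{0..<T}. ((\<lambda>t. A t \<omega>) \<longlongrightarrow> A s \<omega>) (at_right s))"
    using H2_L2_process[OF \<open>H2_semimartingale M F T P L A\<close>] by blast
  obtain N where core: "fbsde_core M F T \<kappa> \<gamma> \<rho> lam \<phi> varrho y xbar \<nu> L' A N"
    and Yeq: "AE \<omega> in M. \<forall>t\<in>{0..T}. Y t \<omega> = transient_impact \<gamma> \<rho> y \<nu> t \<omega>"
    and Yreg: "AE \<omega> in M. total_variation (\<lambda>t. Y t \<omega>) 0 T < \<infinity> \<and> (\<forall>s\<in>{0..<T}. ((\<lambda>t. Y t \<omega>) \<longlongrightarrow> Y s \<omega>) (at_right s))"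
    using fbsde_solution_core[OF pos \<open>mean_field_fbsde_solution M F T \<kappa> \<gamma> \<rho> lam \<phi> varrho y P xbar X Y \<nu>\<close> L' A P] by blast
  interpret c: fbsde_core M F T \<kappa> \<gamma> \<rho> lam \<phi> varrho y xbar \<nu> L' A N by (rule core)
  define P' where "P' t \<omega> = L' t \<omega> + A t \<omega>" for t \<omega>
  have P'T: "P' T = c.PT" by (simp add: P'_def c.PT_def fun_eq_iff)
  have sP': "sqint P'" unfolding P'_def[abs_def] by (intro sqint_add L2_processD(1) L' A)
  have obj: "objective M T \<kappa> \<gamma> \<rho> lam \<phi> varrho y P z w \<mu> =
      payoff (\<lambda>t \<omega>. L' t \<omega> + A t \<omega> - \<kappa> * transient_impact \<gamma> \<rho> y \<mu> t \<omega>) c.PT lam \<phi> varrho z w"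
    if "w \<in> admissible M F T" "\<mu> \<in> admissible M F T" for z w \<mu>
  proof -
    have "AE \<omega> in M. \<forall>t\<in>{0..T}. P' t \<omega> = P t \<omega>" using P by (simp add: P'_def)
    from objective_eq_payoff[OF _ _ sP' c.PT_rv[folded P'T] this] show ?thesis
      using that unfolding P'T P'_def admissible_iff by blast
  qed
  have sS: "sqint (\<lambda>t \<omega>. L' t \<omega> + A t \<omega> - \<kappa> * transient_impact \<gamma> \<rho> y \<mu> t \<omega>)" if "\<mu> \<in> admissible M F T" for \<mu>
    using that by (intro sqint_diff sqint_add sqint_cmult L2_processD(1)[OF L'(1)] L2_processD(1)[OF A] sqint_transient_impact) (simp add: admissible_iff)
  \<comment> \<open>Stated for an arbitrary mean field \<mu>: with \<nu> it shows that
    \<open>v\<close> is an equilibrium, with the mean field of a competitor it yields the first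
    order conditions for uniqueness.\<close>
  have opt: "(\<forall>w\<in>admissible M F T. objective M T \<kappa> \<gamma> \<rho> lam \<phi> varrho y P z w \<mu> \<le> objective M T \<kappa> \<gamma> \<rho> lam \<phi> varrho y P z v \<mu>)
      \<longleftrightarrow> (\<forall>h\<in>admissible M F T. payoff_gradient (\<lambda>t \<omega>. L' t \<omega> + A t \<omega> - \<kappa> * transient_impact \<gamma> \<rho> y \<mu> t \<omega>) c.PT lam \<phi> varrho z v h = 0)"
    if "v \<in> admissible M F T" "\<mu> \<in> admissible M F T" for z v \<mu>
    using payoff_maximum_iff[OF that(1) sS[OF that(2)] c.PT_rv pos(4-6), of z] obj[OF _ that(2)] that(1) by simp
  define v where "v i = c.strategy (x i)" for i
  have nash: "mfg_nash_equilibrium M F T \<kappa> \<gamma> \<rho> lam \<phi> varrho y P x v"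
    unfolding mfg_nash_equilibrium_def
  proof (intro conjI allI bexI[OF _ c.nu])
    show "v i \<in> admissible M F T" for i unfolding v_def by (rule c.strategy_admissible)
    show "AE (\<omega>, t) in M \<Otimes>\<^sub>M restrict_space lborel {0..T}. (\<lambda>N. (\<Sum>i<N. v i t \<omega>) / real N) \<longlonglongrightarrow> \<nu> t \<omega>"
      unfolding v_def using c.strategy_average[OF assms(11)] by (intro AE_I2) auto
    show "\<forall>w\<in>admissible M F T. objective M T \<kappa> \<gamma> \<rho> lam \<phi> varrho y P (x i) w \<nu> \<le> objective M T \<kappa> \<gamma> \<rho> lam \<phi> varrho y P (x i) (v i) \<nu>" for i
      using opt[OF c.strategy_admissible c.nu] c.strategy_first_order by (simp add: v_def c.S_def[abs_def])
  qed
  have feedback: "AE \<omega> in M.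
      v i t \<omega> = deriv R (T - t) / R (T - t) * inventory (x i) (v i) t \<omega>
        - 1 / (2 * lam) * real_cond_exp M (F t) (\<lambda>\<omega>.
            stieltjes_integral (\<lambda>s. R (T - s) / R (T - t)) (\<lambda>s. A s \<omega>) t T
            - \<kappa> * stieltjes_integral (\<lambda>s. R (T - s) / R (T - t)) (\<lambda>s. Y s \<omega>) t T
            + sqrt (\<phi> / lam) * (\<kappa> / R (T - t)) * Y T \<omega>) \<omega>" if t: "t \<in> {0<..<T}" for i t
    unfolding R_def deriv_R_fun[OF pos(4,5)] v_def
  \<comment> \<open>Here \<open>G\<close> is the random variable inside the conditional expectation.
    Off a null set the paths of \<open>A\<close> and \<open>Y\<close> have finite variation and are
    right-continuous, and there their Stieltjes integrals are \<open>parts\<close> divided by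
    \<open>R (T - t)\<close>.\<close>
  proof (rule c.strategy_feedback[OF t])
    have Rt: "R_fun lam \<phi> varrho (T - t) > 0" using t pos by (intro R_fun_pos) auto
    show "AE \<omega> in M. R_fun lam \<phi> varrho (T - t) * (stieltjes_integral (\<lambda>s. R_fun lam \<phi> varrho (T - s) / R_fun lam \<phi> varrho (T - t)) (\<lambda>s. A s \<omega>) t T
            - \<kappa> * stieltjes_integral (\<lambda>s. R_fun lam \<phi> varrho (T - s) / R_fun lam \<phi> varrho (T - t)) (\<lambda>s. Y s \<omega>) t T
            + sqrt (\<phi> / lam) * (\<kappa> / R_fun lam \<phi> varrho (T - t)) * Y T \<omega>)
      = c.parts t (\<lambda>s. A s \<omega>) - \<kappa> * c.parts t (\<lambda>s. transient_impact \<gamma> \<rho> y \<nu> s \<omega>) + sqrt (\<phi> / lam) * \<kappa> * transient_impact \<gamma> \<rho> y \<nu> T \<omega>"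
      using Areg Yreg Yeq
    proof eventually_elim
      case (elim \<omega>)
      have st: "stieltjes_integral (\<lambda>s. R_fun lam \<phi> varrho (T - s) / R_fun lam \<phi> varrho (T - t)) g t T = c.parts t g / R_fun lam \<phi> varrho (T - t)"
        if "total_variation g 0 T < \<infinity> \<and> (\<forall>s\<in>{0..<T}. (g \<longlongrightarrow> g s) (at_right s))" for g
        using that t total_variation_mono[of 0 t T T g] by (intro c.parts_stieltjes[OF t]) (auto intro: le_less_trans)
      have "c.parts t (\<lambda>s. Y s \<omega>) = c.parts t (\<lambda>s. transient_impact \<gamma> \<rho> y \<nu> s \<omega>)"
        using elim(3) t by (intro c.parts_cong) auto
      moreover have "Y T \<omega> = transient_impact \<gamma> \<rho> y \<nu> T \<omega>" using elim(3) T_in by blast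
      ultimately show ?case
        unfolding st[OF elim(1)] st[OF elim(2)] using Rt by (simp add: field_simps)
    qed
  qed
  have unique: "AE (\<omega>, t) in M \<Otimes>\<^sub>M restrict_space lborel {0..T}. w i t \<omega> = v i t \<omega>"
    if w: "mfg_nash_equilibrium M F T \<kappa> \<gamma> \<rho> lam \<phi> varrho y P x w" for w i
  proof -
    obtain \<mu> where \<mu>: "\<mu> \<in> admissible M F T" and wa: "\<And>i. w i \<in> admissible M F T"
      and avg: "AE (\<omega>, t) in M \<Otimes>\<^sub>M restrict_space lborel {0..T}. (\<lambda>N. (\<Sum>i<N. w i t \<omega>) / real N) \<longlonglongrightarrow> \<mu> t \<omega>"
      and max: "\<And>i. \<forall>u\<in>admissible M F T. objective M T \<kappa> \<gamma> \<rho> lam \<phi> varrho y P (x i) u \<mu> \<le> objective M T \<kappa> \<gamma> \<rho> lam \<phi> varrho y P (x i) (w i) \<mu>"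
      using w unfolding mfg_nash_equilibrium_def by blast
    show ?thesis unfolding v_def
      using opt[OF wa \<mu>] max by (intro c.equilibrium_unique[OF assms(11) wa \<mu> avg]) blast
  qed
  show ?thesis using nash feedback unique by blast
qed

end
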